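(* Let $\Omega\subset\mathbb{R}^n$, $n\ge2$, be a nonempty open bounded convex set, and let $\Omega^*$ denote an open ball in $\mathbb{R}^n$ with the same volume (Lebesgue measure) as $\Omega$. Then $$\Lambda_\infty(\Omega)\ \ge\ \Lambda_\infty(\Omega^* ),$$ with equality if and only if $\Omega$ is a ball.
   Context: For a nonempty open bounded convex set $\Omega\subset\mathbb{R}^n$ let $\mathrm{Lip}_1(\Omega):=\{u\in W^{1,\infty}(\Omega):\ u\ge0 \text{ in }\Omega,\ u=1\text{ on }\partial\Omega\}$ (elements identified with their continuous representatives on $\overline\Omega$). For $\Lambda>0$ let $J_\Lambda(u):=\|\nabla u\|_\infty+\Lambda\,|\{x\in\Omega:u(x)>0\}|$ for $u\in\mathrm{Lip}_1(\Omega)$, where $\|\cdot\|_\infty$ is the $L^\infty(\Omega)$ norm and $|\cdot|$ is Lebesgue measure. Problem $(P)_\Lambda$ is to minimize $J_\Lambda$ over $\mathrm{Lip}_1(\Omega)$; a solution is a minimizer. The variational $\infty$-Bernoulli constant of $\Omega$ is $$\Lambda_\infty(\Omega):=\inf\{\Lambda>0:\ (P)_\Lambda\text{ admits a non-constant solution}\}.$$ *)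

theory Defs
  imports "HOL-Analysis.Analysis" "HOL-Probability.Essential_Supremum"
begin

text \<open>Smooth functions: all iterated partial derivatives exist and are Frechet differentiable
  (hence continuous).\<close>

primrec iterated_partial :: "'a::euclidean_space list \<Rightarrow> ('a \<Rightarrow> real) \<Rightarrow> 'a \<Rightarrow> real" where
  "iterated_partial [] f = f"
| "iterated_partial (b # bs) f = (\<lambda>x. frechet_derivative (iterated_partial bs f) (at x) b)"

definition smooth_fun :: "('a::euclidean_space \<Rightarrow> real) \<Rightarrow> bool" where
  "smooth_fun f \<longleftrightarrow> (\<forall>bs. set bs \<subseteq> Basis \<longrightarrow> (\<forall>x. iterated_partial bs f differentiable (at x)))"

definition test_functions :: "'a::euclidean_space set \<Rightarrow> ('a \<Rightarrow> real) set" where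
  "test_functions \<Omega> =
     {\<phi>. smooth_fun \<phi> \<and> compact (closure {x. \<phi> x \<noteq> 0}) \<and> closure {x. \<phi> x \<noteq> 0} \<subseteq> \<Omega>}"

definition Linf_norm :: "'a::euclidean_space set \<Rightarrow> ('a \<Rightarrow> 'b::euclidean_space) \<Rightarrow> ereal" where
  "Linf_norm \<Omega> f = esssup (lebesgue_on \<Omega>) (\<lambda>x. ereal (norm (f x)))"

definition Linf :: "'a::euclidean_space set \<Rightarrow> ('a \<Rightarrow> 'b::euclidean_space) set" where
  "Linf \<Omega> = {f \<in> borel_measurable (lebesgue_on \<Omega>). Linf_norm \<Omega> f < \<infinity>}"

definition is_weak_gradient ::
  "'a::euclidean_space set \<Rightarrow> ('a \<Rightarrow> real) \<Rightarrow> ('a \<Rightarrow> 'a) \<Rightarrow> bool" where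
  "is_weak_gradient \<Omega> u g \<longleftrightarrow>
     (\<forall>\<phi>\<in>test_functions \<Omega>. \<forall>b\<in>Basis.
        (\<integral>x. u x * frechet_derivative \<phi> (at x) b \<partial>lebesgue_on \<Omega>)
          = - (\<integral>x. (g x \<bullet> b) * \<phi> x \<partial>lebesgue_on \<Omega>))"

definition W1inf :: "'a::euclidean_space set \<Rightarrow> ('a \<Rightarrow> real) set" where
  "W1inf \<Omega> = {u \<in> Linf \<Omega>. \<exists>g \<in> Linf \<Omega>. is_weak_gradient \<Omega> u g}"

text \<open>Weak gradients are unique almost everywhere, so the essential supremum norm of the chosen
  one does not depend on the choice.\<close>

definition weak_gradient :: "'a::euclidean_space set \<Rightarrow> ('a \<Rightarrow> real) \<Rightarrow> 'a \<Rightarrow> 'a" where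
  "weak_gradient \<Omega> u = (SOME g. g \<in> Linf \<Omega> \<and> is_weak_gradient \<Omega> u g)"

text \<open>Elements are represented by functions that are continuous on the closure of the domain; their
  values outside the closure are irrelevant.\<close>

definition Lip1 :: "'a::euclidean_space set \<Rightarrow> ('a \<Rightarrow> real) set" where
  "Lip1 \<Omega> = {u \<in> W1inf \<Omega>. continuous_on (closure \<Omega>) u \<and>
                (\<forall>x\<in>\<Omega>. 0 \<le> u x) \<and> (\<forall>x\<in>frontier \<Omega>. u x = 1)}"

definition J :: "'a::euclidean_space set \<Rightarrow> real \<Rightarrow> ('a \<Rightarrow> real) \<Rightarrow> ereal" where
  "J \<Omega> \<Lambda> u =
     Linf_norm \<Omega> (weak_gradient \<Omega> u) + ereal (\<Lambda> * measure lebesgue {x\<in>\<Omega>. 0 < u x})"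

definition is_solution :: "'a::euclidean_space set \<Rightarrow> real \<Rightarrow> ('a \<Rightarrow> real) \<Rightarrow> bool" where
  "is_solution \<Omega> \<Lambda> u \<longleftrightarrow> is_arg_min (J \<Omega> \<Lambda>) (\<lambda>v. v \<in> Lip1 \<Omega>) u"

text \<open>The infimum is taken in the extended reals, so that the infimum of the empty set would
  be infinite.\<close>

definition Bernoulli_const :: "'a::euclidean_space set \<Rightarrow> ereal" where
  "Bernoulli_const \<Omega> =
     (INF \<Lambda> \<in> {\<Lambda>. 0 < \<Lambda> \<and> (\<exists>u. is_solution \<Omega> \<Lambda> u \<and> \<not> u constant_on closure \<Omega>)}. ereal \<Lambda>)"

end

theory Submission
  imports Defs "HOL-Probability.Distribution_Functions" "HOL-Computational_Algebra.Polynomial"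
begin

text \<open>Write \<open>W(t)\<close> for the volume of the inner parallel set of points at distance at least \<open>t\<close> from the
  complement of \<open>\<Omega>\<close>. An admissible \<open>u\<close> with gradient norm \<open>L\<close> is \<open>L\<close>-Lipschitz, so it vanishes only in the inner
  parallel set at distance \<open>1/L\<close>; hence \<open>J(u) \<ge> L + \<Lambda> (|\<Omega>| - W(1/L))\<close>, with equality for the truncated distance
  function, which is convex and so has one-sided directional derivatives serving as weak gradient. Comparing with
  the constant competitor, a non-constant minimizer exists if and only if \<open>\<Lambda> t W(t) \<ge> 1\<close> for some \<open>t > 0\<close>,
  and the Bernoulli constant is \<open>1 / max t W(t)\<close>.

  The Brunn--Minkowski inequality gives \<open>W(t)\<close> at most the value for the ball of the same volume. If equality
  holds for one \<open>t\<close>, then for every cut of the inner parallel set \<open>K\<close> and of the ball of radius \<open>t\<close> by parallel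
  hyperplanes in the same proportion, \<open>\<Omega>\<close> is covered by the sums of corresponding parts. Applied to the support
  point \<open>H(u)\<close> of \<open>K\<close> in direction \<open>u\<close>, this shows that \<open>e \<bullet> u = e \<bullet> v\<close> forces \<open>e \<bullet> H(u) = e \<bullet> H(v)\<close>.
  So chords of \<open>H\<close> are parallel to chords of the sphere, \<open>H(u) = c + l u\<close>, and \<open>\<Omega>\<close> is a ball.\<close>

section \<open>The Brunn--Minkowski inequality\<close>

lemma exists_proportional_cut:
  fixes A :: "'a::euclidean_space set"
  assumes A: "A \<in> lmeasurable" and e: "e \<noteq> 0" and \<theta>: "0 < \<theta>" "\<theta> < 1" and pos: "measure lebesgue A > 0"
  obtains b where "measure lebesgue (A \<inter> {x. b < e \<bullet> x}) = \<theta> * measure lebesgue A"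
proof -
  define M where "M = distr (lebesgue_on A) borel ((\<bullet>) e)"
  have meas: "(\<bullet>) e \<in> borel_measurable (lebesgue_on A)"
    by (intro measurable_restrict_space1 measurable_completion) simp
  have finM: "finite_measure (lebesgue_on A)"
    by (rule finite_measure_lebesgue_on[OF A])
  interpret M: finite_borel_measure M
    unfolding M_def
    by (intro finite_borel_measure.intro finite_measure.finite_measure_distr[OF finM meas] finite_borel_measure_axioms.intro) auto
  have mM: "measure M T = measure lebesgue (A \<inter> {x. e \<bullet> x \<in> T})" if "T \<in> sets borel" for T
  proof -
    have "measure M T = measure (lebesgue_on A) ((\<bullet>) e -` T \<inter> A)"
      unfolding M_def using that by (subst measure_distr[OF meas]) auto
    also have "\<dots> = measure lebesgue ((\<bullet>) e -` T \<inter> A)"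
      using A by (intro measure_restrict_space) (auto simp: fmeasurableD)
    finally show ?thesis by (simp add: vimage_def Int_commute)
  qed
  have nul: "measure lebesgue (A \<inter> {x. e \<bullet> x = b}) = 0" for b
    using negligible_subset[OF negligible_hyperplane[of e b]] e
    by (intro negligible_imp_measure0) auto
  have cont: "isCont (cdf M) x" for x
    using nul[of x] by (simp add: M.isCont_cdf mM)
  have tot: "measure M (space M) = measure lebesgue A"
    using mM[of UNIV] by (simp add: M.borel_UNIV)
  let ?y = "(1 - \<theta>) * measure lebesgue A"
  have y: "0 < ?y" "?y < measure lebesgue A" using \<theta> pos by auto
  obtain l where l: "cdf M l < ?y"
    using order_tendstoD(2)[OF M.cdf_lim_at_bot y(1)] by (auto simp: eventually_at_bot_linorder)
  obtain u where u: "cdf M u > ?y"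
    using order_tendstoD(1)[OF M.cdf_lim_at_top, unfolded tot, OF y(2)] by (auto simp: eventually_at_top_linorder)
  have "l \<le> u" using l u M.cdf_nondecreasing[of u l] by (cases "l \<le> u") auto
  then obtain b where b: "cdf M b = ?y"
    using IVT'[of "cdf M" l ?y u] l u cont by (auto intro: continuous_at_imp_continuous_on)
  have "measure lebesgue (A \<inter> {x. b < e \<bullet> x}) = measure lebesgue (A - A \<inter> {x. e \<bullet> x \<in> {..b}})"
    by (rule arg_cong[where f="measure lebesgue"]) auto
  also have "\<dots> = measure lebesgue A - measure lebesgue (A \<inter> {x. e \<bullet> x \<in> {..b}})"
    using fmeasurable_Int_fmeasurable[OF A, of "{x. e \<bullet> x \<in> {..b}}"]
    by (intro measurable_measure_Diff[OF A]) (auto simp: closed_halfspace_le sets_completionI_sets borel_closed fmeasurableD)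
  also have "measure lebesgue (A \<inter> {x. e \<bullet> x \<in> {..b}}) = ?y"
    using b mM[of "{..b}"] by (simp add: cdf_def)
  finally show ?thesis
    by (intro that[of b]) (simp add: algebra_simps)
qed

lemma measure_halfspace_split:
  fixes A :: "'a::euclidean_space set"
  assumes A: "A \<in> lmeasurable" and e: "e \<noteq> 0"
  shows "measure lebesgue A = measure lebesgue (A \<inter> {x. b < e \<bullet> x}) + measure lebesgue (A \<inter> {x. e \<bullet> x < b})"
proof -
  have "measure lebesgue A = measure lebesgue ((A \<inter> {x. b < e \<bullet> x}) \<union> (A \<inter> {x. e \<bullet> x < b}))"
  proof (rule measure_negligible_symdiff[symmetric, OF A])
    show "negligible (sym_diff A ((A \<inter> {x. b < e \<bullet> x}) \<union> (A \<inter> {x. e \<bullet> x < b})))"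
      by (rule negligible_subset[OF negligible_hyperplane[of e b]]) (use e in auto)
  qed
  also have "\<dots> = measure lebesgue (A \<inter> {x. b < e \<bullet> x}) + measure lebesgue (A \<inter> {x. e \<bullet> x < b})"
    by (rule measure_Un_AE) (auto intro!: fmeasurable_Int_fmeasurable[OF A] borel_open open_halfspace_gt open_halfspace_lt simp: sets_completionI_sets)
  finally show ?thesis .
qed

abbreviation (input) upper where "upper e m A \<equiv> A \<inter> {x. m < e \<bullet> x}"
abbreviation (input) lower where "lower e m A \<equiv> A \<inter> {x. e \<bullet> x < m}"

lemma lmeasurable_open_bounded: "open A \<Longrightarrow> bounded A \<Longrightarrow> A \<in> lmeasurable"
  by (simp add: bounded_set_imp_lmeasurable borel_open)

lemma open_set_plus: "open A \<Longrightarrow> open (A + B)" for A :: "'a::real_normed_vector set"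
proof -
  assume "open A"
  moreover have "A + B = (\<Union>x\<in>A. \<Union>y\<in>B. {x + y})" by (auto simp: set_plus_def)
  ultimately show ?thesis using open_sums[of A B] by auto
qed

lemma bounded_set_plus:
  fixes A B :: "'a::real_normed_vector set"
  assumes "bounded A" "bounded B"
  shows "bounded (A + B)"
proof -
  have "A + B = (\<lambda>(x, y). x + y) ` (A \<times> B)" by (auto simp: set_plus_def)
  then show ?thesis using bounded_plus[OF assms] by simp
qed

definition BM_ineq :: "'a::euclidean_space set \<Rightarrow> 'a set \<Rightarrow> 'a set \<Rightarrow> bool" where
  "BM_ineq A B C \<longleftrightarrow> root DIM('a) (measure lebesgue A) + root DIM('a) (measure lebesgue B)
      \<le> root DIM('a) (measure lebesgue C)"

lemma BM_ineq_glue: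
  fixes A B :: "'a::euclidean_space set"
  assumes A: "open A" "bounded A" and B: "open B" "bounded B" and e: "e \<noteq> 0"
    and \<theta>: "0 \<le> \<theta>" "\<theta> \<le> 1"
    and mA: "measure lebesgue (upper e a A) = \<theta> * measure lebesgue A"
    and mB: "measure lebesgue (upper e b B) = \<theta> * measure lebesgue B"
    and up: "BM_ineq (upper e a A) (upper e b B) (upper e a A + upper e b B)"
    and lo: "BM_ineq (lower e a A) (lower e b B) (lower e a A + lower e b B)"
  shows "BM_ineq A B ((upper e a A + upper e b B) \<union> (lower e a A + lower e b B))"
proof -
  let ?n = "DIM('a)"
  let ?m = "measure lebesgue"
  note lA = lmeasurable_open_bounded[OF A] and lB = lmeasurable_open_bounded[OF B]
  have mA': "?m (lower e a A) = (1 - \<theta>) * ?m A"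
    using measure_halfspace_split[OF lA e, of a] mA by (simp add: algebra_simps)
  have mB': "?m (lower e b B) = (1 - \<theta>) * ?m B"
    using measure_halfspace_split[OF lB e, of b] mB by (simp add: algebra_simps)
  have scale: "t * (root ?n (?m A) + root ?n (?m B)) ^ ?n \<le> ?m C"
    if "0 \<le> t" "?m X = t * ?m A" "?m Y = t * ?m B" "BM_ineq X Y C" for t and X Y C :: "'a set"
  proof -
    have "root ?n t * (root ?n (?m A) + root ?n (?m B)) \<le> root ?n (?m C)"
      using that by (simp add: BM_ineq_def real_root_mult distrib_left)
    then have "(root ?n t * (root ?n (?m A) + root ?n (?m B))) ^ ?n \<le> root ?n (?m C) ^ ?n"
      using that by (intro power_mono) auto
    then show ?thesis using that by (simp add: power_mult_distrib)
  qed
  have op: "open (upper e a A)" "open (upper e b B)" "open (lower e a A)" "open (lower e b B)"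
    using A B by (auto intro!: open_Int open_halfspace_gt open_halfspace_lt)
  have bd: "bounded (upper e a A)" "bounded (upper e b B)" "bounded (lower e a A)" "bounded (lower e b B)"
    using A B by (auto intro: bounded_subset)
  have lm: "upper e a A + upper e b B \<in> lmeasurable" "lower e a A + lower e b B \<in> lmeasurable"
    using op bd by (auto intro!: lmeasurable_open_bounded open_set_plus bounded_set_plus)
  have disj: "(upper e a A + upper e b B) \<inter> (lower e a A + lower e b B) = {}"
  proof -
    have "a + b < e \<bullet> z" if "z \<in> upper e a A + upper e b B" for z
      using that by (auto simp: set_plus_def inner_add_right)
    moreover have "e \<bullet> z < a + b" if "z \<in> lower e a A + lower e b B" for z
      using that by (auto simp: set_plus_def inner_add_right)
    ultimately show ?thesis by (meson disjoint_iff less_asym)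
  qed
  have "(root ?n (?m A) + root ?n (?m B)) ^ ?n
     \<le> ?m (upper e a A + upper e b B) + ?m (lower e a A + lower e b B)"
    using scale[OF \<theta>(1) mA mB up] scale[OF _ mA' mB' lo] \<theta> by (simp add: algebra_simps)
  also have "\<dots> = ?m ((upper e a A + upper e b B) \<union> (lower e a A + lower e b B))"
    using lm disj by (subst measure_Un3) auto
  finally have "root ?n ((root ?n (?m A) + root ?n (?m B)) ^ ?n) \<le> root ?n (?m ((upper e a A + upper e b B) \<union> (lower e a A + lower e b B)))"
    by simp
  then show ?thesis
    unfolding BM_ineq_def by (subst (asm) real_root_power_cancel) (auto simp: real_root_ge_zero)
qed

lemma root_prod_add_le:
  fixes p q :: "'i \<Rightarrow> real"
  assumes I: "finite I" "I \<noteq> {}" and p: "\<And>i. i \<in> I \<Longrightarrow> 0 < p i" and q: "\<And>i. i \<in> I \<Longrightarrow> 0 < q i"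
  shows "root (card I) (prod p I) + root (card I) (prod q I) \<le> root (card I) (\<Prod>i\<in>I. p i + q i)"
proof -
  let ?n = "card I" and ?s = "\<lambda>i. p i + q i"
  have n: "0 < ?n" using I by (simp add: card_gt_0_iff)
  have s: "0 < ?s i" if "i \<in> I" for i using p[OF that] q[OF that] by simp
  have am: "root ?n (\<Prod>i\<in>I. f i / ?s i) \<le> (\<Sum>i\<in>I. f i / ?s i / real ?n)"
    if f: "\<And>i. i \<in> I \<Longrightarrow> 0 < f i" for f
  proof -
    have "0 < (\<Prod>i\<in>I. f i / ?s i)" using f s by (intro prod_pos) auto
    then have "root ?n (\<Prod>i\<in>I. f i / ?s i) = (\<Prod>i\<in>I. f i / ?s i) powr (1 / real ?n)"
      using n by (simp add: root_powr_inverse)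
    then show ?thesis using arith_geom_mean[of I "\<lambda>i. f i / ?s i"] I f s by (simp add: less_imp_le)
  qed
  have "root ?n (\<Prod>i\<in>I. p i / ?s i) + root ?n (\<Prod>i\<in>I. q i / ?s i)
      \<le> (\<Sum>i\<in>I. p i / ?s i / real ?n) + (\<Sum>i\<in>I. q i / ?s i / real ?n)"
    by (intro add_mono am p q)
  also have "\<dots> = (\<Sum>i\<in>I. 1 / real ?n)"
    unfolding sum.distrib[symmetric]
    by (rule sum.cong[OF refl]) (use s in \<open>force simp: add_divide_distrib[symmetric]\<close>)
  also have "\<dots> = 1" using n by simp
  finally have "(root ?n (prod p I) + root ?n (prod q I)) / root ?n (prod ?s I) \<le> 1"
    by (simp add: prod_dividef real_root_divide add_divide_distrib)
  moreover have "0 < root ?n (prod ?s I)" using n s by (auto intro!: prod_pos)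
  ultimately show ?thesis by (simp add: divide_le_eq)
qed

lemma box_plus_box_subset:
  fixes a b c d :: "'a::euclidean_space"
  assumes ne: "box a b \<noteq> {}" "box c d \<noteq> {}"
  shows "box (a + c) (b + d) \<subseteq> box a b + box c d"
proof
  fix z assume z: "z \<in> box (a + c) (b + d)"
  have ab: "a \<bullet> i < b \<bullet> i" "c \<bullet> i < d \<bullet> i" if "i \<in> Basis" for i
    using ne that by (auto simp: box_ne_empty)
  define t where "t i = (z \<bullet> i - (a + c) \<bullet> i) / ((b + d) \<bullet> i - (a + c) \<bullet> i)" for i
  have t: "0 < t i" "t i < 1" if "i \<in> Basis" for i
    using z ab[OF that] that by (auto simp: t_def mem_box inner_add_left field_simps)
  define x where "x = (\<Sum>i\<in>Basis. (a \<bullet> i + t i * (b \<bullet> i - a \<bullet> i)) *\<^sub>R i)"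
  define y where "y = (\<Sum>i\<in>Basis. (c \<bullet> i + t i * (d \<bullet> i - c \<bullet> i)) *\<^sub>R i)"
  have xi: "x \<bullet> i = a \<bullet> i + t i * (b \<bullet> i - a \<bullet> i)" "y \<bullet> i = c \<bullet> i + t i * (d \<bullet> i - c \<bullet> i)" if "i \<in> Basis" for i
    using that by (simp_all add: x_def y_def)
  have between: "l < l + s * (u - l)" "l + s * (u - l) < u" if "0 < s" "s < 1" "l < u" for l s u :: real
  proof -
    have "0 < s * (u - l)" "s * (u - l) < 1 * (u - l)" using that by (auto intro: mult_strict_right_mono)
    then show "l < l + s * (u - l)" "l + s * (u - l) < u" by simp_all
  qed
  have "x \<in> box a b" "y \<in> box c d"
    unfolding mem_box using xi t ab between by (simp_all add: between)
  moreover have "z = x + y"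
  proof (rule euclidean_eqI)
    fix i :: 'a assume i: "i \<in> Basis"
    have "t i * ((b + d) \<bullet> i - (a + c) \<bullet> i) = z \<bullet> i - (a + c) \<bullet> i"
      using ab[OF i] by (simp add: t_def inner_add_left)
    then show "z \<bullet> i = (x + y) \<bullet> i"
      using xi[OF i] by (simp add: inner_add_left algebra_simps)
  qed
  ultimately show "z \<in> box a b + box c d" by (auto intro: set_plus_intro)
qed

lemma BM_ineq_mono:
  "BM_ineq A B C \<Longrightarrow> C \<subseteq> D \<Longrightarrow> C \<in> lmeasurable \<Longrightarrow> D \<in> lmeasurable \<Longrightarrow> BM_ineq A B D"
  unfolding BM_ineq_def
  by (erule order_trans) (auto intro!: real_root_le_mono measure_mono_fmeasurable fmeasurableD)

lemma BM_ineq_box: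
  fixes a b c d :: "'a::euclidean_space"
  assumes ne: "box a b \<noteq> {}" "box c d \<noteq> {}"
  shows "BM_ineq (box a b) (box c d) (box a b + box c d)"
proof (rule BM_ineq_mono[OF _ box_plus_box_subset[OF ne]])
  have ab: "a \<bullet> i < b \<bullet> i" "c \<bullet> i < d \<bullet> i" if "i \<in> Basis" for i
    using ne that by (auto simp: box_ne_empty)
  have m: "measure lebesgue (box l u) = (\<Prod>i\<in>Basis. (u - l) \<bullet> i)" if "\<And>i. i \<in> Basis \<Longrightarrow> l \<bullet> i < u \<bullet> i" for l u :: 'a
    using that by (simp add: measure_lborel_box less_imp_le)
  have mab: "measure lebesgue (box a b) = (\<Prod>i\<in>Basis. (b - a) \<bullet> i)" "measure lebesgue (box c d) = (\<Prod>i\<in>Basis. (d - c) \<bullet> i)"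
    by (rule m, erule ab)+
  have "measure lebesgue (box (a + c) (b + d)) = (\<Prod>i\<in>Basis. (b - a) \<bullet> i + (d - c) \<bullet> i)"
    using ab by (subst m) (auto simp: inner_add_left inner_diff_left intro!: prod.cong add_strict_mono)
  then show "BM_ineq (box a b) (box c d) (box (a + c) (b + d))"
    using root_prod_add_le[of "Basis :: 'a set" "\<lambda>i. (b - a) \<bullet> i" "\<lambda>i. (d - c) \<bullet> i"] ab
    unfolding BM_ineq_def mab by (simp add: inner_diff_left)
qed (auto intro!: lmeasurable_open_bounded open_set_plus bounded_set_plus open_box bounded_box)

definition box_family :: "'a::euclidean_space set set \<Rightarrow> bool" where
  "box_family \<A> \<longleftrightarrow> finite \<A> \<and> \<A> \<noteq> {} \<and> disjoint \<A> \<and> (\<forall>X\<in>\<A>. X \<noteq> {} \<and> (\<exists>a b. X = box a b))"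

lemma box_Int_upper:
  fixes a b :: "'a::euclidean_space"
  assumes "e \<in> Basis"
  shows "\<exists>c d. upper e m (box a b) = box c d"
proof -
  have "upper e m (box a b) = box (\<Sum>i\<in>Basis. (if i = e then max (a \<bullet> i) m else a \<bullet> i) *\<^sub>R i) b"
    using assms by (auto simp: mem_box inner_commute[of e] split: if_splits)
  then show ?thesis by blast
qed

lemma box_Int_lower:
  fixes a b :: "'a::euclidean_space"
  assumes "e \<in> Basis"
  shows "\<exists>c d. lower e m (box a b) = box c d"
proof -
  have "lower e m (box a b) = box a (\<Sum>i\<in>Basis. (if i = e then min (b \<bullet> i) m else b \<bullet> i) *\<^sub>R i)"
    using assms by (auto simp: mem_box inner_commute[of e] split: if_splits)
  then show ?thesis by blast
qed

lemma box_family_Int: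
  assumes A: "box_family \<A>" and H: "\<And>a b. \<exists>c d. box a b \<inter> H = box c d" and ne: "\<Union>\<A> \<inter> H \<noteq> {}"
  shows "\<exists>\<B>. box_family \<B> \<and> \<Union>\<B> = \<Union>\<A> \<inter> H \<and> card \<B> \<le> card \<A> \<and>
    ((\<exists>X\<in>\<A>. X \<inter> H = {}) \<longrightarrow> card \<B> < card \<A>)"
proof -
  define \<B> where "\<B> = (\<lambda>X. X \<inter> H) ` {X\<in>\<A>. X \<inter> H \<noteq> {}}"
  have fin: "finite \<A>" using A by (simp add: box_family_def)
  have dis: "disjoint \<A>" using A by (simp add: box_family_def)
  have 1: "box_family \<B>" unfolding box_family_def
  proof (intro conjI ballI)
    show "finite \<B>" using fin by (simp add: \<B>_def)
    show "\<B> \<noteq> {}" using ne by (auto simp: \<B>_def)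
    show "disjoint \<B>" using dis unfolding \<B>_def pairwise_def disjnt_def by blast
    fix X assume "X \<in> \<B>"
    then show "X \<noteq> {}" "\<exists>a b. X = box a b"
      using A H by (fastforce simp: \<B>_def box_family_def)+
  qed
  have 2: "\<Union>\<B> = \<Union>\<A> \<inter> H" by (auto simp: \<B>_def)
  have c: "card \<B> \<le> card {X\<in>\<A>. X \<inter> H \<noteq> {}}" using fin by (simp add: \<B>_def card_image_le)
  also have "\<dots> \<le> card \<A>" using fin by (auto intro: card_mono)
  finally have 3: "card \<B> \<le> card \<A>" .
  have 4: "card \<B> < card \<A>" if "\<exists>X\<in>\<A>. X \<inter> H = {}"
  proof -
    have "card {X\<in>\<A>. X \<inter> H \<noteq> {}} < card \<A>" using fin that by (intro psubset_card_mono) auto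
    with c show ?thesis by simp
  qed
  show ?thesis using 1 2 3 4 by blast
qed

lemma box_family_open: "box_family \<A> \<Longrightarrow> open (\<Union>\<A>)"
  by (auto simp: box_family_def intro!: open_Union)

lemma box_family_bounded: "box_family \<A> \<Longrightarrow> bounded (\<Union>\<A>)"
  by (auto simp: box_family_def intro!: bounded_Union)

lemma box_family_nonempty: "box_family \<A> \<Longrightarrow> \<Union>\<A> \<noteq> {}"
  by (auto simp: box_family_def)

lemma measure_open_pos: "open A \<Longrightarrow> bounded A \<Longrightarrow> A \<noteq> {} \<Longrightarrow> 0 < measure lebesgue A"
  using open_not_negligible[of A] lmeasurable_open_bounded[of A]
  by (metis negligible_iff_measure zero_less_measure_iff)

lemma BM_ineq_commute: "BM_ineq A B (A + B) \<Longrightarrow> BM_ineq B A (B + A)"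
  by (simp add: BM_ineq_def add.commute)

text \<open>Hadwiger--Ohmann: a coordinate hyperplane separating two boxes of the first family, together
  with the parallel hyperplane cutting the second union in the same proportion, leaves fewer boxes
  on either side.\<close>

lemma BM_ineq_box_family:
  fixes \<A> \<B> :: "'a::euclidean_space set set"
  assumes "box_family \<A>" "box_family \<B>"
  shows "BM_ineq (\<Union>\<A>) (\<Union>\<B>) (\<Union>\<A> + \<Union>\<B>)"
  using assms
proof (induction "card \<A> + card \<B>" arbitrary: \<A> \<B> rule: less_induct)
  case less
  have step: "BM_ineq (\<Union>\<A>) (\<Union>\<B>) (\<Union>\<A> + \<Union>\<B>)"
    if A: "box_family \<A>" and B: "box_family \<B>" and c: "card \<A> \<noteq> 1"
      and IH: "\<And>\<A>' \<B>' :: 'a set set. box_family \<A>' \<Longrightarrow> box_family \<B>' \<Longrightarrow> card \<A>' < card \<A> \<Longrightarrow> card \<B>' \<le> card \<B> \<Longrightarrow>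
         BM_ineq (\<Union>\<A>') (\<Union>\<B>') (\<Union>\<A>' + \<Union>\<B>')"
    for \<A> \<B> :: "'a set set"
  proof -
    have "card \<A> \<noteq> 0" using A by (auto simp: box_family_def)
    then have "\<not> is_singleton \<A>" "\<A> \<noteq> {}" using c by (auto simp: is_singleton_altdef)
    then obtain X Y where XY: "X \<in> \<A>" "Y \<in> \<A>" "X \<noteq> Y"
      by (metis is_singletonI' ex_in_conv)
    then have disj: "X \<inter> Y = {}" using A by (auto simp: box_family_def pairwise_def disjnt_def)
    have "\<exists>i\<in>Basis. \<exists>m. \<exists>X\<in>\<A>. \<exists>Y\<in>\<A>. X \<subseteq> {x. i \<bullet> x < m} \<and> Y \<subseteq> {x. m < i \<bullet> x}"
    proof -
      obtain a b c d where X: "X = box a b" "X \<noteq> {}" and Y: "Y = box c d" "Y \<noteq> {}"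
        using A XY by (metis box_family_def)
      then obtain i where i: "i \<in> Basis" "b \<bullet> i \<le> c \<bullet> i \<or> d \<bullet> i \<le> a \<bullet> i"
        using disj unfolding X Y disjoint_interval by (auto simp: box_ne_empty leD)
      show ?thesis
      proof (cases "b \<bullet> i \<le> c \<bullet> i")
        case True
        then have "X \<subseteq> {x. i \<bullet> x < b \<bullet> i}" "Y \<subseteq> {x. b \<bullet> i < i \<bullet> x}"
          using i X Y by (auto simp: mem_box inner_commute[of i] intro: less_le_trans le_less_trans)
        then show ?thesis using XY i(1) by blast
      next
        case False
        then have "Y \<subseteq> {x. i \<bullet> x < d \<bullet> i}" "X \<subseteq> {x. d \<bullet> i < i \<bullet> x}"
          using i X Y by (auto simp: mem_box inner_commute[of i] intro: less_le_trans le_less_trans)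
        then show ?thesis using XY i(1) by blast
      qed
    qed
    then obtain i m X Y where i: "i \<in> Basis" and XY: "X \<in> \<A>" "Y \<in> \<A>"
      and X: "X \<subseteq> {x. i \<bullet> x < m}" and Y: "Y \<subseteq> {x. m < i \<bullet> x}"
      by blast
    have i0: "i \<noteq> 0" using i by (auto simp: nonzero_Basis)
    note oA = box_family_open[OF A] and bA = box_family_bounded[OF A]
    note oB = box_family_open[OF B] and bB = box_family_bounded[OF B]
    have Xne: "X \<noteq> {}" "Y \<noteq> {}" using XY A by (auto simp: box_family_def)
    have neA: "upper i m (\<Union>\<A>) \<noteq> {}" "lower i m (\<Union>\<A>) \<noteq> {}"
      using XY X Y Xne by blast+
    have pos: "0 < measure lebesgue (upper i m (\<Union>\<A>))" "0 < measure lebesgue (lower i m (\<Union>\<A>))"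
      "0 < measure lebesgue (\<Union>\<A>)" "0 < measure lebesgue (\<Union>\<B>)"
      by (intro measure_open_pos open_Int open_halfspace_gt open_halfspace_lt bounded_Int disjI1
          oA bA oB bB neA box_family_nonempty[OF A] box_family_nonempty[OF B])+
    define \<theta> where "\<theta> = measure lebesgue (upper i m (\<Union>\<A>)) / measure lebesgue (\<Union>\<A>)"
    have mA: "measure lebesgue (upper i m (\<Union>\<A>)) = \<theta> * measure lebesgue (\<Union>\<A>)"
      using pos by (simp add: \<theta>_def)
    note lA = lmeasurable_open_bounded[OF oA bA] and lB = lmeasurable_open_bounded[OF oB bB]
    have \<theta>: "0 < \<theta>" "\<theta> < 1"
      using pos measure_halfspace_split[OF lA i0, of m] by (auto simp: \<theta>_def)
    obtain b where mB: "measure lebesgue (upper i b (\<Union>\<B>)) = \<theta> * measure lebesgue (\<Union>\<B>)"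
      using exists_proportional_cut[OF lB i0 \<theta> pos(4)] .
    have mB': "measure lebesgue (lower i b (\<Union>\<B>)) = (1 - \<theta>) * measure lebesgue (\<Union>\<B>)"
      using measure_halfspace_split[OF lB i0, of b] mB by (simp add: algebra_simps)
    have posB: "0 < measure lebesgue (upper i b (\<Union>\<B>))" "0 < measure lebesgue (lower i b (\<Union>\<B>))"
      unfolding mB mB' by (rule mult_pos_pos[OF \<theta>(1) pos(4)], rule mult_pos_pos[OF _ pos(4)]) (simp add: \<theta>)
    have "X \<noteq> {}" if "0 < measure lebesgue X" for X :: "'a set"
      using that by auto
    note neB = this[OF posB(1)] this[OF posB(2)]
    have missed: "\<exists>Z\<in>\<A>. upper i m Z = {}" "\<exists>Z\<in>\<A>. lower i m Z = {}"
    proof -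
      have "upper i m X = {}" "lower i m Y = {}" using X Y by force+
      then show "\<exists>Z\<in>\<A>. upper i m Z = {}" "\<exists>Z\<in>\<A>. lower i m Z = {}" using XY by (auto intro: bexI)
    qed
    obtain \<A>1 where A1: "box_family \<A>1" "\<Union>\<A>1 = upper i m (\<Union>\<A>)" "card \<A>1 < card \<A>"
      using box_family_Int[OF A box_Int_upper[OF i] neA(1)] missed(1) by (elim exE conjE) simp
    obtain \<A>2 where A2: "box_family \<A>2" "\<Union>\<A>2 = lower i m (\<Union>\<A>)" "card \<A>2 < card \<A>"
      using box_family_Int[OF A box_Int_lower[OF i] neA(2)] missed(2) by (elim exE conjE) simp
    obtain \<B>1 where B1: "box_family \<B>1" "\<Union>\<B>1 = upper i b (\<Union>\<B>)" "card \<B>1 \<le> card \<B>"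
      using box_family_Int[OF B box_Int_upper[OF i] neB(1)] by (elim exE conjE) simp
    obtain \<B>2 where B2: "box_family \<B>2" "\<Union>\<B>2 = lower i b (\<Union>\<B>)" "card \<B>2 \<le> card \<B>"
      using box_family_Int[OF B box_Int_lower[OF i] neB(2)] by (elim exE conjE) simp
    have lsum: "\<Union>\<A>' + \<Union>\<B>' \<in> lmeasurable" if "box_family \<A>'" "box_family \<B>'" for \<A>' \<B>' :: "'a set set"
      using that by (intro lmeasurable_open_bounded open_set_plus bounded_set_plus box_family_open box_family_bounded)
    show ?thesis
    proof (rule BM_ineq_mono[OF BM_ineq_glue[OF oA bA oB bB i0 _ _ mA mB]])
      show "BM_ineq (upper i m (\<Union>\<A>)) (upper i b (\<Union>\<B>)) (upper i m (\<Union>\<A>) + upper i b (\<Union>\<B>))"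
        using IH[OF A1(1) B1(1) A1(3) B1(3)] unfolding A1(2) B1(2) .
      show "BM_ineq (lower i m (\<Union>\<A>)) (lower i b (\<Union>\<B>)) (lower i m (\<Union>\<A>) + lower i b (\<Union>\<B>))"
        using IH[OF A2(1) B2(1) A2(3) B2(3)] unfolding A2(2) B2(2) .
      show "upper i m (\<Union>\<A>) + upper i b (\<Union>\<B>) \<union> (lower i m (\<Union>\<A>) + lower i b (\<Union>\<B>)) \<in> lmeasurable"
        using lsum[OF A1(1) B1(1)] lsum[OF A2(1) B2(1)] unfolding A1(2) A2(2) B1(2) B2(2) by (rule fmeasurable.Un)
      show "\<Union>\<A> + \<Union>\<B> \<in> lmeasurable"
        using oA bA oB bB by (intro lmeasurable_open_bounded open_set_plus bounded_set_plus)
      show "upper i m (\<Union>\<A>) + upper i b (\<Union>\<B>) \<union> (lower i m (\<Union>\<A>) + lower i b (\<Union>\<B>)) \<subseteq> \<Union>\<A> + \<Union>\<B>"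
        by (intro Un_least set_plus_mono2) auto
    qed (use \<theta> in auto)
  qed
  show ?case
  proof (cases "card \<A> = 1")
    case False
    show ?thesis
    proof (rule step[OF less.prems False])
      fix \<A>' \<B>' :: "'a set set"
      assume *: "box_family \<A>'" "box_family \<B>'" "card \<A>' < card \<A>" "card \<B>' \<le> card \<B>"
      show "BM_ineq (\<Union>\<A>') (\<Union>\<B>') (\<Union>\<A>' + \<Union>\<B>')"
        by (rule less.hyps[OF add_less_le_mono[OF *(3,4)] *(1,2)])
    qed
  next
    case cA: True
    show ?thesis
    proof (cases "card \<B> = 1")
      case False
      have "BM_ineq (\<Union>\<B>) (\<Union>\<A>) (\<Union>\<B> + \<Union>\<A>)"
      proof (rule step[OF less.prems(2,1) False])
        fix \<B>' \<A>' :: "'a set set"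
        assume *: "box_family \<B>'" "box_family \<A>'" "card \<B>' < card \<B>" "card \<A>' \<le> card \<A>"
        show "BM_ineq (\<Union>\<B>') (\<Union>\<A>') (\<Union>\<B>' + \<Union>\<A>')"
          by (rule BM_ineq_commute, rule less.hyps[OF add_le_less_mono[OF *(4,3)] *(2,1)])
      qed
      then show ?thesis by (rule BM_ineq_commute)
    next
      case True
      obtain X where X: "\<A> = {X}" using cA by (rule card_1_singletonE)
      obtain Y where Y: "\<B> = {Y}" using True by (rule card_1_singletonE)
      have "X \<noteq> {}" "\<exists>a b. X = box a b" "Y \<noteq> {}" "\<exists>c d. Y = box c d"
        using less.prems unfolding box_family_def X Y by simp_all
      then obtain a b c d where "X = box a b" "X \<noteq> {}" "Y = box c d" "Y \<noteq> {}" by iprover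
      then show ?thesis using BM_ineq_box[of a b c d] unfolding X Y by simp
    qed
  qed
qed

lemma exists_box_family_approx:
  fixes A :: "'a::euclidean_space set"
  assumes A: "open A" "bounded A" "A \<noteq> {}"
  obtains U where "\<And>n. box_family (U n)" "\<And>n. \<Union>(U n) \<subseteq> A"
    "(\<lambda>n::nat. measure lebesgue (\<Union>(U n))) \<longlonglongrightarrow> measure lebesgue A"
proof -
  obtain a where a: "A \<subseteq> cbox (-a) a" using A(2) bounded_subset_cbox_symmetric by blast
  have "box (-a) a \<noteq> {}"
    using interior_mono[OF a] A by (auto simp: interior_open)
  moreover have "gauge (\<lambda>x. if x \<in> A then A else UNIV)" using A by (auto simp: gauge_def)
  ultimately obtain \<D> where D: "countable \<D>" "\<Union>\<D> \<subseteq> cbox (-a) a"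
    "\<And>K. K \<in> \<D> \<Longrightarrow> interior K \<noteq> {} \<and> (\<exists>c d. K = cbox c d)"
    "pairwise (\<lambda>A B. interior A \<inter> interior B = {}) \<D>"
    "\<And>K. K \<in> \<D> \<Longrightarrow> \<exists>x \<in> A \<inter> K. K \<subseteq> (if x \<in> A then A else UNIV)"
    "A \<subseteq> \<Union>\<D>"
    by (rule covering_lemma[OF a]) (rule that; assumption)
  have DA: "K \<subseteq> A" if "K \<in> \<D>" for K using D(5)[OF that] by auto
  have Dne: "\<D> \<noteq> {}" using D(6) A(3) by auto
  define f where "f = from_nat_into \<D>"
  have fD: "f k \<in> \<D>" for k using from_nat_into[OF Dne] by (simp add: f_def)
  have ran: "range f = \<D>" using D(1) Dne by (simp add: f_def)
  have fbox: "\<exists>c d. f k = cbox c d \<and> interior (f k) = box c d" for k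
  proof -
    obtain c d where "f k = cbox c d" using D(3)[OF fD[of k]] by iprover
    then show ?thesis using interior_cbox[of c d] by auto
  qed
  define S where "S n = (\<Union>k\<le>n. f k)" for n
  define U where "U n = (\<lambda>k. interior (f k)) ` {..n}" for n
  have UnS: "(\<Union>n. S n) = A"
  proof
    show "(\<Union>n. S n) \<subseteq> A" using DA[OF fD] unfolding S_def by (intro UN_least) simp
    have "f k \<subseteq> S k" for k unfolding S_def by (rule UN_upper) simp
    then have "(\<Union>k. f k) \<subseteq> (\<Union>n. S n)" by (rule UN_mono[OF order_refl])
    then show "A \<subseteq> (\<Union>n. S n)" using D(6) unfolding ran[symmetric] by (rule order_trans[rotated])
  qed
  have Slm: "S n \<in> lmeasurable" for n
    unfolding S_def
  proof (rule fmeasurable.finite_UN)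
    fix k show "f k \<in> lmeasurable" using fbox[of k] by (elim exE conjE) simp
  qed simp
  have lim: "(\<lambda>n. measure lebesgue (S n)) \<longlonglongrightarrow> measure lebesgue A"
    unfolding UnS[symmetric]
  proof (rule Lim_measure_incseq)
    show "range S \<subseteq> sets lebesgue" using Slm by auto
    show "incseq S" unfolding S_def by (intro incseq_SucI UN_mono) auto
    show "emeasure lebesgue (\<Union> (range S)) \<noteq> \<infinity>"
      unfolding UnS using lmeasurable_open_bounded[OF A(1,2)] by (metis fmeasurableD2 infinity_ennreal_def)
  qed
  show ?thesis
  proof (rule that[of U])
    fix n
    show "box_family (U n)" unfolding box_family_def
    proof (intro conjI ballI)
      show "finite (U n)" "U n \<noteq> {}" by (auto simp: U_def)
      show "disjoint (U n)"
      proof (rule pairwiseI)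
        fix X Y assume "X \<in> U n" "Y \<in> U n" "X \<noteq> Y"
        then obtain i k where ik: "X = interior (f i)" "Y = interior (f k)" unfolding U_def by (elim imageE)
        then have "f i \<noteq> f k" using \<open>X \<noteq> Y\<close> by auto
        then show "disjnt X Y" using pairwiseD[OF D(4) fD fD] ik by (simp add: disjnt_def)
      qed
      fix X assume "X \<in> U n"
      then obtain k where k: "X = interior (f k)" by (auto simp: U_def)
      show "X \<noteq> {}" using D(3)[OF fD[of k]] k by simp
      show "\<exists>a b. X = box a b" using fbox[of k] k by auto
    qed
    show "\<Union>(U n) \<subseteq> A" unfolding U_def
    proof (rule UN_least)
      fix k show "interior (f k) \<subseteq> A" using interior_subset DA[OF fD] by (rule order_trans)
    qed
  next
    have "measure lebesgue (\<Union>(U n)) = measure lebesgue (S n)" for n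
    proof (rule measure_negligible_symdiff[OF Slm])
      have "\<Union>(U n) \<subseteq> S n"
        unfolding S_def U_def by (intro UN_mono order_refl interior_subset)
      moreover have "S n - \<Union>(U n) \<subseteq> (\<Union>k\<le>n. f k - interior (f k))"
        unfolding S_def U_def by blast
      ultimately have "sym_diff (S n) (\<Union>(U n)) \<subseteq> (\<Union>k\<le>n. f k - interior (f k))"
        by (simp add: Diff_eq_empty_iff[THEN iffD2])
      moreover have "negligible (f k - interior (f k))" for k
      proof -
        obtain c d where "f k = cbox c d" "interior (f k) = box c d" using fbox[of k] by iprover
        then show ?thesis using negligible_frontier_interval[of c d] by simp
      qed
      then have "negligible (\<Union>k\<le>n. f k - interior (f k))"
        by (intro negligible_Union) auto
      ultimately show "negligible (sym_diff (S n) (\<Union>(U n)))"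
        by (rule negligible_subset[rotated])
    qed
    then show "(\<lambda>n. measure lebesgue (\<Union>(U n))) \<longlonglongrightarrow> measure lebesgue A"
      using lim by simp
  qed
qed

theorem Brunn_Minkowski_open:
  fixes A B :: "'a::euclidean_space set"
  assumes A: "open A" "bounded A" "A \<noteq> {}" and B: "open B" "bounded B" "B \<noteq> {}"
  shows "BM_ineq A B (A + B)"
proof -
  obtain U where U: "\<And>n. box_family (U n)" "\<And>n. \<Union>(U n) \<subseteq> A"
    "(\<lambda>n::nat. measure lebesgue (\<Union>(U n))) \<longlonglongrightarrow> measure lebesgue A"
    using exists_box_family_approx[OF A] by blast
  obtain V where V: "\<And>n. box_family (V n)" "\<And>n. \<Union>(V n) \<subseteq> B"
    "(\<lambda>n::nat. measure lebesgue (\<Union>(V n))) \<longlonglongrightarrow> measure lebesgue B"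
    using exists_box_family_approx[OF B] by blast
  have "BM_ineq (\<Union>(U n)) (\<Union>(V n)) (A + B)" for n
  proof (rule BM_ineq_mono[OF BM_ineq_box_family[OF U(1) V(1)]])
    show "\<Union>(U n) + \<Union>(V n) \<subseteq> A + B" by (rule set_plus_mono2[OF U(2) V(2)])
    show "\<Union>(U n) + \<Union>(V n) \<in> lmeasurable"
      by (intro lmeasurable_open_bounded open_set_plus bounded_set_plus box_family_open box_family_bounded U V)
    show "A + B \<in> lmeasurable" using A B by (intro lmeasurable_open_bounded open_set_plus bounded_set_plus)
  qed
  then show ?thesis unfolding BM_ineq_def
    by (intro LIMSEQ_le_const2[OF tendsto_add[OF tendsto_real_root[OF U(3)] tendsto_real_root[OF V(3)]]])
      (intro exI[of _ 0] allI impI)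
qed

section \<open>Inner parallel sets and rigidity\<close>

definition inner_parallel :: "'a::metric_space set \<Rightarrow> real \<Rightarrow> 'a set" where
  "inner_parallel \<Omega> t = {x. ball x t \<subseteq> \<Omega>}"

lemma inner_parallel_subset: "0 < t \<Longrightarrow> inner_parallel \<Omega> t \<subseteq> \<Omega>"
  by (auto simp: inner_parallel_def)

lemma closed_inner_parallel: "closed (inner_parallel \<Omega> t)"
proof -
  have "inner_parallel \<Omega> t = (\<Inter>y\<in>-\<Omega>. {x. t \<le> dist x y})"
    unfolding inner_parallel_def subset_eq by (auto simp: mem_ball) (meson ComplI not_le)+
  then show ?thesis by (auto intro!: closed_INT closed_Collect_le continuous_intros)
qed

lemma convex_inner_parallel:
  fixes \<Omega> :: "'a::real_normed_vector set"
  assumes "convex \<Omega>" shows "convex (inner_parallel \<Omega> t)"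
proof (rule convexI)
  fix x y u v assume xy: "x \<in> inner_parallel \<Omega> t" "y \<in> inner_parallel \<Omega> t" "0 \<le> u" "0 \<le> v" "u + v = (1::real)"
  have "z \<in> \<Omega>" if "z \<in> ball (u *\<^sub>R x + v *\<^sub>R y) t" for z
  proof -
    define w where "w = z - (u *\<^sub>R x + v *\<^sub>R y)"
    have "norm w < t" using that by (simp add: w_def dist_norm norm_minus_commute)
    then have "x + w \<in> \<Omega>" "y + w \<in> \<Omega>" using xy by (auto simp: inner_parallel_def subset_eq dist_norm)
    then have "u *\<^sub>R (x + w) + v *\<^sub>R (y + w) \<in> \<Omega>" using xy by (intro convexD[OF assms])
    also have "u *\<^sub>R (x + w) + v *\<^sub>R (y + w) = u *\<^sub>R x + v *\<^sub>R y + (u + v) *\<^sub>R w"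
      by (simp add: algebra_simps)
    also have "\<dots> = z" using xy by (simp add: w_def)
    finally show ?thesis .
  qed
  then show "u *\<^sub>R x + v *\<^sub>R y \<in> inner_parallel \<Omega> t" by (auto simp: inner_parallel_def)
qed

lemma inner_parallel_plus_ball:
  fixes \<Omega> :: "'a::real_normed_vector set"
  shows "inner_parallel \<Omega> t + ball 0 t \<subseteq> \<Omega>"
  by (auto simp: inner_parallel_def set_plus_def subset_eq dist_norm)

lemma inner_parallel_plus_cball:
  fixes \<Omega> :: "'a::euclidean_space set"
  assumes "0 < t"
  shows "inner_parallel \<Omega> t + cball 0 t \<subseteq> closure \<Omega>"
proof
  fix z assume "z \<in> inner_parallel \<Omega> t + cball 0 t"
  then obtain x y where z: "z = x + y" "ball x t \<subseteq> \<Omega>" "norm y \<le> t"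
    by (auto simp: inner_parallel_def set_plus_def)
  then have "z \<in> cball x t" by (simp add: dist_norm)
  then show "z \<in> closure \<Omega>"
    using closure_mono[OF z(2)] assms by auto
qed

lemma lmeasurable_inner_parallel:
  fixes \<Omega> :: "'a::euclidean_space set"
  assumes "bounded \<Omega>" "0 < t" shows "inner_parallel \<Omega> t \<in> lmeasurable"
  using closed_inner_parallel[of \<Omega> t] inner_parallel_subset[OF assms(2)] assms(1)
  by (intro lmeasurable_compact) (auto simp: compact_eq_bounded_closed intro: bounded_subset)

lemma measure_inner_parallel_interior:
  fixes \<Omega> :: "'a::euclidean_space set"
  assumes "convex \<Omega>" "bounded \<Omega>" "0 < t"
  shows "measure lebesgue (interior (inner_parallel \<Omega> t)) = measure lebesgue (inner_parallel \<Omega> t)"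
  using assms bounded_subset[OF _ inner_parallel_subset]
  by (intro measure_interior negligible_convex_frontier convex_inner_parallel) auto

lemma parallel_vectorI:
  fixes w d :: "'a::real_inner"
  assumes "d \<noteq> 0" "\<And>e. e \<bullet> d = 0 \<Longrightarrow> e \<bullet> w = 0"
  shows "\<exists>l. w = l *\<^sub>R d"
proof -
  define e where "e = w - ((w \<bullet> d) / (d \<bullet> d)) *\<^sub>R d"
  have "e \<bullet> d = 0" using assms(1) by (simp add: e_def inner_diff_left)
  with assms(2) have "e \<bullet> w = 0" "e \<bullet> d = 0" by auto
  then have "e \<bullet> e = 0"
    using e_def by (metis inner_diff_right inner_scaleR_right mult_zero_right diff_zero)
  then show ?thesis by (auto simp: e_def)
qed

lemma unit_vectors_parallel:
  fixes u v :: "'a::real_inner"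
  assumes "norm u = 1" "norm v = 1" "a *\<^sub>R u = b *\<^sub>R v" "u \<noteq> v" "u \<noteq> - v"
  shows "a = 0"
proof (rule ccontr)
  assume a: "a \<noteq> 0"
  then have u: "u = (b / a) *\<^sub>R v" using assms(3) by (simp add: eq_vector_fraction_iff)
  then have "\<bar>b / a\<bar> = 1" using assms(1,2) by (metis norm_scaleR mult.right_neutral)
  then have "b / a = 1 \<or> b / a = -1" by linarith
  then show False using u assms(4,5) by auto
qed

lemma chords_parallel_imp_affine:
  fixes H :: "'a::euclidean_space \<Rightarrow> 'a"
  assumes par: "\<And>u v. norm u = 1 \<Longrightarrow> norm v = 1 \<Longrightarrow> u \<noteq> v \<Longrightarrow> \<exists>l. H u - H v = l *\<^sub>R (u - v)"
  obtains c l where "\<And>u. norm u = 1 \<Longrightarrow> H u = c + l *\<^sub>R u"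
proof -
  obtain w :: 'a where w: "w \<in> Basis" by (meson nonempty_Basis ex_in_conv)
  then have w1: "norm w = 1" "norm (- w) = 1" by auto
  have "- w \<noteq> w"
  proof
    assume "- w = w"
    then have "(- w) \<bullet> w = w \<bullet> w" by simp
    then show False using w1 by (simp add: norm_eq_sqrt_inner)
  qed
  then obtain l where l: "H (- w) - H w = l *\<^sub>R (- w - w)" using par[OF w1(2,1)] by auto
  have "H u = (H w - l *\<^sub>R w) + l *\<^sub>R u" if u: "norm u = 1" for u
  proof (cases "u = w \<or> u = - w")
    case True
    moreover have "H (- w) = H w + l *\<^sub>R (- w - w)" using l by (simp add: diff_eq_eq add.commute)
    moreover have "H w + l *\<^sub>R (- w - w) = (H w - l *\<^sub>R w) + l *\<^sub>R (- w)"
      unfolding scaleR_diff_right scaleR_minus_right by simp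
    ultimately show ?thesis by auto
  next
    case False
    obtain \<alpha> where \<alpha>: "H u - H w = \<alpha> *\<^sub>R (u - w)" using par[OF u w1(1)] False by auto
    obtain \<beta> where \<beta>: "H u - H (- w) = \<beta> *\<^sub>R (u - (- w))" using par[OF u w1(2)] False by auto
    have "\<alpha> *\<^sub>R (u - w) - \<beta> *\<^sub>R (u - (- w)) - l *\<^sub>R (- w - w) = 0"
      unfolding \<alpha>[symmetric] \<beta>[symmetric] l[symmetric] by simp
    moreover have "\<alpha> *\<^sub>R (u - w) - \<beta> *\<^sub>R (u - (- w)) - l *\<^sub>R (- w - w)
        = (\<alpha> - \<beta>) *\<^sub>R u - (\<alpha> + \<beta> - l - l) *\<^sub>R w"
      by (simp add: algebra_simps) (simp only: mult_2_right scaleR_add_left)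
    ultimately have *: "(\<alpha> - \<beta>) *\<^sub>R u = (\<alpha> + \<beta> - l - l) *\<^sub>R w" by simp
    moreover have "\<alpha> - \<beta> = 0" using unit_vectors_parallel[OF u w1(1) *] False by blast
    moreover have "w \<noteq> 0" using w1 by auto
    ultimately have "\<alpha> = l" using * by simp
    then show ?thesis using \<alpha> by (simp add: algebra_simps)
  qed
  then show ?thesis using that by blast
qed

lemma equality_decomposition:
  fixes \<Omega> :: "'a::euclidean_space set"
  assumes K_def: "K = inner_parallel \<Omega> t" and \<Omega>: "open \<Omega>" "bounded \<Omega>" "convex \<Omega>" and t: "0 < t"
    and eq: "root DIM('a) (measure lebesgue \<Omega>)
       \<le> root DIM('a) (measure lebesgue (K)) + root DIM('a) (measure lebesgue (ball (0::'a) t))"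
    and e: "e \<noteq> 0" and \<theta>: "0 < \<theta>" "\<theta> < 1"
    and a: "measure lebesgue (upper e a (interior (K))) = \<theta> * measure lebesgue (interior (K))"
    and b: "measure lebesgue (upper e b (ball 0 t)) = \<theta> * measure lebesgue (ball (0::'a) t)"
    and ne: "interior (K) \<noteq> {}" and p: "p \<in> closure \<Omega>"
  shows "\<exists>x\<in>K. \<exists>y\<in>cball 0 t. p = x + y \<and> (a \<le> e \<bullet> x \<and> b \<le> e \<bullet> y \<or> e \<bullet> x \<le> a \<and> e \<bullet> y \<le> b)"
proof -
  let ?A = "interior (K)" and ?B = "ball (0::'a) t" and ?m = "measure lebesgue"
  let ?n = "DIM('a)"
  have KO: "K \<subseteq> \<Omega>" using inner_parallel_subset[OF t] by (simp add: K_def)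
  have bdK: "bounded (K)" using KO \<Omega>(2) by (rule bounded_subset[rotated])
  have cK: "closed (K)" by (simp add: K_def closed_inner_parallel)
  have A: "open ?A" "bounded ?A" using bounded_subset[OF bdK interior_subset] by auto
  have B: "open ?B" "bounded ?B" by auto
  let ?C1 = "upper e a ?A + upper e b ?B" and ?C2 = "lower e a ?A + lower e b ?B"
  have pA: "0 < ?m ?A" using measure_open_pos[OF A ne] .
  have pB: "0 < ?m ?B" using measure_open_pos[OF B] t by simp
  note lA = lmeasurable_open_bounded[OF A] and lB = lmeasurable_open_bounded[OF B]
  have pos: "0 < ?m (upper e a ?A)" "0 < ?m (upper e b ?B)" "0 < ?m (lower e a ?A)" "0 < ?m (lower e b ?B)"
    using measure_halfspace_split[OF lA e, of a] measure_halfspace_split[OF lB e, of b] a b pA pB \<theta>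
      mult_pos_pos[OF \<theta>(1) pA] mult_pos_pos[OF \<theta>(1) pB]
      mult_strict_right_mono[OF \<theta>(2) pA] mult_strict_right_mono[OF \<theta>(2) pB] by linarith+
  have nonem: "X \<noteq> {}" if "0 < ?m X" for X :: "'a set" using that by auto
  note ne4 = pos[THEN nonem]
  have op: "open (upper e a ?A)" "open (upper e b ?B)" "open (lower e a ?A)" "open (lower e b ?B)"
    by (intro open_Int open_halfspace_gt open_halfspace_lt A B)+
  have bd: "bounded (upper e a ?A)" "bounded (upper e b ?B)" "bounded (lower e a ?A)" "bounded (lower e b ?B)"
    using A B by (auto intro: bounded_subset)
  have BM: "BM_ineq ?A ?B (?C1 \<union> ?C2)"
    using \<theta> by (intro BM_ineq_glue[OF A B e _ _ a b] Brunn_Minkowski_open op bd ne4) auto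
  have "K + ball 0 t \<subseteq> \<Omega>" unfolding K_def by (rule inner_parallel_plus_ball)
  then have AB: "?A + ?B \<subseteq> \<Omega>" using set_plus_mono2[OF interior_subset order_refl] by (rule order_trans[rotated])
  have C: "?C1 \<subseteq> \<Omega>" "?C2 \<subseteq> \<Omega>"
    using order_trans[OF set_plus_mono2[OF Int_lower1 Int_lower1] AB] by auto
  have lC: "?C1 \<union> ?C2 \<in> lmeasurable"
    using op bd by (intro fmeasurable.Un lmeasurable_open_bounded open_set_plus bounded_set_plus)
  have mA: "?m ?A = ?m (K)"
    unfolding K_def using \<Omega> t by (intro measure_inner_parallel_interior)
  have "root ?n (?m \<Omega>) \<le> root ?n (?m (?C1 \<union> ?C2))"
    using BM eq unfolding BM_ineq_def mA by linarith
  then have "?m \<Omega> \<le> ?m (?C1 \<union> ?C2)" by simp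
  then have "?m (\<Omega> - (?C1 \<union> ?C2)) \<le> 0"
    using C lC lmeasurable_open_bounded[OF \<Omega>(1,2)]
    by (subst measurable_measure_Diff) auto
  moreover have "?m (\<Omega> - closure (?C1 \<union> ?C2)) \<le> ?m (\<Omega> - (?C1 \<union> ?C2))"
    using lC lmeasurable_open_bounded[OF \<Omega>(1,2)] closure_subset[of "?C1 \<union> ?C2"]
    by (intro measure_mono_fmeasurable fmeasurable.Diff) (auto intro!: borel_open)
  ultimately have "\<not> 0 < ?m (\<Omega> - closure (?C1 \<union> ?C2))" by simp
  moreover have "open (\<Omega> - closure (?C1 \<union> ?C2))" "bounded (\<Omega> - closure (?C1 \<union> ?C2))"
    using \<Omega> by (auto intro: open_Diff bounded_subset)
  ultimately have "\<Omega> - closure (?C1 \<union> ?C2) = {}" using measure_open_pos by blast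
  then have "\<Omega> \<subseteq> closure (?C1 \<union> ?C2)" by simp
  then have "closure \<Omega> \<subseteq> closure (?C1 \<union> ?C2)" by (rule closure_minimal) (rule closed_closure)
  then have pC: "p \<in> closure ?C1 \<union> closure ?C2" using p by auto
  have cl: "closure (X + Y) \<subseteq> X' + Y'" if "X \<subseteq> X'" "Y \<subseteq> Y'" "closed X'" "bounded X'" "closed Y'" "bounded Y'" for X Y X' Y' :: "'a set"
  proof -
    have "X' + Y' = {x + y |x y. x \<in> X' \<and> y \<in> Y'}" by (auto simp: set_plus_def)
    then have "compact (X' + Y')" using compact_sums[of X' Y'] that by (simp add: compact_eq_bounded_closed)
    then show ?thesis using that by (intro closure_minimal set_plus_mono2 compact_imp_closed)
  qed
  have "closure ?C1 \<subseteq> (K \<inter> {x. a \<le> e \<bullet> x}) + (cball 0 t \<inter> {x. b \<le> e \<bullet> x})"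
    using interior_subset[of "K"] bdK
    by (intro cl) (auto intro!: closed_Int cK closed_halfspace_ge intro: bounded_subset)
  moreover have "closure ?C2 \<subseteq> (K \<inter> {x. e \<bullet> x \<le> a}) + (cball 0 t \<inter> {x. e \<bullet> x \<le> b})"
    using interior_subset[of "K"] bdK
    by (intro cl) (auto intro!: closed_Int cK closed_halfspace_le intro: bounded_subset)
  ultimately have "p \<in> (K \<inter> {x. a \<le> e \<bullet> x}) + (cball 0 t \<inter> {x. b \<le> e \<bullet> x}) \<or>
     p \<in> (K \<inter> {x. e \<bullet> x \<le> a}) + (cball 0 t \<inter> {x. e \<bullet> x \<le> b})" using pC by blast
  then show ?thesis by (fastforce simp: set_plus_def)
qed

lemma inner_eq_norm_bound:
  fixes u y :: "'a::real_inner"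
  assumes "norm u = 1" "norm y \<le> t" "u \<bullet> y = t"
  shows "y = t *\<^sub>R u"
proof -
  have t: "0 \<le> t" using assms(2) norm_ge_zero order_trans by blast
  have "(norm (y - t *\<^sub>R u))\<^sup>2 = (y - t *\<^sub>R u) \<bullet> (y - t *\<^sub>R u)" by (rule power2_norm_eq_inner)
  also have "\<dots> = y \<bullet> y - 2 * t * (u \<bullet> y) + t * t * (u \<bullet> u)"
    by (simp add: inner_diff_left inner_diff_right inner_commute[of y u] algebra_simps)
  also have "\<dots> = (norm y)\<^sup>2 - 2 * t * t + t\<^sup>2"
    using assms by (simp add: power2_norm_eq_inner norm_eq_1) (simp add: power2_eq_square)
  also have "\<dots> \<le> t\<^sup>2 - 2 * t * t + t\<^sup>2" using power_mono[OF assms(2), of 2] by simp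
  also have "\<dots> = 0" by (simp add: power2_eq_square)
  finally show ?thesis by simp
qed

theorem inner_parallel_rigidity:
  fixes \<Omega> :: "'a::euclidean_space set"
  assumes \<Omega>: "open \<Omega>" "bounded \<Omega>" "convex \<Omega>" and t: "0 < t"
    and eq: "root DIM('a) (measure lebesgue \<Omega>)
       \<le> root DIM('a) (measure lebesgue (inner_parallel \<Omega> t)) + root DIM('a) (measure lebesgue (ball (0::'a) t))"
    and pos: "0 < measure lebesgue (inner_parallel \<Omega> t)"
  shows "\<exists>c s. 0 < s \<and> \<Omega> = ball c s"
proof -
  define K where "K = inner_parallel \<Omega> t"
  note eq = eq[folded K_def] and pos = pos[folded K_def]
  let ?A = "interior (K)" and ?B = "ball (0::'a) t" and ?m = "measure lebesgue"
  have KO: "K \<subseteq> \<Omega>" using inner_parallel_subset[OF t] by (simp add: K_def)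
  have bdK: "bounded (K)" using KO \<Omega>(2) by (rule bounded_subset[rotated])
  have cK: "closed (K)" by (simp add: K_def closed_inner_parallel)
  have compK: "compact (K)" using bdK cK by (simp add: compact_eq_bounded_closed)
  have convK: "convex (K)" using convex_inner_parallel[OF \<Omega>(3)] by (simp add: K_def)
  have mA: "?m ?A = ?m (K)"
    unfolding K_def using \<Omega> t by (intro measure_inner_parallel_interior)
  then have ne: "?A \<noteq> {}" using pos by auto
  then have KA: "K = closure ?A" using convex_closure_interior[OF convK ne] cK by simp
  have A: "open ?A" "bounded ?A" using bounded_subset[OF bdK interior_subset] by auto
  have B: "open ?B" "bounded ?B" "?B \<noteq> {}" using t by auto
  note lA = lmeasurable_open_bounded[OF A] and lB = lmeasurable_open_bounded[OF B(1,2)]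
  have pA: "0 < ?m ?A" using measure_open_pos[OF A ne] .
  have pB: "0 < ?m ?B" using measure_open_pos[OF B] .
  have meet: "?A \<inter> U \<noteq> {}" if "open U" "x \<in> K" "x \<in> U" for U x
    using that KA open_Int_closure_eq_empty[OF that(1), of ?A] by blast
  have meas_pos: "0 < ?m (?A \<inter> U)" if "open U" "?A \<inter> U \<noteq> {}" for U
    using that by (intro measure_open_pos open_Int A bounded_Int disjI1)
  have "\<exists>x\<in>K. \<forall>y\<in>K. u \<bullet> y \<le> u \<bullet> x" for u
    using ne interior_subset[of "K"] by (intro continuous_attains_sup[OF compK] continuous_intros) auto
  then obtain H where H: "\<And>u. H u \<in> K" "\<And>u y. y \<in> K \<Longrightarrow> u \<bullet> y \<le> u \<bullet> H u" by metis
  have KB: "K + cball 0 t \<subseteq> closure \<Omega>" unfolding K_def by (rule inner_parallel_plus_cball[OF t])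
  have Hcl: "H u + t *\<^sub>R u \<in> closure \<Omega>" if "norm u = 1" for u
    using subsetD[OF KB set_plus_intro[OF H(1)]] that t by auto
  have uniq: "y = t *\<^sub>R u \<and> x = H u" if "norm u = 1" "H u + t *\<^sub>R u = x + y" "x \<in> K" "y \<in> cball 0 t" for u x y
  proof -
    have "u \<bullet> H u + t = u \<bullet> x + u \<bullet> y"
      using arg_cong[OF that(2), of "\<lambda>z. u \<bullet> z"] that(1) by (simp add: inner_add_right norm_eq_1)
    moreover have "u \<bullet> x \<le> u \<bullet> H u" using H(2) that(3) .
    moreover have "u \<bullet> y \<le> t" using norm_cauchy_schwarz[of u y] that by simp
    ultimately have "u \<bullet> y = t" by linarith
    then have "y = t *\<^sub>R u" using that by (intro inner_eq_norm_bound) auto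
    then show ?thesis using that(2) by simp
  qed
  have cut: "\<exists>b. ?m (upper e b ?B) = (?m (upper e m ?A) / ?m ?A) * ?m ?B \<and>
      t * (e \<bullet> u) \<le> b \<and> b \<le> t * (e \<bullet> v)"
    if uv: "norm u = 1" "norm v = 1" and m: "e \<bullet> H u < m" "m < e \<bullet> H v" for e u v m
  proof -
    have e: "e \<noteq> 0" using m by auto
    let ?\<theta> = "?m (upper e m ?A) / ?m ?A"
    have "?A \<inter> {x. m < e \<bullet> x} \<noteq> {}" "?A \<inter> {x. e \<bullet> x < m} \<noteq> {}"
      using meet[OF open_halfspace_gt H(1)[of v]] meet[OF open_halfspace_lt H(1)[of u]] m by auto
    then have "0 < ?m (upper e m ?A)" "0 < ?m (lower e m ?A)"
      using meas_pos[OF open_halfspace_gt] meas_pos[OF open_halfspace_lt] by blast+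
    then have \<theta>: "0 < ?\<theta>" "?\<theta> < 1" using pA measure_halfspace_split[OF lA e, of m] by (auto simp: divide_less_eq)
    obtain b where b: "?m (upper e b ?B) = ?\<theta> * ?m ?B" using exists_proportional_cut[OF lB e \<theta> pB] .
    have dec: "m \<le> e \<bullet> H w \<and> b \<le> t * (e \<bullet> w) \<or> e \<bullet> H w \<le> m \<and> t * (e \<bullet> w) \<le> b" if w: "norm w = 1" for w
    proof -
      have "?m (upper e m ?A) = ?\<theta> * ?m ?A" using pA by simp
      from equality_decomposition[OF K_def \<Omega> t eq e \<theta> this b ne Hcl[OF w]]
      obtain x y where xy: "x \<in> K" "y \<in> cball 0 t" "H w + t *\<^sub>R w = x + y"
         "m \<le> e \<bullet> x \<and> b \<le> e \<bullet> y \<or> e \<bullet> x \<le> m \<and> e \<bullet> y \<le> b" by blast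
      then show ?thesis using uniq[OF w xy(3,1,2)] by simp
    qed
    show ?thesis using b dec[OF uv(1)] dec[OF uv(2)] m by (intro exI[of _ b]) auto
  qed
  have less_imp: "\<not> e \<bullet> H u < e \<bullet> H v" if uv: "norm u = 1" "norm v = 1" "e \<bullet> u = e \<bullet> v" for e u v
  proof
    assume lt: "e \<bullet> H u < e \<bullet> H v"
    define d where "d = (e \<bullet> H v - e \<bullet> H u) / 3"
    have d: "0 < d" "e \<bullet> H v = e \<bullet> H u + 3 * d" using lt by (auto simp: d_def field_simps)
    let ?m1 = "e \<bullet> H u + d" and ?m2 = "e \<bullet> H u + 2 * d"
    have "?m (upper e ?m1 ?A) = ?m (upper e ?m2 ?A)"
    proof -
      obtain b1 where b1: "?m (upper e b1 ?B) = (?m (upper e ?m1 ?A) / ?m ?A) * ?m ?B" "t * (e \<bullet> u) \<le> b1" "b1 \<le> t * (e \<bullet> v)"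
        using cut[OF uv(1,2), of e ?m1] d by auto
      obtain b2 where b2: "?m (upper e b2 ?B) = (?m (upper e ?m2 ?A) / ?m ?A) * ?m ?B" "t * (e \<bullet> u) \<le> b2" "b2 \<le> t * (e \<bullet> v)"
        using cut[OF uv(1,2), of e ?m2] d by auto
      have "b1 = b2" using b1 b2 uv(3) by simp
      then show ?thesis using b1(1) b2(1) pA pB by simp
    qed
    moreover have "?m (upper e ?m2 ?A) + ?m (?A \<inter> {x. ?m1 < e \<bullet> x} \<inter> {x. e \<bullet> x < ?m2}) = ?m (upper e ?m1 ?A)"
    proof -
      have e: "e \<noteq> 0" using lt by auto
      have "upper e ?m1 ?A \<in> lmeasurable"
        using A by (intro lmeasurable_open_bounded open_Int open_halfspace_gt) (auto intro: bounded_subset)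
      moreover have "upper e ?m2 (upper e ?m1 ?A) = upper e ?m2 ?A" using d by auto
      ultimately show ?thesis using measure_halfspace_split[OF _ e, of "upper e ?m1 ?A" ?m2] by simp
    qed
    moreover have "0 < ?m (?A \<inter> {x. ?m1 < e \<bullet> x} \<inter> {x. e \<bullet> x < ?m2})"
    proof (rule measure_open_pos)
      let ?z = "(1/2) *\<^sub>R H u + (1/2) *\<^sub>R H v"
      have "?z \<in> K" by (intro convexD[OF convK] H) auto
      moreover have "e \<bullet> ?z = e \<bullet> H u + 3/2 * d" using d by (simp add: inner_add_right field_simps)
      ultimately have "?A \<inter> ({x. ?m1 < e \<bullet> x} \<inter> {x. e \<bullet> x < ?m2}) \<noteq> {}"
        using d by (intro meet[of _ ?z]) (auto intro!: open_Int open_halfspace_gt open_halfspace_lt)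
      then show "?A \<inter> {x. ?m1 < e \<bullet> x} \<inter> {x. e \<bullet> x < ?m2} \<noteq> {}" by (simp add: Int_assoc)
    qed (use A in \<open>auto intro!: open_Int open_halfspace_gt open_halfspace_lt intro: bounded_subset\<close>)
    ultimately show False by simp
  qed
  have "\<exists>l. H u - H v = l *\<^sub>R (u - v)" if uv: "norm u = 1" "norm v = 1" "u \<noteq> v" for u v
  proof (rule parallel_vectorI)
    fix e assume "e \<bullet> (u - v) = 0"
    then have "e \<bullet> u = e \<bullet> v" by (simp add: inner_diff_right)
    then have "\<not> e \<bullet> H u < e \<bullet> H v" "\<not> e \<bullet> H v < e \<bullet> H u" using less_imp uv by auto
    then show "e \<bullet> (H u - H v) = 0" by (simp add: inner_diff_right)
  qed (use uv in auto)
  then obtain c l where cl: "\<And>u. norm u = 1 \<Longrightarrow> H u = c + l *\<^sub>R u" using chords_parallel_imp_affine[of H] by metis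
  have Kc: "K \<subseteq> cball c l"
  proof
    fix x assume x: "x \<in> K"
    obtain u :: 'a where u: "norm u = 1" "x - c = norm (x - c) *\<^sub>R u"
    proof (cases "x = c")
      case True
      then show ?thesis using that[of "SOME i. i \<in> Basis"] SOME_Basis by auto
    next
      case False
      then show ?thesis using that[of "(x - c) /\<^sub>R norm (x - c)"] by simp
    qed
    have "u \<bullet> x \<le> u \<bullet> (c + l *\<^sub>R u)" using H(2)[OF x, of u] cl[OF u(1)] by simp
    then have "u \<bullet> (x - c) \<le> l" using u(1) by (simp add: inner_add_right inner_diff_right norm_eq_1)
    then have "norm (x - c) \<le> l" using u(1) by (subst (asm) u(2)) (simp add: norm_eq_1)
    then show "x \<in> cball c l" by (simp add: dist_norm norm_minus_commute)
  qed
  then have l: "0 \<le> l" using H(1)[of 0] zero_le_dist[of c "H 0"] by (auto simp: subset_eq simp del: zero_le_dist)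
  have "\<Omega> \<subseteq> cball c (l + t)"
  proof -
    have "\<Omega> \<subseteq> K + cball 0 t"
    proof
      fix p assume "p \<in> \<Omega>"
      then have p: "p \<in> closure \<Omega>" using closure_subset by blast
      obtain e :: 'a where e: "e \<in> Basis" using nonempty_Basis by blast
      then have e0: "e \<noteq> 0" by auto
      obtain a where a: "?m (upper e a ?A) = (1/2) * ?m ?A" using exists_proportional_cut[OF lA e0 _ _ pA, of "1/2"] by auto
      obtain b where b: "?m (upper e b ?B) = (1/2) * ?m ?B" using exists_proportional_cut[OF lB e0 _ _ pB, of "1/2"] by auto
      have "\<exists>x\<in>K. \<exists>y\<in>cball 0 t. p = x + y"
        using equality_decomposition[OF K_def \<Omega> t eq e0 _ _ a b ne p] by auto
      then show "p \<in> K + cball 0 t" by (auto intro: set_plus_intro)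
    qed
    also have "\<dots> \<subseteq> cball c l + cball 0 t" using Kc by (intro set_plus_mono2) auto
    also have "\<dots> \<subseteq> cball c (l + t)"
    proof
      fix z assume "z \<in> cball c l + cball 0 t"
      then obtain x y where "z = x + y" "norm (c - x) \<le> l" "norm y \<le> t" by (auto simp: set_plus_def dist_norm)
      then show "z \<in> cball c (l + t)" using norm_triangle_ineq4[of "c - x" y] by (simp add: dist_norm diff_diff_eq)
    qed
    finally show ?thesis .
  qed
  then have 1: "\<Omega> \<subseteq> ball c (l + t)" using interior_maximal[OF _ \<Omega>(1), of "cball c (l + t)"] by simp
  have sph: "sphere c (l + t) \<subseteq> closure \<Omega>"
  proof
    fix x assume x: "x \<in> sphere c (l + t)"
    define u where "u = (x - c) /\<^sub>R (l + t)"
    have u: "norm u = 1" using x l t by (simp add: u_def dist_norm norm_minus_commute)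
    have "x = c + (l + t) *\<^sub>R u" using l t by (simp add: u_def)
    also have "\<dots> = H u + t *\<^sub>R u" using cl[OF u] by (simp add: scaleR_add_left)
    finally show "x \<in> closure \<Omega>" using Hcl[OF u] by simp
  qed
  have "convex hull sphere c (l + t) \<subseteq> closure \<Omega>" using sph convex_closure[OF \<Omega>(3)] by (rule hull_minimal)
  moreover have "cball c (l + t) = convex hull sphere c (l + t)"
    using Krein_Milman_frontier[of "cball c (l + t)"] by simp
  ultimately have "ball c (l + t) \<subseteq> interior (closure \<Omega>)" using ball_subset_cball by (intro interior_maximal) auto
  then have "ball c (l + t) \<subseteq> \<Omega>" using convex_interior_closure[OF \<Omega>(3)] \<Omega>(1) by (simp add: interior_open)
  with 1 have "\<Omega> = ball c (l + t)" by blast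
  then show ?thesis using l t by (intro exI[of _ c] exI[of _ "l + t"]) simp
qed

section \<open>Test functions\<close>

definition flat :: "real poly \<Rightarrow> real \<Rightarrow> real" where
  "flat p t = (if 0 < t then poly p (1 / t) * exp (- (1 / t)) else 0)"

lemma tendsto_poly_exp_neg: "((\<lambda>s::real. poly p s * exp (- s)) \<longlongrightarrow> 0) at_top"
proof -
  have "((\<lambda>s. \<Sum>i\<le>degree p. coeff p i * (s ^ i / exp s)) \<longlongrightarrow> (\<Sum>i\<le>degree p. coeff p i * 0)) at_top"
    by (intro tendsto_intros tendsto_power_div_exp_0)
  moreover have "(\<lambda>s. \<Sum>i\<le>degree p. coeff p i * (s ^ i / exp s)) = (\<lambda>s. poly p s * exp (- s))"
    by (auto simp: poly_altdef exp_minus sum_divide_distrib field_simps)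
  ultimately show ?thesis by simp
qed

lemma flat_has_derivative:
  "(flat p has_real_derivative flat (pCons 0 (pCons 0 (p - pderiv p))) t) (at t)"
proof -
  consider "t < 0" | "t = 0" | "0 < t" by linarith
  then show ?thesis
  proof cases
    case 1
    have "\<forall>\<^sub>F s in nhds t. flat p s = 0"
      using eventually_nhds_in_open[of "{..<0}" t] 1 by (auto elim!: eventually_mono simp: flat_def)
    then have "(flat p has_real_derivative 0) (at t)"
      by (subst DERIV_cong_ev[OF refl _ refl]) auto
    then show ?thesis using 1 by (simp add: flat_def)
  next
    case 3
    have ev: "\<forall>\<^sub>F s in nhds t. flat p s = poly p (1 / s) * exp (- (1 / s))"
      using eventually_nhds_in_open[of "{0<..}" t] 3 by (auto elim!: eventually_mono simp: flat_def)
    have "((\<lambda>s. poly p (1 / s) * exp (- (1 / s))) has_real_derivative flat (pCons 0 (pCons 0 (p - pderiv p))) t) (at t)"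
      using 3 by (auto intro!: derivative_eq_intros DERIV_chain2[OF poly_DERIV] simp: flat_def field_simps power2_eq_square)
    then show ?thesis by (subst DERIV_cong_ev[OF refl ev refl])
  next
    case 2
    have r: "((\<lambda>h. (flat p (0 + h) - flat p 0) / h) \<longlongrightarrow> 0) (at_right 0)"
    proof -
      have "((\<lambda>h. poly (pCons 0 p) (inverse h) * exp (- inverse h)) \<longlongrightarrow> 0) (at_right 0)"
        by (rule filterlim_compose[OF tendsto_poly_exp_neg filterlim_inverse_at_top_right])
      moreover have "\<forall>\<^sub>F h in at_right 0. poly (pCons 0 p) (inverse h) * exp (- inverse h) = (flat p (0 + h) - flat p 0) / h"
        unfolding eventually_at_right_field by (intro exI[of _ 1]) (auto simp: flat_def field_simps)
      ultimately show ?thesis by (rule Lim_transform_eventually)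
    qed
    have l: "((\<lambda>h. (flat p (0 + h) - flat p 0) / h) \<longlongrightarrow> 0) (at_left 0)"
    proof -
      have "\<forall>\<^sub>F h in at_left 0. 0 = (flat p (0 + h) - flat p 0) / h"
        unfolding eventually_at_left_field by (intro exI[of _ "-1"]) (auto simp: flat_def)
      then show ?thesis by (rule Lim_transform_eventually[OF tendsto_const])
    qed
    from l r have "((\<lambda>h. (flat p (0 + h) - flat p 0) / h) \<longlongrightarrow> 0) (at 0)" by (rule filterlim_split_at)
    then show ?thesis using 2 by (simp add: DERIV_def flat_def)
  qed
qed

definition deriv_chain :: "(nat \<Rightarrow> real \<Rightarrow> real) \<Rightarrow> bool" where
  "deriv_chain D \<longleftrightarrow> (\<forall>k t. (D k has_real_derivative D (Suc k) t) (at t))"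

lemma deriv_chain_flat: "deriv_chain (\<lambda>k. flat (((\<lambda>p. pCons 0 (pCons 0 (p - pderiv p))) ^^ k) p))"
  unfolding deriv_chain_def using flat_has_derivative by simp

lemma deriv_chain_affine:
  assumes "deriv_chain D"
  shows "deriv_chain (\<lambda>k t. c ^ k * D k (c * t + d))"
  unfolding deriv_chain_def
proof (intro allI)
  fix k t
  have "(D k has_real_derivative D (Suc k) (c * t + d)) (at (c * t + d))"
    using assms by (simp add: deriv_chain_def)
  then show "((\<lambda>t. c ^ k * D k (c * t + d)) has_real_derivative c ^ Suc k * D (Suc k) (c * t + d)) (at t)"
    by (auto intro!: derivative_eq_intros DERIV_chain2[where f = "D k" and g = "\<lambda>t. c * t + d"])
qed

primrec leibniz_terms :: "nat \<Rightarrow> (nat \<times> nat) list" where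
  "leibniz_terms 0 = [(0, 0)]"
| "leibniz_terms (Suc k) = concat (map (\<lambda>(i, j). [(Suc i, j), (i, Suc j)]) (leibniz_terms k))"

lemma deriv_chain_mult:
  assumes F: "deriv_chain F" and G: "deriv_chain G"
  shows "deriv_chain (\<lambda>k t. \<Sum>(i, j)\<leftarrow>leibniz_terms k. F i t * G j t)"
proof -
  have "((\<lambda>t. \<Sum>(i, j)\<leftarrow>L. F i t * G j t) has_real_derivative
     (\<Sum>(i, j)\<leftarrow>concat (map (\<lambda>(i, j). [(Suc i, j), (i, Suc j)]) L). F i t * G j t)) (at t)" for L t
  proof (induction L)
    case (Cons a L)
    obtain i j where a: "a = (i, j)" by fastforce
    have "((\<lambda>t. F i t * G j t + (\<Sum>(i, j)\<leftarrow>L. F i t * G j t)) has_real_derivative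
       (F (Suc i) t * G j t + F i t * G (Suc j) t) + (\<Sum>(i, j)\<leftarrow>concat (map (\<lambda>(i, j). [(Suc i, j), (i, Suc j)]) L). F i t * G j t)) (at t)"
      using F G by (intro DERIV_add Cons) (auto intro!: derivative_eq_intros simp: deriv_chain_def)
    then show ?case by (simp add: a add.assoc)
  qed simp
  then show ?thesis by (simp add: deriv_chain_def)
qed

lemma smooth_fun_prod:
  fixes D :: "'a::euclidean_space \<Rightarrow> nat \<Rightarrow> real \<Rightarrow> real"
  assumes D: "\<And>i. i \<in> Basis \<Longrightarrow> deriv_chain (D i)"
  shows "smooth_fun (\<lambda>x. \<Prod>i\<in>Basis. D i 0 (x \<bullet> i))"
proof -
  have der: "((\<lambda>x. \<Prod>i\<in>Basis. D i (m i) (x \<bullet> i)) has_derivative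
      (\<lambda>y. \<Sum>i\<in>Basis. D i (Suc (m i)) (x \<bullet> i) * (y \<bullet> i) * (\<Prod>j\<in>Basis - {i}. D j (m j) (x \<bullet> j)))) (at x)" for m and x :: 'a
  proof (rule has_derivative_prod)
    fix i :: 'a assume "i \<in> Basis"
    then have "(D i (m i) has_derivative (*) (D i (Suc (m i)) (x \<bullet> i))) (at (x \<bullet> i))"
      using D by (simp add: deriv_chain_def has_field_derivative_def)
    then show "((\<lambda>x. D i (m i) (x \<bullet> i)) has_derivative (\<lambda>y. D i (Suc (m i)) (x \<bullet> i) * (y \<bullet> i))) (at x)"
      by (rule has_derivative_compose[rotated]) (auto intro!: derivative_eq_intros)
  qed
  have it: "iterated_partial bs (\<lambda>x. \<Prod>i\<in>Basis. D i 0 (x \<bullet> i)) = (\<lambda>x. \<Prod>i\<in>Basis. D i (count_list bs i) (x \<bullet> i))"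
    if "set bs \<subseteq> Basis" for bs
    using that
  proof (induction bs)
    case (Cons b bs)
    have b: "b \<in> Basis" using Cons.prems by simp
    show ?case
    proof
      fix x
      have "iterated_partial (b # bs) (\<lambda>x. \<Prod>i\<in>Basis. D i 0 (x \<bullet> i)) x =
         frechet_derivative (\<lambda>x. \<Prod>i\<in>Basis. D i (count_list bs i) (x \<bullet> i)) (at x) b"
        using Cons by simp
      also have "\<dots> = (\<Sum>i\<in>Basis. D i (Suc (count_list bs i)) (x \<bullet> i) * (b \<bullet> i) * (\<Prod>j\<in>Basis - {i}. D j (count_list bs j) (x \<bullet> j)))"
        by (subst frechet_derivative_at[OF der, symmetric]) simp
      also have "\<dots> = (\<Sum>i\<in>Basis. if i = b then D i (Suc (count_list bs i)) (x \<bullet> i) * (\<Prod>j\<in>Basis - {i}. D j (count_list bs j) (x \<bullet> j)) else 0)"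
        using b by (intro sum.cong) (auto simp: inner_Basis)
      also have "\<dots> = D b (Suc (count_list bs b)) (x \<bullet> b) * (\<Prod>j\<in>Basis - {b}. D j (count_list bs j) (x \<bullet> j))"
        using b by simp
      also have "\<dots> = D b (count_list (b # bs) b) (x \<bullet> b) * (\<Prod>j\<in>Basis - {b}. D j (count_list (b # bs) j) (x \<bullet> j))"
        by (intro arg_cong2[where f = "(*)"] prod.cong) auto
      also have "\<dots> = (\<Prod>i\<in>Basis. D i (count_list (b # bs) i) (x \<bullet> i))"
        using b by (simp add: prod.remove[of Basis b])
      finally show "iterated_partial (b # bs) (\<lambda>x. \<Prod>i\<in>Basis. D i 0 (x \<bullet> i)) x = (\<Prod>i\<in>Basis. D i (count_list (b # bs) i) (x \<bullet> i))" .
    qed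
  qed simp
  show ?thesis
    unfolding smooth_fun_def using it der by (auto simp: differentiable_def)
qed

definition bump :: "real \<Rightarrow> 'a::euclidean_space \<Rightarrow> 'a \<Rightarrow> 'a \<Rightarrow> real" where
  "bump k a b x = (\<Prod>i\<in>Basis. flat 1 (k * (x \<bullet> i - a \<bullet> i)) * flat 1 (k * (b \<bullet> i - x \<bullet> i)))"

lemma smooth_bump: "smooth_fun (bump k a b)"
proof -
  define F where "F n = flat (((\<lambda>p. pCons 0 (pCons 0 (p - pderiv p))) ^^ n) 1)" for n
  have F: "deriv_chain F" unfolding F_def by (rule deriv_chain_flat)
  define D where "D i n t = (\<Sum>(l, m)\<leftarrow>leibniz_terms n. (k ^ l * F l (k * t + - k * (a \<bullet> i))) * ((- k) ^ m * F m (- k * t + k * (b \<bullet> i))))" for i :: 'a and n t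
  have "deriv_chain (D i)" for i
    unfolding D_def by (intro deriv_chain_mult deriv_chain_affine F)
  then have "smooth_fun (\<lambda>x. \<Prod>i\<in>Basis. D i 0 (x \<bullet> i))" by (intro smooth_fun_prod)
  moreover have "(\<lambda>x. \<Prod>i\<in>Basis. D i 0 (x \<bullet> i)) = bump k a b"
    by (auto simp: D_def F_def bump_def algebra_simps intro!: prod.cong ext)
  ultimately show ?thesis by simp
qed

lemma flat_1_bounds: "0 \<le> flat 1 t" "flat 1 t \<le> 1" "0 < flat 1 t \<longleftrightarrow> 0 < t"
  by (auto simp: flat_def)

lemma bump_bounds: "0 \<le> bump k a b x" "bump k a b x \<le> 1"
  unfolding bump_def by (auto intro!: prod_nonneg prod_le_1 mult_nonneg_nonneg mult_le_one flat_1_bounds)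

lemma bump_pos: "0 < k \<Longrightarrow> x \<in> box a b \<Longrightarrow> 0 < bump k a b x"
  unfolding bump_def by (auto intro!: prod_pos mult_pos_pos simp: flat_1_bounds mem_box)

lemma bump_eq_0: "0 < k \<Longrightarrow> x \<notin> box a b \<Longrightarrow> bump k a b x = 0"
proof -
  assume k: "0 < k" and "x \<notin> box a b"
  then obtain i where i: "i \<in> Basis" "x \<bullet> i \<le> a \<bullet> i \<or> b \<bullet> i \<le> x \<bullet> i" by (auto simp: mem_box not_less)
  then have "flat 1 (k * (x \<bullet> i - a \<bullet> i)) * flat 1 (k * (b \<bullet> i - x \<bullet> i)) = 0"
    using k by (auto simp: flat_def zero_less_mult_iff)
  then show ?thesis unfolding bump_def using i by (intro prod_zero) auto
qed

lemma bump_support: "0 < k \<Longrightarrow> closure {x. bump k a b x \<noteq> 0} \<subseteq> cbox a b"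
  using bump_eq_0 box_subset_cbox by (intro closure_minimal) (auto simp: subset_eq, blast)

lemma bump_in_test_functions:
  assumes "0 < k" "cbox a b \<subseteq> \<Omega>" shows "bump k a b \<in> test_functions \<Omega>"
  using bump_support[OF assms(1), of a b] assms(2) smooth_bump bounded_subset[OF bounded_cbox]
  by (auto simp: test_functions_def compact_eq_bounded_closed)

lemma bump_tendsto: "(\<lambda>n. bump (real (Suc n)) a b x) \<longlonglongrightarrow> indicator (box a b) x"
proof (cases "x \<in> box a b")
  case True
  have 1: "(\<lambda>n. flat 1 (real (Suc n) * c)) \<longlonglongrightarrow> 1" if c: "0 < c" for c
  proof -
    have "(\<lambda>n. exp (- (inverse (real (Suc n)) * inverse c))) \<longlonglongrightarrow> exp (- (0 * inverse c))"
      by (intro tendsto_intros LIMSEQ_inverse_real_of_nat)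
    moreover have "flat 1 (real (Suc n) * c) = exp (- (inverse (real (Suc n)) * inverse c))" for n
      using c by (simp add: flat_def field_simps add_pos_nonneg)
    ultimately show ?thesis by simp
  qed
  have "(\<lambda>n. bump (real (Suc n)) a b x) \<longlonglongrightarrow> (\<Prod>i\<in>(Basis::'a set). 1 * 1)"
    unfolding bump_def using True by (intro tendsto_prod tendsto_mult 1) (auto simp: mem_box)
  then show ?thesis using True by simp
qed (simp add: bump_eq_0)

lemma bump_translate: "bump k (a + v) (b + v) x = bump k a b (x - v)"
  unfolding bump_def by (intro prod.cong refl) (simp add: inner_add_left inner_diff_left algebra_simps)

lemma smooth_fun_differentiable: "smooth_fun f \<Longrightarrow> f differentiable (at x)"
  unfolding smooth_fun_def by (drule spec[of _ "[]"]) simp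

lemma smooth_fun_continuous: "smooth_fun f \<Longrightarrow> continuous_on A f"
  by (meson differentiable_imp_continuous_within continuous_at_imp_continuous_on smooth_fun_differentiable)

lemma frechet_derivative_sum_Basis:
  assumes "f differentiable (at x)"
  shows "frechet_derivative f (at x) e = (\<Sum>b\<in>Basis. (e \<bullet> b) * frechet_derivative f (at x) b)"
proof -
  have lin: "linear (frechet_derivative f (at x))" by (rule linear_frechet_derivative[OF assms])
  have "frechet_derivative f (at x) e = frechet_derivative f (at x) (\<Sum>b\<in>Basis. (e \<bullet> b) *\<^sub>R b)"
    by (simp add: euclidean_representation)
  also have "\<dots> = (\<Sum>b\<in>Basis. (e \<bullet> b) * frechet_derivative f (at x) b)"
    by (simp add: linear_sum[OF lin] linear_cmul[OF lin])
  finally show ?thesis .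
qed

lemma smooth_fun_continuous_derivative:
  assumes "smooth_fun f" shows "continuous_on A (\<lambda>x. frechet_derivative f (at x) e)"
proof -
  have "continuous_on A (\<lambda>x. frechet_derivative f (at x) b)" if "b \<in> Basis" for b
  proof -
    have "iterated_partial [b] f differentiable (at x)" for x
      using assms that unfolding smooth_fun_def by (metis empty_set insert_subset list.simps(15) empty_subsetI)
    then show ?thesis
      by (auto intro!: continuous_at_imp_continuous_on differentiable_imp_continuous_within)
  qed
  then have "continuous_on A (\<lambda>x. \<Sum>b\<in>Basis. (e \<bullet> b) * frechet_derivative f (at x) b)"
    by (intro continuous_intros)
  then show ?thesis
    by (rule continuous_on_eq) (simp add: frechet_derivative_sum_Basis[OF smooth_fun_differentiable[OF assms], of _ e, symmetric])
qed

lemma test_functionsD: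
  assumes "\<phi> \<in> test_functions \<Omega>"
  shows "smooth_fun \<phi>" "compact (closure {x. \<phi> x \<noteq> 0})" "closure {x. \<phi> x \<noteq> 0} \<subseteq> \<Omega>"
    "x \<notin> \<Omega> \<Longrightarrow> \<phi> x = 0"
proof -
  show *: "smooth_fun \<phi>" "compact (closure {x. \<phi> x \<noteq> 0})" "closure {x. \<phi> x \<noteq> 0} \<subseteq> \<Omega>"
    using assms by (auto simp: test_functions_def)
  show "x \<notin> \<Omega> \<Longrightarrow> \<phi> x = 0" using *(3) closure_subset[of "{x. \<phi> x \<noteq> 0}"] by blast
qed

lemma test_function_derivative_eq_0:
  assumes "\<phi> \<in> test_functions \<Omega>" "x \<notin> closure {x. \<phi> x \<noteq> 0}"
  shows "frechet_derivative \<phi> (at x) e = 0"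
proof -
  have "(\<phi> has_derivative (\<lambda>_. 0)) (at x)"
  proof (rule has_derivative_transform_within_open[OF has_derivative_const])
    show "open (- closure {x. \<phi> x \<noteq> 0})" "x \<in> - closure {x. \<phi> x \<noteq> 0}" using assms(2) by auto
    show "0 = \<phi> y" if "y \<in> - closure {x. \<phi> x \<noteq> 0}" for y
      using that closure_subset[of "{x. \<phi> x \<noteq> 0}"] by auto
  qed
  then show ?thesis using frechet_derivative_at by metis
qed

lemma bounded_of_compact_support:
  fixes f :: "'a::t2_space \<Rightarrow> real"
  assumes "compact K" "continuous_on K f" "\<And>x. x \<notin> K \<Longrightarrow> f x = 0"
  obtains B where "0 \<le> B" "\<And>x. \<bar>f x\<bar> \<le> B"
proof -
  have "bounded (f ` K)" using assms by (intro compact_imp_bounded compact_continuous_image)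
  then obtain B where B: "\<And>x. x \<in> K \<Longrightarrow> \<bar>f x\<bar> \<le> B" by (auto simp: bounded_iff)
  show ?thesis
  proof (rule that[of "max B 0"])
    fix x show "\<bar>f x\<bar> \<le> max B 0" using B[of x] assms(3)[of x] by (cases "x \<in> K") auto
  qed simp
qed

lemma test_function_bounded:
  assumes "\<phi> \<in> test_functions \<Omega>" obtains B where "0 \<le> B" "\<And>x. \<bar>\<phi> x\<bar> \<le> B"
proof (rule bounded_of_compact_support[OF test_functionsD(2)[OF assms], of \<phi>])
  show "continuous_on (closure {x. \<phi> x \<noteq> 0}) \<phi>" using smooth_fun_continuous test_functionsD(1)[OF assms] .
  show "\<phi> x = 0" if "x \<notin> closure {x. \<phi> x \<noteq> 0}" for x using that closure_subset[of "{x. \<phi> x \<noteq> 0}"] by auto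
qed (use that in blast)

lemma test_function_derivative_bounded:
  assumes "\<phi> \<in> test_functions \<Omega>" obtains B where "0 \<le> B" "\<And>x. \<bar>frechet_derivative \<phi> (at x) e\<bar> \<le> B"
proof (rule bounded_of_compact_support[OF test_functionsD(2)[OF assms], of "\<lambda>x. frechet_derivative \<phi> (at x) e"])
  show "continuous_on (closure {x. \<phi> x \<noteq> 0}) (\<lambda>x. frechet_derivative \<phi> (at x) e)"
    using smooth_fun_continuous_derivative test_functionsD(1)[OF assms] .
  show "frechet_derivative \<phi> (at x) e = 0" if "x \<notin> closure {x. \<phi> x \<noteq> 0}" for x
    using test_function_derivative_eq_0[OF assms that] .
qed (use that in blast)

lemma integral_lebesgue_on_indicator:
  fixes f :: "'a::euclidean_space \<Rightarrow> real"
  assumes "S \<in> sets lebesgue"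
  shows "(\<integral>x. f x \<partial>lebesgue_on S) = (\<integral>x. indicator S x * f x \<partial>lebesgue)"
  using assms by (subst integral_restrict_space) auto

lemma AE_zero_of_box_integrals:
  fixes f :: "'a::euclidean_space \<Rightarrow> real"
  assumes int: "integrable lborel f" and zero: "\<And>a b. (LINT x:box a b|lborel. f x) = 0" and all: "(LINT x|lborel. f x) = 0"
  shows "AE x in lborel. f x = 0"
proof (rule density_unique_real[OF int])
  show "integrable lborel (\<lambda>x :: 'a. 0 :: real)" by simp
  fix A :: "'a set" assume "A \<in> sets lborel"
  then have A: "A \<in> sigma_sets UNIV (range (\<lambda>(a, b). box a b :: 'a set))" by (simp add: borel_eq_box)
  have stable: "Int_stable (range (\<lambda>(a, b). box a b :: 'a set))"
  proof (rule Int_stableI)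
    fix X Y assume "X \<in> range (\<lambda>(a, b). box a b :: 'a set)" "Y \<in> range (\<lambda>(a, b). box a b :: 'a set)"
    then obtain a b c d where "X = box a b" "Y = box c d" by auto
    then obtain p q where "X \<inter> Y = box p q" using box_Int_box[of a b c d] by blast
    then show "X \<inter> Y \<in> range (\<lambda>(a, b). box a b :: 'a set)" by (intro range_eqI[of _ _ "(p, q)"]) simp
  qed
  have "range (\<lambda>(a, b). box a b :: 'a set) \<subseteq> Pow UNIV" by simp
  from stable this A have "(LINT x:A|lborel. f x) = 0"
  proof (induction rule: sigma_sets_induct_disjoint)
    case (basic A) then show ?case using zero by auto
  next
    case (compl A)
    have "A \<in> sets borel" using compl by (simp add: borel_eq_box)
    then have iA: "integrable lborel (\<lambda>x. indicator A x *\<^sub>R f x)" using int by (intro integrable_mult_indicator) simp_all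
    have eq: "indicator (UNIV - A) x *\<^sub>R f x = f x - indicator A x *\<^sub>R f x" for x by (simp add: indicator_def)
    have "(LINT x:UNIV - A|lborel. f x) = (LINT x|lborel. f x) - (LINT x:A|lborel. f x)"
      unfolding set_lebesgue_integral_def eq by (rule Bochner_Integration.integral_diff[OF int iA])
    then show ?case using compl all by simp
  next
    case (union A)
    have A: "A i \<in> sets lborel" for i using union(2) by (simp add: borel_eq_box image_subset_iff)
    have "set_integrable lborel (\<Union>i. A i) f"
      unfolding set_integrable_def by (intro integrable_mult_indicator int sets.countable_UN) (use A in auto)
    then have "(LINT x:(\<Union>i. A i)|lborel. f x) = (\<Sum>i. LINT x:A i|lborel. f x)"
      using union(1) A unfolding disjoint_family_on_def
      by (intro lebesgue_integral_countable_add) auto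
    then show ?case using union by simp
  qed (auto simp: set_lebesgue_integral_def)
  then show "(LINT x:A|lborel. f x) = (LINT x:A|lborel. 0)" by (simp add: set_lebesgue_integral_def)
qed

lemma bump_measurable [measurable]: "bump k a b \<in> borel_measurable borel"
  by (intro borel_measurable_continuous_onI smooth_fun_continuous smooth_bump)

lemma test_functions_AE_zero:
  fixes f :: "'a::euclidean_space \<Rightarrow> real"
  assumes \<Omega>: "open \<Omega>" and meas: "f \<in> borel_measurable (lebesgue_on \<Omega>)"
    and bd: "AE x in lebesgue_on \<Omega>. \<bar>f x\<bar> \<le> C"
    and orth: "\<And>\<phi>. \<phi> \<in> test_functions \<Omega> \<Longrightarrow> (\<integral>x. f x * \<phi> x \<partial>lebesgue_on \<Omega>) = 0"
  shows "AE x in lebesgue_on \<Omega>. f x = 0"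
proof -
  have \<Omega>s: "\<Omega> \<in> sets lebesgue" using \<Omega> by (simp add: borel_open)
  define h where "h x = indicator \<Omega> x * f x" for x
  have hm: "h \<in> borel_measurable lebesgue"
    using meas \<Omega>s unfolding h_def by (subst (asm) borel_measurable_restrict_space_iff) (auto simp: Int_absorb2)
  then obtain h' where h': "h' \<in> borel_measurable lborel" "AE x in lborel. h x = h' x"
    using completion_ex_borel_measurable_real by blast
  have h'b [measurable]: "h' \<in> borel_measurable borel" using h'(1) by simp
  have AEh: "AE x in lebesgue. h x = h' x" using h'(2) by (rule AE_completion)
  have "AE x in lebesgue. x \<in> \<Omega> \<longrightarrow> \<bar>f x\<bar> \<le> C"
    using bd \<Omega>s by (subst (asm) AE_restrict_space_iff) auto
  then have "AE x in lebesgue. \<bar>h' x\<bar> \<le> \<bar>C\<bar>"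
    using AEh
  proof eventually_elim
    case (elim x)
    then show ?case by (cases "x \<in> \<Omega>") (auto simp: h_def)
  qed
  then have bh': "AE x in lborel. \<bar>h' x\<bar> \<le> \<bar>C\<bar>" using h'(1) by (simp add: AE_completion_iff)
  have Z: "(LINT x:box a b|lborel. h' x) = 0" if ab: "cbox a b \<subseteq> \<Omega>" for a b
  proof -
    let ?\<phi> = "\<lambda>n. bump (real (Suc n)) a b"
    have "(\<lambda>n. \<integral>x. ?\<phi> n x * h' x \<partial>lborel) \<longlonglongrightarrow> (\<integral>x. indicator (box a b) x * h' x \<partial>lborel)"
    proof (rule integral_dominated_convergence[where w = "\<lambda>x. \<bar>C\<bar> * indicator (cbox a b) x"])
      show "(\<lambda>x. ?\<phi> n x * h' x) \<in> borel_measurable lborel" for n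
        using h'(1) by measurable
      show "AE x in lborel. norm (?\<phi> n x * h' x) \<le> \<bar>C\<bar> * indicator (cbox a b) x" for n
        using bh'
      proof eventually_elim
        case (elim x)
        show ?case
        proof (cases "x \<in> cbox a b")
          case True
          then show ?thesis using elim bump_bounds[of "real (Suc n)" a b x] mult_mono[of "?\<phi> n x" 1 "\<bar>h' x\<bar>" "\<bar>C\<bar>"]
            by (simp add: abs_mult)
        next
          case False
          then have "?\<phi> n x = 0" using box_subset_cbox[of a b] by (intro bump_eq_0) auto
          then show ?thesis by simp
        qed
      qed
      show "integrable lborel (\<lambda>x. \<bar>C\<bar> * indicator (cbox a b) x :: real)"
        by (intro integrable_mult_right integrable_real_indicator) (auto simp: emeasure_lborel_cbox_finite[unfolded infinity_ennreal_def])
      show "AE x in lborel. (\<lambda>n. ?\<phi> n x * h' x) \<longlonglongrightarrow> indicator (box a b) x * h' x"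
        by (intro AE_I2 tendsto_mult bump_tendsto tendsto_const)
    qed measurable
    moreover have "(\<integral>x. ?\<phi> n x * h' x \<partial>lborel) = 0" for n
    proof -
      have "(\<integral>x. ?\<phi> n x * h' x \<partial>lborel) = (\<integral>x. ?\<phi> n x * h' x \<partial>lebesgue)"
        using h'(1) by (intro integral_completion[symmetric]) measurable
      also have "\<dots> = (\<integral>x. ?\<phi> n x * h x \<partial>lebesgue)"
        using AEh h'(1) hm bump_measurable
        by (intro integral_cong_AE borel_measurable_times) (auto intro: measurable_completion)
      also have "\<dots> = (\<integral>x. f x * ?\<phi> n x \<partial>lebesgue_on \<Omega>)"
        unfolding integral_lebesgue_on_indicator[OF \<Omega>s] h_def by (simp add: mult_ac)
      also have "\<dots> = 0" by (intro orth bump_in_test_functions ab) simp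
      finally show ?thesis .
    qed
    ultimately show ?thesis by (simp add: set_lebesgue_integral_def LIMSEQ_const_iff)
  qed
  have loc: "AE x in lborel. x \<in> box p q \<longrightarrow> h' x = 0" if pq: "cbox p q \<subseteq> \<Omega>" for p q
  proof -
    have int: "integrable lborel (\<lambda>x. indicator (box p q) x * h' x)"
    proof (rule Bochner_Integration.integrable_bound)
      show "integrable lborel (\<lambda>x. \<bar>C\<bar> * indicator (box p q) x :: real)"
        by (intro integrable_mult_right integrable_real_indicator) (auto simp: emeasure_lborel_box_finite[unfolded infinity_ennreal_def])
      show "AE x in lborel. norm (indicator (box p q) x * h' x) \<le> norm (\<bar>C\<bar> * indicator (box p q) x :: real)"
        using bh' by eventually_elim (auto simp: indicator_def)
    qed measurable
    have sub: "(LINT x:box a b|lborel. indicator (box p q) x * h' x) = 0" for a b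
    proof -
      obtain c d where cd: "box a b \<inter> box p q = box c d" unfolding box_Int_box by blast
      show ?thesis
      proof (cases "box c d = {}")
        case True
        then have "(\<lambda>x. indicator (box a b) x * (indicator (box p q) x * h' x)) = (\<lambda>x. 0)"
          using cd by (auto simp: indicator_def fun_eq_iff)
        then show ?thesis unfolding set_lebesgue_integral_def real_scaleR_def by simp
      next
        case False
        have "box c d \<subseteq> box p q" using cd by blast
        then have "cbox c d \<subseteq> cbox p q" using False closure_mono[of "box c d" "box p q"]
          by (metis closure_box box_subset_cbox closure_minimal closed_cbox order_trans)
        then have "(LINT x:box c d|lborel. h' x) = 0" using pq by (intro Z) auto
        moreover have "(\<lambda>x. indicator (box a b) x * (indicator (box p q) x * h' x)) = (\<lambda>x. indicator (box c d) x * h' x)"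
          using cd by (auto simp: indicator_def fun_eq_iff)
        ultimately show ?thesis unfolding set_lebesgue_integral_def real_scaleR_def by simp
      qed
    qed
    have "AE x in lborel. indicator (box p q) x * h' x = 0"
      using int sub Z[OF pq] by (intro AE_zero_of_box_integrals) (auto simp: set_lebesgue_integral_def)
    then show ?thesis by eventually_elim (auto simp: indicator_def)
  qed
  obtain \<D> where \<D>: "countable \<D>" "\<And>X. X \<in> \<D> \<Longrightarrow> \<exists>a b. X = cbox a b" "\<Union>\<D> = \<Omega>"
    using open_countable_Union_open_cbox[OF \<Omega>] by metis
  have "AE x in lborel. x \<in> X \<longrightarrow> h' x = 0" if XD: "X \<in> \<D>" for X
  proof -
    obtain a b where X: "X = cbox a b" using \<D>(2)[OF XD] by blast
    have "cbox a b - box a b \<in> null_sets lebesgue"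
      using negligible_frontier_interval[of a b] by (simp add: negligible_iff_null_sets)
    then have "AE x in lebesgue. x \<notin> cbox a b - box a b" by (rule AE_not_in)
    then have "AE x in lborel. x \<notin> cbox a b - box a b" by (subst (asm) AE_completion_iff) auto
    moreover have "AE x in lborel. x \<in> box a b \<longrightarrow> h' x = 0" using \<D>(3) XD X by (intro loc) blast
    ultimately show ?thesis unfolding X by eventually_elim auto
  qed
  then have "AE x in lborel. \<forall>X\<in>\<D>. x \<in> X \<longrightarrow> h' x = 0" using \<D>(1) by (subst AE_ball_countable) auto
  then have "AE x in lborel. x \<in> \<Omega> \<longrightarrow> f x = 0"
    using h'(2) by eventually_elim (use \<D>(3) in \<open>auto simp: h_def indicator_def\<close>)
  then have "AE x in lebesgue. x \<in> \<Omega> \<longrightarrow> f x = 0" by (rule AE_completion)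
  then show ?thesis using \<Omega>s by (subst AE_restrict_space_iff) auto
qed

section \<open>Weak gradients\<close>

definition diff_quot :: "'a::euclidean_space set \<Rightarrow> ('a \<Rightarrow> real) \<Rightarrow> 'a \<Rightarrow> nat \<Rightarrow> 'a \<Rightarrow> real" where
  "diff_quot \<Omega> u e k x = real (Suc k) *
     (indicator \<Omega> (x + (1 / real (Suc k)) *\<^sub>R e) * u (x + (1 / real (Suc k)) *\<^sub>R e) - indicator \<Omega> x * u x)"

definition dir_deriv :: "'a::euclidean_space set \<Rightarrow> ('a \<Rightarrow> real) \<Rightarrow> 'a \<Rightarrow> 'a \<Rightarrow> real" where
  "dir_deriv \<Omega> u e x = lim (\<lambda>k. diff_quot \<Omega> u e k x)"

lemma diff_quot_bound:
  assumes L: "\<And>x y. x \<in> \<Omega> \<Longrightarrow> y \<in> \<Omega> \<Longrightarrow> \<bar>u x - u y\<bar> \<le> L * dist x y"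
    and x: "x \<in> \<Omega>" "x + (1 / real (Suc k)) *\<^sub>R e \<in> \<Omega>"
  shows "\<bar>diff_quot \<Omega> u e k x\<bar> \<le> L * norm e"
proof -
  have "\<bar>diff_quot \<Omega> u e k x\<bar> = real (Suc k) * \<bar>u (x + (1 / real (Suc k)) *\<^sub>R e) - u x\<bar>"
    using x by (simp add: diff_quot_def abs_mult)
  also have "\<dots> \<le> real (Suc k) * (L * dist (x + (1 / real (Suc k)) *\<^sub>R e) x)"
    using L[OF x(2,1)] by (intro mult_left_mono) auto
  also have "\<dots> = L * norm e" by (simp add: dist_norm)
  finally show ?thesis .
qed

lemma step_tendsto: "(\<lambda>k. x + (1 / real (Suc k)) *\<^sub>R e) \<longlonglongrightarrow> (x :: 'a::real_normed_vector)"
proof -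
  have "(\<lambda>k. x + (1 / real (Suc k)) *\<^sub>R e) \<longlonglongrightarrow> x + 0 *\<^sub>R e"
    using LIMSEQ_inverse_real_of_nat by (intro tendsto_intros) (simp add: inverse_eq_divide)
  then show ?thesis by simp
qed

lemma diff_quot_tendsto:
  fixes u :: "'a::euclidean_space \<Rightarrow> real"
  assumes \<Omega>: "open \<Omega>" and u: "convex_on \<Omega> u"
    and L: "\<And>x y. x \<in> \<Omega> \<Longrightarrow> y \<in> \<Omega> \<Longrightarrow> \<bar>u x - u y\<bar> \<le> L * dist x y" and x: "x \<in> \<Omega>"
  shows "(\<lambda>k. diff_quot \<Omega> u e k x) \<longlonglongrightarrow> dir_deriv \<Omega> u e x" "\<bar>dir_deriv \<Omega> u e x\<bar> \<le> L * norm e"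
proof -
  let ?x = "\<lambda>k. x + (1 / real (Suc k)) *\<^sub>R e"
  obtain K where K: "\<And>k. K \<le> k \<Longrightarrow> ?x k \<in> \<Omega>"
    using topological_tendstoD[OF step_tendsto \<Omega> x, of e] by (auto simp: eventually_sequentially)
  have mono: "diff_quot \<Omega> u e m x \<le> diff_quot \<Omega> u e k x" if km: "K \<le> k" "k \<le> m" for k m
  proof -
    define s where "s = real (Suc k) / real (Suc m)"
    have s: "0 \<le> s" "s \<le> 1" "real (Suc m) * s = real (Suc k)" using km by (auto simp: s_def field_simps)
    have eq: "?x m = (1 - s) *\<^sub>R x + s *\<^sub>R ?x k"
      by (simp add: s_def algebra_simps del: of_nat_Suc)
    have "u (?x m) \<le> (1 - s) * u x + s * u (?x k)"
      unfolding eq using s K[of k] km x by (intro convex_onD[OF u]) auto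
    then have "real (Suc m) * (u (?x m) - u x) \<le> real (Suc m) * (s * (u (?x k) - u x))"
      by (intro mult_left_mono) (simp_all add: algebra_simps)
    also have "\<dots> = real (Suc k) * (u (?x k) - u x)" using s(3) by (simp only: mult.assoc[symmetric])
    finally show ?thesis using K[of m] K[of k] km x by (simp add: diff_quot_def del: of_nat_Suc)
  qed
  have bd: "\<bar>diff_quot \<Omega> u e k x\<bar> \<le> L * norm e" if "K \<le> k" for k
    using diff_quot_bound[OF L x K[OF that]] .
  have "\<exists>l. (\<lambda>k. diff_quot \<Omega> u e (k + K) x) \<longlonglongrightarrow> l \<and> (\<forall>k. l \<le> diff_quot \<Omega> u e (k + K) x)"
  proof (rule decseq_convergent[of _ "- (L * norm e)"])
    show "decseq (\<lambda>k. diff_quot \<Omega> u e (k + K) x)" by (auto simp: decseq_def intro: mono)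
    show "\<forall>k. - (L * norm e) \<le> diff_quot \<Omega> u e (k + K) x" using bd[OF le_add2] by (auto simp: abs_le_iff minus_le_iff)
  qed blast
  then obtain l where "(\<lambda>k. diff_quot \<Omega> u e (k + K) x) \<longlonglongrightarrow> l" by blast
  then have l: "(\<lambda>k. diff_quot \<Omega> u e k x) \<longlonglongrightarrow> l" by (rule LIMSEQ_offset)
  then show lim: "(\<lambda>k. diff_quot \<Omega> u e k x) \<longlonglongrightarrow> dir_deriv \<Omega> u e x"
    by (simp add: dir_deriv_def limI)
  have "(\<lambda>k. \<bar>diff_quot \<Omega> u e k x\<bar>) \<longlonglongrightarrow> \<bar>dir_deriv \<Omega> u e x\<bar>" using lim by (rule tendsto_rabs)
  then show "\<bar>dir_deriv \<Omega> u e x\<bar> \<le> L * norm e"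
    using bd by (intro LIMSEQ_le_const2) auto
qed

lemma indicator_mult_measurable:
  fixes u :: "'a::euclidean_space \<Rightarrow> real"
  assumes "open \<Omega>" "continuous_on \<Omega> u"
  shows "(\<lambda>x. indicator \<Omega> x * u x) \<in> borel_measurable borel"
  using borel_measurable_continuous_on_indicator[OF _ assms(2)] assms(1) by (simp add: borel_open)

lemma diff_quot_measurable:
  assumes "open \<Omega>" "continuous_on \<Omega> u"
  shows "diff_quot \<Omega> u e k \<in> borel_measurable borel"
proof -
  note [measurable] = indicator_mult_measurable[OF assms]
  have "(\<lambda>x. indicator \<Omega> (x + (1 / real (Suc k)) *\<^sub>R e) * u (x + (1 / real (Suc k)) *\<^sub>R e)) \<in> borel_measurable borel"
    by (rule measurable_compose[OF _ indicator_mult_measurable[OF assms], where f = "\<lambda>x. x + (1 / real (Suc k)) *\<^sub>R e"]) simp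
  then show ?thesis unfolding diff_quot_def by measurable
qed

lemma dir_deriv_measurable:
  assumes "open \<Omega>" "continuous_on \<Omega> u"
  shows "dir_deriv \<Omega> u e \<in> borel_measurable borel"
  unfolding dir_deriv_def by (intro borel_measurable_lim_metric diff_quot_measurable assms)

lemma Lipschitz_imp_continuous_on:
  fixes u :: "'a::metric_space \<Rightarrow> real"
  assumes L: "\<And>x y. x \<in> \<Omega> \<Longrightarrow> y \<in> \<Omega> \<Longrightarrow> \<bar>u x - u y\<bar> \<le> L * dist x y"
  shows "continuous_on \<Omega> u"
proof (rule lipschitz_on_continuous_on[of "max L 0"], rule lipschitz_onI)
  fix x y assume "x \<in> \<Omega>" "y \<in> \<Omega>"
  then have "\<bar>u x - u y\<bar> \<le> L * dist x y" by (rule L)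
  also have "\<dots> \<le> max L 0 * dist x y" by (intro mult_right_mono) auto
  finally show "dist (u x) (u y) \<le> max L 0 * dist x y" by (simp add: dist_real_def)
qed simp

lemma has_real_derivative_along:
  fixes f :: "'a::real_normed_vector \<Rightarrow> real"
  assumes "f differentiable (at (x + s *\<^sub>R v))"
  shows "((\<lambda>s. f (x + s *\<^sub>R v)) has_real_derivative frechet_derivative f (at (x + s *\<^sub>R v)) v) (at s)"
proof -
  have f: "(f has_derivative frechet_derivative f (at (x + s *\<^sub>R v))) (at (x + s *\<^sub>R v))"
    using assms by (simp add: frechet_derivative_works)
  have "((\<lambda>s. f (x + s *\<^sub>R v)) has_derivative (\<lambda>h. frechet_derivative f (at (x + s *\<^sub>R v)) (h *\<^sub>R v))) (at s)"
    by (rule has_derivative_compose[where g = f and f = "\<lambda>s. x + s *\<^sub>R v" and x = s, OF _ f]) (auto intro!: derivative_eq_intros)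
  also have "(\<lambda>h. frechet_derivative f (at (x + s *\<^sub>R v)) (h *\<^sub>R v)) = (*) (frechet_derivative f (at (x + s *\<^sub>R v)) v)"
    using linear_cmul[OF linear_frechet_derivative[OF assms]] by (auto simp: mult.commute)
  finally show ?thesis by (simp add: has_field_derivative_def)
qed

lemma test_function_difference_bound:
  assumes \<phi>: "\<phi> \<in> test_functions \<Omega>" and B: "\<And>x. \<bar>frechet_derivative \<phi> (at x) e\<bar> \<le> B" and s: "0 < s"
  shows "\<bar>\<phi> x - \<phi> (x - s *\<^sub>R e)\<bar> \<le> B * s"
proof -
  have d: "\<phi> differentiable (at y)" for y using smooth_fun_differentiable[OF test_functionsD(1)[OF \<phi>]] .
  obtain z where "\<phi> (x + 0 *\<^sub>R e) - \<phi> (x + (- s) *\<^sub>R e) = (0 - (- s)) * frechet_derivative \<phi> (at (x + z *\<^sub>R e)) e"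
    using MVT2[of "- s" 0 "\<lambda>r. \<phi> (x + r *\<^sub>R e)"] s has_real_derivative_along[OF d] by force
  then have "\<phi> x - \<phi> (x - s *\<^sub>R e) = s * frechet_derivative \<phi> (at (x + z *\<^sub>R e)) e" by simp
  then show ?thesis using B[of "x + z *\<^sub>R e"] s by (simp add: abs_mult mult.commute)
qed

lemma test_function_difference_tendsto:
  assumes \<phi>: "\<phi> \<in> test_functions \<Omega>"
  shows "(\<lambda>k. real (Suc k) * (\<phi> x - \<phi> (x - (1 / real (Suc k)) *\<^sub>R e))) \<longlonglongrightarrow> frechet_derivative \<phi> (at x) e"
proof -
  have d: "\<phi> differentiable (at y)" for y using smooth_fun_differentiable[OF test_functionsD(1)[OF \<phi>]] .
  have "((\<lambda>h. (\<phi> (x + (0 + h) *\<^sub>R e) - \<phi> (x + 0 *\<^sub>R e)) / h) \<longlongrightarrow> frechet_derivative \<phi> (at (x + 0 *\<^sub>R e)) e) (at 0)"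
    using has_real_derivative_along[where f = \<phi> and x = x and s = 0 and v = e, OF d] by (simp add: DERIV_def)
  moreover have "filterlim (\<lambda>k. - (1 / real (Suc k))) (at 0) sequentially"
  proof -
    have "(\<lambda>k. - (1 / real (Suc k))) \<longlonglongrightarrow> - 0"
      using LIMSEQ_inverse_real_of_nat by (intro tendsto_minus) (simp add: inverse_eq_divide)
    then show ?thesis by (auto simp: filterlim_at)
  qed
  ultimately have "(\<lambda>k. (\<phi> (x + (0 + - (1 / real (Suc k))) *\<^sub>R e) - \<phi> (x + 0 *\<^sub>R e)) / (- (1 / real (Suc k))))
     \<longlonglongrightarrow> frechet_derivative \<phi> (at (x + 0 *\<^sub>R e)) e"
    by (rule filterlim_compose)
  moreover have "(\<phi> (x + (0 + - (1 / real (Suc k))) *\<^sub>R e) - \<phi> (x + 0 *\<^sub>R e)) / (- (1 / real (Suc k)))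
     = real (Suc k) * (\<phi> x - \<phi> (x - (1 / real (Suc k)) *\<^sub>R e))" for k
    by (simp add: algebra_simps del: of_nat_Suc)
  ultimately show ?thesis by simp
qed

lemma integral_translate:
  fixes f :: "'a::euclidean_space \<Rightarrow> real"
  assumes "f \<in> borel_measurable borel"
  shows "(\<integral>x. f (x + v) \<partial>lborel) = (\<integral>x. f x \<partial>lborel)"
proof -
  have "(\<integral>x. f x \<partial>lborel) = (\<integral>x. f x \<partial>distr lborel borel ((+) v))" by (simp add: lborel_distr_plus)
  also have "\<dots> = (\<integral>x. f (v + x) \<partial>lborel)" using assms by (intro integral_distr) auto
  finally show ?thesis by (simp add: add.commute)
qed

lemma integrable_bounded_support:
  fixes f :: "'a::euclidean_space \<Rightarrow> real"
  assumes "f \<in> borel_measurable borel" "bounded S" "\<And>x. x \<notin> S \<Longrightarrow> f x = 0" "\<And>x. \<bar>f x\<bar> \<le> B"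
  shows "integrable lborel f"
proof -
  obtain a where a: "S \<subseteq> cbox (-a) a" using assms(2) bounded_subset_cbox_symmetric by blast
  show ?thesis
  proof (rule Bochner_Integration.integrable_bound)
    show "integrable lborel (\<lambda>x. \<bar>B\<bar> * indicator (cbox (-a) a) x :: real)"
      by (intro integrable_mult_right integrable_real_indicator) (auto simp: emeasure_lborel_cbox_finite[unfolded infinity_ennreal_def])
    show "AE x in lborel. norm (f x) \<le> norm (\<bar>B\<bar> * indicator (cbox (-a) a) x :: real)"
    proof (rule AE_I2)
      fix x show "norm (f x) \<le> norm (\<bar>B\<bar> * indicator (cbox (-a) a) x :: real)"
        using a assms(3)[of x] assms(4)[of x] by (cases "x \<in> S") (auto simp: indicator_def)
    qed
  qed (use assms(1) in simp)
qed

lemma integral_lebesgue_on_lborel: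
  fixes f :: "'a::euclidean_space \<Rightarrow> real"
  assumes "S \<in> sets borel" "(\<lambda>x. indicator S x * f x) \<in> borel_measurable borel"
  shows "(\<integral>x. f x \<partial>lebesgue_on S) = (\<integral>x. indicator S x * f x \<partial>lborel)"
  using assms by (subst integral_lebesgue_on_indicator) (auto intro!: integral_completion)

lemma weak_dir_deriv:
  fixes u :: "'a::euclidean_space \<Rightarrow> real"
  assumes \<Omega>: "open \<Omega>" "bounded \<Omega>" and u: "convex_on \<Omega> u"
    and L: "\<And>x y. x \<in> \<Omega> \<Longrightarrow> y \<in> \<Omega> \<Longrightarrow> \<bar>u x - u y\<bar> \<le> L * dist x y"
    and bd: "\<And>x. x \<in> \<Omega> \<Longrightarrow> \<bar>u x\<bar> \<le> M"
    and \<phi>: "\<phi> \<in> test_functions \<Omega>"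
  shows "(\<integral>x. u x * frechet_derivative \<phi> (at x) e \<partial>lebesgue_on \<Omega>)
     = - (\<integral>x. dir_deriv \<Omega> u e x * \<phi> x \<partial>lebesgue_on \<Omega>)"
proof -
  have cu: "continuous_on \<Omega> u" using L by (rule Lipschitz_imp_continuous_on)
  define U where "U x = indicator \<Omega> x * u x" for x
  have [measurable]: "U \<in> borel_measurable borel" using indicator_mult_measurable[OF \<Omega>(1) cu] by (simp add: U_def[abs_def])
  have [measurable]: "\<phi> \<in> borel_measurable borel"
    using smooth_fun_continuous[OF test_functionsD(1)[OF \<phi>]] by (intro borel_measurable_continuous_onI)
  have [measurable]: "(\<lambda>x. frechet_derivative \<phi> (at x) e) \<in> borel_measurable borel"
    using smooth_fun_continuous_derivative[OF test_functionsD(1)[OF \<phi>]] by (intro borel_measurable_continuous_onI)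
  note [measurable] = diff_quot_measurable[OF \<Omega>(1) cu] dir_deriv_measurable[OF \<Omega>(1) cu]
  have [measurable]: "\<Omega> \<in> sets borel" using \<Omega>(1) by (rule borel_open)
  have Ub: "\<bar>U x\<bar> \<le> \<bar>M\<bar>" for x using bd[of x] by (auto simp: U_def indicator_def)
  obtain B where B: "0 \<le> B" "\<And>x. \<bar>frechet_derivative \<phi> (at x) e\<bar> \<le> B" using test_function_derivative_bounded[OF \<phi>] by blast
  obtain C where C: "0 \<le> C" "\<And>x. \<bar>\<phi> x\<bar> \<le> C" using test_function_bounded[OF \<phi>] by blast
  let ?v = "\<lambda>k. (1 / real (Suc k)) *\<^sub>R e"
  let ?q = "\<lambda>k x. real (Suc k) * (\<phi> x - \<phi> (x - ?v k))"
  have qm [measurable]: "?q k \<in> borel_measurable borel" for k by measurable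
  have qB: "\<bar>?q k x\<bar> \<le> B" for k x
  proof -
    have "\<bar>?q k x\<bar> = real (Suc k) * \<bar>\<phi> x - \<phi> (x - ?v k)\<bar>" by (simp add: abs_mult)
    also have "\<dots> \<le> real (Suc k) * (B * (1 / real (Suc k)))"
      using test_function_difference_bound[OF \<phi> B(2), of "1 / real (Suc k)" x] by (intro mult_left_mono) auto
    finally show ?thesis by simp
  qed
  have A: "(\<lambda>k. \<integral>x. U x * ?q k x \<partial>lborel) \<longlonglongrightarrow> (\<integral>x. U x * frechet_derivative \<phi> (at x) e \<partial>lborel)"
  proof (rule integral_dominated_convergence[where w = "\<lambda>x. B * \<bar>U x\<bar>"])
    show "integrable lborel (\<lambda>x. B * \<bar>U x\<bar>)"
    proof (rule integrable_bounded_support[OF _ \<Omega>(2), of _ "B * \<bar>M\<bar>"])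
      show "(\<lambda>x. B * \<bar>U x\<bar>) \<in> borel_measurable borel" by measurable
      show "B * \<bar>U x\<bar> = 0" if "x \<notin> \<Omega>" for x using that by (simp add: U_def)
      show "\<bar>B * \<bar>U x\<bar>\<bar> \<le> B * \<bar>M\<bar>" for x using Ub[of x] B(1) by (simp add: abs_mult mult_left_mono)
    qed
    show "AE x in lborel. norm (U x * ?q k x) \<le> B * \<bar>U x\<bar>" for k
      using qB by (intro AE_I2) (auto simp: abs_mult mult.commute[of B] intro!: mult_left_mono)
    show "AE x in lborel. (\<lambda>k. U x * ?q k x) \<longlonglongrightarrow> U x * frechet_derivative \<phi> (at x) e"
      by (intro AE_I2 tendsto_mult tendsto_const test_function_difference_tendsto[OF \<phi>])
  qed measurable
  define K where "K = closure {x. \<phi> x \<noteq> 0}"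
  have K: "compact K" "K \<subseteq> \<Omega>" "x \<notin> K \<Longrightarrow> \<phi> x = 0" for x
    using test_functionsD[OF \<phi>] closure_subset[of "{x. \<phi> x \<noteq> 0}"] by (auto simp: K_def)
  have "\<exists>d>0. \<forall>x\<in>K. \<forall>y\<in>-\<Omega>. d \<le> dist x y"
    using K \<Omega>(1) by (intro separate_compact_closed) auto
  then obtain d where d: "0 < d" "\<And>x y. x \<in> K \<Longrightarrow> y \<notin> \<Omega> \<Longrightarrow> d \<le> dist x y" by auto
  have "(\<lambda>k. norm (0 + ?v k)) \<longlonglongrightarrow> norm (0::'a)" by (intro tendsto_norm step_tendsto)
  then have "\<forall>\<^sub>F k in sequentially. norm (0 + ?v k) < d" using d(1) by (intro order_tendstoD) auto
  then obtain N where N: "\<And>k. N \<le> k \<Longrightarrow> norm (?v k) < d" by (auto simp: eventually_sequentially)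
  have KN: "x + ?v k \<in> \<Omega>" if "x \<in> K" "N \<le> k" for x k
    using d(2)[OF that(1), of "x + ?v k"] N[OF that(2)] by (force simp: dist_norm)
  have "(\<lambda>k. \<integral>x. diff_quot \<Omega> u e (k + N) x * \<phi> x \<partial>lborel) \<longlonglongrightarrow> (\<integral>x. dir_deriv \<Omega> u e x * \<phi> x \<partial>lborel)"
  proof (rule integral_dominated_convergence[where w = "\<lambda>x. (L * norm e) * \<bar>\<phi> x\<bar>"])
    show "integrable lborel (\<lambda>x. L * norm e * \<bar>\<phi> x\<bar>)"
      by (intro integrable_mult_right integrable_abs integrable_bounded_support[OF _ compact_imp_bounded[OF K(1)], of _ C]) (use C K in auto)
    show "AE x in lborel. norm (diff_quot \<Omega> u e (k + N) x * \<phi> x) \<le> L * norm e * \<bar>\<phi> x\<bar>" for k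
    proof (rule AE_I2)
      fix x
      show "norm (diff_quot \<Omega> u e (k + N) x * \<phi> x) \<le> L * norm e * \<bar>\<phi> x\<bar>"
      proof (cases "x \<in> K")
        case True
        then have "\<bar>diff_quot \<Omega> u e (k + N) x\<bar> \<le> L * norm e"
          using K(2) by (intro diff_quot_bound[OF L] KN) auto
        then show ?thesis by (simp add: abs_mult mult_right_mono)
      qed (simp add: K(3))
    qed
    show "AE x in lborel. (\<lambda>k. diff_quot \<Omega> u e (k + N) x * \<phi> x) \<longlonglongrightarrow> dir_deriv \<Omega> u e x * \<phi> x"
    proof (rule AE_I2)
      fix x
      show "(\<lambda>k. diff_quot \<Omega> u e (k + N) x * \<phi> x) \<longlonglongrightarrow> dir_deriv \<Omega> u e x * \<phi> x"
      proof (cases "x \<in> K")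
        case True
        then have "x \<in> \<Omega>" using K(2) by blast
        then show ?thesis using LIMSEQ_ignore_initial_segment[OF diff_quot_tendsto(1)[OF \<Omega>(1) u L]] by (intro tendsto_intros) auto
      qed (simp add: K(3))
    qed
  qed measurable
  then have D: "(\<lambda>k. \<integral>x. diff_quot \<Omega> u e k x * \<phi> x \<partial>lborel) \<longlonglongrightarrow> (\<integral>x. dir_deriv \<Omega> u e x * \<phi> x \<partial>lborel)"
    by (rule LIMSEQ_offset)
  have eq: "(\<integral>x. diff_quot \<Omega> u e k x * \<phi> x \<partial>lborel) = - (\<integral>x. U x * ?q k x \<partial>lborel)" for k
  proof -
    have int: "integrable lborel (\<lambda>x. U x * \<phi> x)" "integrable lborel (\<lambda>x. U x * \<phi> (x - ?v k))" "integrable lborel (\<lambda>x. U (x + ?v k) * \<phi> x)"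
    proof -
      have UC: "\<bar>U x * \<phi> y\<bar> \<le> \<bar>M\<bar> * C" for x y
        unfolding abs_mult using Ub[of x] C(2)[of y] by (intro mult_mono) auto
      have 0: "U x = 0" "\<phi> x = 0" if "x \<notin> \<Omega>" for x using that test_functionsD(4)[OF \<phi>] by (auto simp: U_def)
      show "integrable lborel (\<lambda>x. U x * \<phi> x)"
        by (rule integrable_bounded_support[OF _ \<Omega>(2) _ UC]) (measurable, simp add: 0)
      show "integrable lborel (\<lambda>x. U x * \<phi> (x - ?v k))"
        by (rule integrable_bounded_support[OF _ \<Omega>(2) _ UC]) (measurable, simp add: 0)
      show "integrable lborel (\<lambda>x. U (x + ?v k) * \<phi> x)"
        by (rule integrable_bounded_support[OF _ \<Omega>(2) _ UC]) (measurable, simp add: 0)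
    qed
    have "(\<integral>x. U (x + ?v k) * \<phi> x \<partial>lborel) = (\<integral>x. U (x + ?v k) * \<phi> ((x + ?v k) - ?v k) \<partial>lborel)" by simp
    also have "\<dots> = (\<integral>x. U x * \<phi> (x - ?v k) \<partial>lborel)"
      by (rule integral_translate[where f = "\<lambda>x. U x * \<phi> (x - ?v k)"]) measurable
    finally have tr: "(\<integral>x. U (x + ?v k) * \<phi> x \<partial>lborel) = (\<integral>x. U x * \<phi> (x - ?v k) \<partial>lborel)" .
    have "(\<integral>x. diff_quot \<Omega> u e k x * \<phi> x \<partial>lborel) = (\<integral>x. real (Suc k) * (U (x + ?v k) * \<phi> x - U x * \<phi> x) \<partial>lborel)"
      by (intro Bochner_Integration.integral_cong) (auto simp: diff_quot_def U_def algebra_simps)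
    also have "\<dots> = real (Suc k) * ((\<integral>x. U x * \<phi> (x - ?v k) \<partial>lborel) - (\<integral>x. U x * \<phi> x \<partial>lborel))"
      using int by (simp add: Bochner_Integration.integral_diff tr del: of_nat_Suc)
    also have "\<dots> = - (real (Suc k) * (\<integral>x. U x * \<phi> x - U x * \<phi> (x - ?v k) \<partial>lborel))"
      using int by (simp add: Bochner_Integration.integral_diff algebra_simps del: of_nat_Suc)
    also have "\<dots> = - (\<integral>x. real (Suc k) * (U x * \<phi> x - U x * \<phi> (x - ?v k)) \<partial>lborel)" by simp
    also have "\<dots> = - (\<integral>x. U x * ?q k x \<partial>lborel)"
      by (intro arg_cong[where f = uminus] Bochner_Integration.integral_cong) (auto simp: algebra_simps)
    finally show ?thesis .
  qed
  have "(\<integral>x. dir_deriv \<Omega> u e x * \<phi> x \<partial>lborel) = - (\<integral>x. U x * frechet_derivative \<phi> (at x) e \<partial>lborel)"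
    using LIMSEQ_unique[OF D] tendsto_minus[OF A] unfolding eq by blast
  moreover have "(\<integral>x. u x * frechet_derivative \<phi> (at x) e \<partial>lebesgue_on \<Omega>) = (\<integral>x. U x * frechet_derivative \<phi> (at x) e \<partial>lborel)"
  proof -
    have "(\<lambda>x. indicator \<Omega> x * (u x * frechet_derivative \<phi> (at x) e)) = (\<lambda>x. U x * frechet_derivative \<phi> (at x) e)"
      by (auto simp: U_def)
    moreover have "(\<lambda>x. U x * frechet_derivative \<phi> (at x) e) \<in> borel_measurable borel" by measurable
    ultimately show ?thesis by (subst integral_lebesgue_on_lborel) auto
  qed
  moreover have "(\<integral>x. dir_deriv \<Omega> u e x * \<phi> x \<partial>lebesgue_on \<Omega>) = (\<integral>x. dir_deriv \<Omega> u e x * \<phi> x \<partial>lborel)"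
  proof -
    have "(\<lambda>x. indicator \<Omega> x * (dir_deriv \<Omega> u e x * \<phi> x)) = (\<lambda>x. dir_deriv \<Omega> u e x * \<phi> x)"
      using test_functionsD(4)[OF \<phi>] by (force simp: indicator_def)
    moreover have "(\<lambda>x. dir_deriv \<Omega> u e x * \<phi> x) \<in> borel_measurable borel" by measurable
    ultimately show ?thesis by (subst integral_lebesgue_on_lborel) auto
  qed
  ultimately show ?thesis by simp
qed

lemma Linf_norm_le:
  assumes "f \<in> borel_measurable (lebesgue_on \<Omega>)" "AE x in lebesgue_on \<Omega>. norm (f x) \<le> C"
  shows "Linf_norm \<Omega> f \<le> ereal C"
  unfolding Linf_norm_def using assms by (intro esssup_I) auto

lemma Linf_AE_bound:
  assumes "f \<in> Linf \<Omega>" obtains C where "AE x in lebesgue_on \<Omega>. norm (f x) \<le> C"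
proof -
  have lt: "Linf_norm \<Omega> f < \<infinity>" using assms by (simp add: Linf_def)
  then obtain C where C: "Linf_norm \<Omega> f \<le> ereal C" by (cases "Linf_norm \<Omega> f") auto
  have "AE x in lebesgue_on \<Omega>. ereal (norm (f x)) \<le> Linf_norm \<Omega> f"
    unfolding Linf_norm_def by (rule esssup_AE)
  then have "AE x in lebesgue_on \<Omega>. norm (f x) \<le> C"
    by eventually_elim (use C in \<open>metis ereal_less_eq(3) order_trans\<close>)
  then show ?thesis by (rule that)
qed

lemma Linf_norm_AE: "Linf_norm \<Omega> f = ereal C \<Longrightarrow> AE x in lebesgue_on \<Omega>. norm (f x) \<le> C"
  using esssup_AE[of "\<lambda>x. ereal (norm (f x))" "lebesgue_on \<Omega>"] by (simp add: Linf_norm_def)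

lemma Linf_norm_nonneg:
  fixes \<Omega> :: "'a::euclidean_space set"
  assumes "open \<Omega>" "\<Omega> \<noteq> {}" shows "0 \<le> Linf_norm \<Omega> f"
proof -
  have "\<not> negligible \<Omega>" using assms by (rule open_not_negligible)
  then have "emeasure (lebesgue_on \<Omega>) (space (lebesgue_on \<Omega>)) \<noteq> 0"
    using assms(1) by (auto simp: emeasure_restrict_space negligible_iff_null_sets null_sets_def borel_open)
  then have "esssup (lebesgue_on \<Omega>) (\<lambda>x. 0 :: ereal) = 0" by (rule esssup_const)
  moreover have "esssup (lebesgue_on \<Omega>) (\<lambda>x. 0 :: ereal) \<le> Linf_norm \<Omega> f"
    unfolding Linf_norm_def by (intro esssup_mono) auto
  ultimately show ?thesis by simp
qed

lemma integrable_lebesgue_on_AE_bounded: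
  fixes f :: "'a::euclidean_space \<Rightarrow> real"
  assumes "\<Omega> \<in> lmeasurable" "f \<in> borel_measurable (lebesgue_on \<Omega>)" "AE x in lebesgue_on \<Omega>. \<bar>f x\<bar> \<le> C"
  shows "integrable (lebesgue_on \<Omega>) f"
  by (rule finite_measure.integrable_const_bound[OF finite_measure_lebesgue_on[OF assms(1)], where B = C])
    (use assms in simp_all)

lemma continuous_measurable_lebesgue_on:
  fixes f :: "'a::euclidean_space \<Rightarrow> real"
  assumes "open \<Omega>" "continuous_on \<Omega> f" shows "f \<in> borel_measurable (lebesgue_on \<Omega>)"
  using assms by (intro continuous_imp_measurable_on_sets_lebesgue) (auto simp: borel_open)

lemma integrable_Linf_mult:
  fixes f h :: "'a::euclidean_space \<Rightarrow> real"
  assumes \<Omega>: "open \<Omega>" "bounded \<Omega>" and f: "f \<in> borel_measurable (lebesgue_on \<Omega>)" "AE x in lebesgue_on \<Omega>. \<bar>f x\<bar> \<le> C"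
    and h: "continuous_on \<Omega> h" "\<And>x. \<bar>h x\<bar> \<le> B"
  shows "integrable (lebesgue_on \<Omega>) (\<lambda>x. f x * h x)"
proof (rule integrable_lebesgue_on_AE_bounded[OF lmeasurable_open_bounded[OF \<Omega>], of _ "\<bar>C\<bar> * \<bar>B\<bar>"])
  show "(\<lambda>x. f x * h x) \<in> borel_measurable (lebesgue_on \<Omega>)"
    using f(1) continuous_measurable_lebesgue_on[OF \<Omega>(1) h(1)] by (rule borel_measurable_times)
  show "AE x in lebesgue_on \<Omega>. \<bar>f x * h x\<bar> \<le> \<bar>C\<bar> * \<bar>B\<bar>"
    using f(2)
  proof eventually_elim
    case (elim x)
    then show ?case unfolding abs_mult using h(2)[of x] by (intro mult_mono) auto
  qed
qed

lemma weak_gradient_direction: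
  fixes u :: "'a::euclidean_space \<Rightarrow> real"
  assumes \<Omega>: "open \<Omega>" "bounded \<Omega>" and u: "u \<in> Linf \<Omega>" and g: "g \<in> Linf \<Omega>" "is_weak_gradient \<Omega> u g"
    and \<phi>: "\<phi> \<in> test_functions \<Omega>"
  shows "(\<integral>x. u x * frechet_derivative \<phi> (at x) e \<partial>lebesgue_on \<Omega>) = - (\<integral>x. (g x \<bullet> e) * \<phi> x \<partial>lebesgue_on \<Omega>)"
proof -
  obtain Cu where Cu: "AE x in lebesgue_on \<Omega>. norm (u x) \<le> Cu" using Linf_AE_bound[OF u] .
  obtain Cg where Cg: "AE x in lebesgue_on \<Omega>. norm (g x) \<le> Cg" using Linf_AE_bound[OF g(1)] .
  note sm = test_functionsD(1)[OF \<phi>]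
  have iu: "integrable (lebesgue_on \<Omega>) (\<lambda>x. u x * frechet_derivative \<phi> (at x) b)" for b
  proof -
    obtain B where "\<And>x. \<bar>frechet_derivative \<phi> (at x) b\<bar> \<le> B" using test_function_derivative_bounded[OF \<phi>] by blast
    then show ?thesis
      using u Cu by (intro integrable_Linf_mult[OF \<Omega> _ _ smooth_fun_continuous_derivative[OF sm]]) (auto simp: Linf_def)
  qed
  have ig: "integrable (lebesgue_on \<Omega>) (\<lambda>x. (g x \<bullet> b) * \<phi> x)" if "b \<in> Basis" for b
  proof -
    obtain B where "\<And>x. \<bar>\<phi> x\<bar> \<le> B" using test_function_bounded[OF \<phi>] by blast
    moreover have "AE x in lebesgue_on \<Omega>. \<bar>g x \<bullet> b\<bar> \<le> Cg"
      using Cg by eventually_elim (use Basis_le_norm[OF that] in \<open>metis order_trans\<close>)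
    ultimately show ?thesis
      using g(1) by (intro integrable_Linf_mult[OF \<Omega> _ _ smooth_fun_continuous[OF sm]]) (auto simp: Linf_def intro: borel_measurable_inner)
  qed
  have "(\<integral>x. u x * frechet_derivative \<phi> (at x) e \<partial>lebesgue_on \<Omega>)
    = (\<integral>x. (\<Sum>b\<in>Basis. (e \<bullet> b) * (u x * frechet_derivative \<phi> (at x) b)) \<partial>lebesgue_on \<Omega>)"
    by (intro Bochner_Integration.integral_cong refl)
      (simp add: frechet_derivative_sum_Basis[OF smooth_fun_differentiable[OF sm], of _ e] sum_distrib_left mult_ac)
  also have "\<dots> = (\<Sum>b\<in>Basis. (e \<bullet> b) * (\<integral>x. u x * frechet_derivative \<phi> (at x) b \<partial>lebesgue_on \<Omega>))"
    using iu by (subst Bochner_Integration.integral_sum) auto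
  also have "\<dots> = (\<Sum>b\<in>Basis. (e \<bullet> b) * - (\<integral>x. (g x \<bullet> b) * \<phi> x \<partial>lebesgue_on \<Omega>))"
    using g(2) \<phi> by (intro sum.cong refl) (simp add: is_weak_gradient_def)
  also have "\<dots> = - (\<integral>x. (\<Sum>b\<in>Basis. (e \<bullet> b) * ((g x \<bullet> b) * \<phi> x)) \<partial>lebesgue_on \<Omega>)"
    using ig by (subst Bochner_Integration.integral_sum) (auto simp: sum_negf)
  also have "\<dots> = - (\<integral>x. (g x \<bullet> e) * \<phi> x \<partial>lebesgue_on \<Omega>)"
    by (intro arg_cong[where f = uminus] Bochner_Integration.integral_cong refl)
      (simp add: euclidean_inner[of _ e] sum_distrib_left mult_ac)
  finally show ?thesis .
qed

context
  fixes \<Omega> :: "'a::euclidean_space set" and u :: "'a \<Rightarrow> real" and L M :: real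
  assumes \<Omega>: "open \<Omega>" "bounded \<Omega>" "\<Omega> \<noteq> {}" and u: "convex_on \<Omega> u"
    and L: "\<And>x y. x \<in> \<Omega> \<Longrightarrow> y \<in> \<Omega> \<Longrightarrow> \<bar>u x - u y\<bar> \<le> L * dist x y" "0 \<le> L"
    and bd: "\<And>x. x \<in> \<Omega> \<Longrightarrow> \<bar>u x\<bar> \<le> M"
begin

lemma convex_Lipschitz_in_Linf: "u \<in> Linf \<Omega>"
proof -
  have m: "u \<in> borel_measurable (lebesgue_on \<Omega>)"
    by (rule continuous_measurable_lebesgue_on[OF \<Omega>(1) Lipschitz_imp_continuous_on[OF L(1)]])
  have "Linf_norm \<Omega> u \<le> ereal M"
    using bd by (intro Linf_norm_le m AE_I2) auto
  then show ?thesis using m by (auto simp: Linf_def)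
qed

lemma dir_deriv_lebesgue_on: "dir_deriv \<Omega> u e \<in> borel_measurable (lebesgue_on \<Omega>)"
  using dir_deriv_measurable[OF \<Omega>(1) Lipschitz_imp_continuous_on[OF L(1)], of e]
  by (intro measurable_restrict_space1 measurable_completion) simp

lemma dir_deriv_AE_bound: "AE x in lebesgue_on \<Omega>. \<bar>dir_deriv \<Omega> u e x\<bar> \<le> L * norm e"
  using diff_quot_tendsto(2)[OF \<Omega>(1) u L(1)] by (intro AE_I2) auto

lemma convex_Lipschitz_weak_gradient_exists: "\<exists>g\<in>Linf \<Omega>. is_weak_gradient \<Omega> u g"
proof (intro bexI)
  let ?g = "\<lambda>x. \<Sum>b\<in>Basis. dir_deriv \<Omega> u b x *\<^sub>R b"
  show "is_weak_gradient \<Omega> u ?g"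
    unfolding is_weak_gradient_def using weak_dir_deriv[OF \<Omega>(1,2) u L(1) bd] by simp
  have m: "?g \<in> borel_measurable (lebesgue_on \<Omega>)"
    by (intro borel_measurable_sum borel_measurable_scaleR dir_deriv_lebesgue_on borel_measurable_const)
  have "AE x in lebesgue_on \<Omega>. norm (?g x) \<le> (\<Sum>b\<in>(Basis::'a set). L)"
  proof (rule AE_I2)
    fix x assume "x \<in> space (lebesgue_on \<Omega>)"
    then have "\<bar>dir_deriv \<Omega> u b x\<bar> \<le> L * norm b" for b using diff_quot_tendsto(2)[OF \<Omega>(1) u L(1)] by simp
    then show "norm (?g x) \<le> (\<Sum>b\<in>(Basis::'a set). L)"
      by (intro sum_norm_le) (metis norm_Basis norm_scaleR mult.right_neutral real_norm_def)
  qed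
  then have "Linf_norm \<Omega> ?g \<le> ereal (\<Sum>b\<in>(Basis::'a set). L)" by (rule Linf_norm_le[OF m])
  then show "?g \<in> Linf \<Omega>" using m by (auto simp: Linf_def)
qed

lemma convex_Lipschitz_weak_gradient_norm: "Linf_norm \<Omega> (weak_gradient \<Omega> u) \<le> ereal L"
proof -
  define G where "G = weak_gradient \<Omega> u"
  have G: "G \<in> Linf \<Omega>" "is_weak_gradient \<Omega> u G"
    using someI_ex[of "\<lambda>g. g \<in> Linf \<Omega> \<and> is_weak_gradient \<Omega> u g"] convex_Lipschitz_weak_gradient_exists
    by (auto simp: G_def weak_gradient_def)
  have Gm: "G \<in> borel_measurable (lebesgue_on \<Omega>)" using G(1) by (simp add: Linf_def)
  obtain C where C: "AE x in lebesgue_on \<Omega>. norm (G x) \<le> C" using Linf_AE_bound[OF G(1)] .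
  have Ge: "AE x in lebesgue_on \<Omega>. \<bar>G x \<bullet> e\<bar> \<le> C * norm e" for e
    using C
  proof eventually_elim
    case (elim x)
    have "\<bar>G x \<bullet> e\<bar> \<le> norm (G x) * norm e" by (rule Cauchy_Schwarz_ineq2)
    also have "\<dots> \<le> C * norm e" using elim by (intro mult_right_mono) auto
    finally show ?case .
  qed
  have Gem: "(\<lambda>x. G x \<bullet> e) \<in> borel_measurable (lebesgue_on \<Omega>)" for e
    using Gm by (intro borel_measurable_inner) auto
  have Gd: "AE x in lebesgue_on \<Omega>. G x \<bullet> e - dir_deriv \<Omega> u e x = 0" for e
  proof (rule test_functions_AE_zero[OF \<Omega>(1), of _ "C * norm e + L * norm e"])
    show "(\<lambda>x. G x \<bullet> e - dir_deriv \<Omega> u e x) \<in> borel_measurable (lebesgue_on \<Omega>)"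
      using Gem dir_deriv_lebesgue_on by (intro borel_measurable_diff)
    show "AE x in lebesgue_on \<Omega>. \<bar>G x \<bullet> e - dir_deriv \<Omega> u e x\<bar> \<le> C * norm e + L * norm e"
      using Ge[of e] dir_deriv_AE_bound[of e] by eventually_elim linarith
    fix \<phi> assume \<phi>: "\<phi> \<in> test_functions \<Omega>"
    obtain B where B: "\<And>x. \<bar>\<phi> x\<bar> \<le> B" using test_function_bounded[OF \<phi>] by blast
    note c = smooth_fun_continuous[OF test_functionsD(1)[OF \<phi>]]
    have i: "integrable (lebesgue_on \<Omega>) (\<lambda>x. (G x \<bullet> e) * \<phi> x)" "integrable (lebesgue_on \<Omega>) (\<lambda>x. dir_deriv \<Omega> u e x * \<phi> x)"
      using integrable_Linf_mult[OF \<Omega>(1,2) Gem Ge c B] integrable_Linf_mult[OF \<Omega>(1,2) dir_deriv_lebesgue_on dir_deriv_AE_bound c B] by auto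
    have "(\<integral>x. (G x \<bullet> e) * \<phi> x \<partial>lebesgue_on \<Omega>) = (\<integral>x. dir_deriv \<Omega> u e x * \<phi> x \<partial>lebesgue_on \<Omega>)"
      using weak_gradient_direction[OF \<Omega>(1,2) convex_Lipschitz_in_Linf G \<phi>, of e] weak_dir_deriv[OF \<Omega>(1,2) u L(1) bd \<phi>, of e] by simp
    then show "(\<integral>x. (G x \<bullet> e - dir_deriv \<Omega> u e x) * \<phi> x \<partial>lebesgue_on \<Omega>) = 0"
      using Bochner_Integration.integral_diff[OF i] by (simp add: left_diff_distrib)
  qed
  have e: "AE x in lebesgue_on \<Omega>. G x \<bullet> e \<le> L * norm e" for e
    using Gd[of e] dir_deriv_AE_bound[of e] by eventually_elim linarith
  obtain D :: "'a set" where D: "countable D" "\<And>X. open X \<Longrightarrow> X \<noteq> {} \<Longrightarrow> \<exists>d\<in>D. d \<in> X"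
    using countable_dense_setE by blast
  have "- closure D = {}"
    using D(2)[of "- closure D"] closure_subset[of D] by auto
  then have clD: "closure D = UNIV" by auto
  have "AE x in lebesgue_on \<Omega>. \<forall>e\<in>D. G x \<bullet> e \<le> L * norm e"
    using D(1) e by (subst AE_ball_countable) auto
  then have "AE x in lebesgue_on \<Omega>. norm (G x) \<le> L"
  proof eventually_elim
    case (elim x)
    have "closed {e. G x \<bullet> e \<le> L * norm e}" by (intro closed_Collect_le continuous_intros)
    then have "closure D \<subseteq> {e. G x \<bullet> e \<le> L * norm e}" using elim by (intro closure_minimal) auto
    then have "G x \<bullet> G x \<le> L * norm (G x)" using clD by auto
    then have "norm (G x) * norm (G x) \<le> L * norm (G x)" by (simp add: dot_square_norm power2_eq_square)
    then show ?case using L(2) by (cases "norm (G x) = 0") (auto simp: mult_le_cancel_right)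
  qed
  then show ?thesis unfolding G_def[symmetric] by (rule Linf_norm_le[OF Gm])
qed

end

lemma integral_cbox_eq_lborel:
  fixes f :: "'a::euclidean_space \<Rightarrow> real"
  assumes "integrable lborel f" "\<And>x. x \<notin> cbox p q \<Longrightarrow> f x = 0"
  shows "integral (cbox p q) f = (\<integral>x. f x \<partial>lborel)"
proof -
  have "(\<lambda>x. if x \<in> cbox p q then f x else 0) = f" using assms(2) by auto
  then show ?thesis using integral_restrict_UNIV[of "cbox p q" f] integral_lborel[OF assms(1)] by simp
qed

lemma dist_le_of_mem_cbox:
  fixes x z :: "'a::euclidean_space"
  assumes "z \<in> cbox (x - d *\<^sub>R One) (x + d *\<^sub>R One)"
  shows "dist x z \<le> d * DIM('a)"
proof -
  have "\<bar>(z - x) \<bullet> i\<bar> \<le> d" if "i \<in> Basis" for i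
  proof -
    have "x \<bullet> i - d \<le> z \<bullet> i \<and> z \<bullet> i \<le> x \<bullet> i + d"
      using assms that by (auto simp: mem_box inner_diff_left inner_add_left)
    then show ?thesis by (simp add: inner_diff_left abs_le_iff)
  qed
  then have "norm (z - x) \<le> (\<Sum>i\<in>(Basis::'a set). d)" by (intro order_trans[OF norm_le_l1 sum_mono])
  then show ?thesis by (simp add: dist_norm norm_minus_commute mult.commute)
qed

text \<open>Mollification: along the segment from \<open>x\<close> to \<open>y\<close> the average of \<open>u\<close> against a translated bump
  has derivative at most \<open>L * dist x y\<close> times the mass of the bump.\<close>

lemma weak_gradient_mollified_increment:
  fixes u U :: "'a::euclidean_space \<Rightarrow> real"
  assumes \<Omega>: "open \<Omega>" "bounded \<Omega>" and u: "u \<in> Linf \<Omega>"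
    and G: "G \<in> Linf \<Omega>" "is_weak_gradient \<Omega> u G" "AE x in lebesgue_on \<Omega>. norm (G x) \<le> L" "0 \<le> L"
    and U: "continuous_on UNIV U" "\<And>x. x \<in> \<Omega> \<Longrightarrow> U x = u x"
    and sub: "\<And>s. 0 \<le> s \<Longrightarrow> s \<le> 1 \<Longrightarrow> cbox (a + s *\<^sub>R v) (b + s *\<^sub>R v) \<subseteq> \<Omega>"
  shows "(\<integral>z. U z * bump 1 (a + v) (b + v) z \<partial>lborel) - (\<integral>z. U z * bump 1 a b z \<partial>lborel)
     \<le> L * norm v * (\<integral>z. bump 1 a b z \<partial>lborel)"
proof -
  obtain c where c: "\<Omega> \<subseteq> cbox (- c) c" using \<Omega>(2) bounded_subset_cbox_symmetric by blast
  let ?\<phi> = "\<lambda>s. bump 1 (a + s *\<^sub>R v) (b + s *\<^sub>R v)"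
  let ?\<psi> = "bump 1 a b"
  have \<phi>\<psi>: "?\<phi> s = (\<lambda>z. ?\<psi> (z + s *\<^sub>R (- v)))" for s by (rule ext) (simp add: bump_translate)
  have \<psi>d: "?\<psi> differentiable (at z)" for z using smooth_fun_differentiable[OF smooth_bump] .
  have \<phi>t: "?\<phi> s \<in> test_functions \<Omega>" if "0 \<le> s" "s \<le> 1" for s
    by (intro bump_in_test_functions sub that) simp
  have \<phi>0: "?\<phi> s z = 0" if "0 \<le> s" "s \<le> 1" "z \<notin> \<Omega>" for s z using test_functionsD(4)[OF \<phi>t] that .
  have der: "frechet_derivative (?\<phi> s) (at z) w = frechet_derivative ?\<psi> (at (z + s *\<^sub>R (- v))) w" for s z w
  proof -
    have "(?\<psi> has_derivative frechet_derivative ?\<psi> (at (z + s *\<^sub>R (- v)))) (at (z + s *\<^sub>R (- v)))"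
      using \<psi>d by (simp add: frechet_derivative_works)
    then have "((\<lambda>z. ?\<psi> (z + s *\<^sub>R (- v))) has_derivative (\<lambda>h. frechet_derivative ?\<psi> (at (z + s *\<^sub>R (- v))) h)) (at z)"
      by (intro has_derivative_compose[where g = ?\<psi> and f = "\<lambda>z. z + s *\<^sub>R (- v)" and x = z]) (auto intro!: derivative_eq_intros)
    then show ?thesis unfolding \<phi>\<psi>[symmetric] using frechet_derivative_at by metis
  qed
  define F where "F s = integral (cbox (- c) c) (\<lambda>z. U z * ?\<psi> (z + s *\<^sub>R (- v)))" for s
  define F' where "F' s = integral (cbox (- c) c) (\<lambda>z. U z * frechet_derivative ?\<psi> (at (z + s *\<^sub>R (- v))) (- v))" for s
  have cont\<psi>: "continuous_on A (\<lambda>z. frechet_derivative ?\<psi> (at z) (- v))" for A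
    by (rule smooth_fun_continuous_derivative[OF smooth_bump])
  have F: "(F has_field_derivative F' s) (at s within {0..1})" if s: "s \<in> {0..1}" for s
    unfolding F_def F'_def
  proof (rule leibniz_rule_field_derivative)
    show "((\<lambda>s. U z * ?\<psi> (z + s *\<^sub>R (- v))) has_field_derivative U z * frechet_derivative ?\<psi> (at (z + s *\<^sub>R (- v))) (- v)) (at s within {0..1})" for s z
      by (intro DERIV_cmult has_field_derivative_at_within[OF has_real_derivative_along[OF \<psi>d]])
    show "(\<lambda>z. U z * ?\<psi> (z + s *\<^sub>R (- v))) integrable_on cbox (- c) c" for s
      by (intro integrable_continuous continuous_on_mult continuous_on_subset[OF U(1)]
          continuous_on_compose2[OF smooth_fun_continuous[OF smooth_bump, of UNIV]] continuous_intros) auto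
    show "continuous_on ({0..1} \<times> cbox (- c) c) (\<lambda>(s, z). U z * frechet_derivative ?\<psi> (at (z + s *\<^sub>R (- v))) (- v))"
      unfolding case_prod_beta
      by (intro continuous_on_mult continuous_on_compose2[OF U(1)] continuous_on_compose2[OF cont\<psi>[of UNIV]] continuous_intros) auto
  qed (use s in auto)
  have "bounded (U ` closure \<Omega>)"
    using \<Omega>(2) by (intro compact_imp_bounded compact_continuous_image continuous_on_subset[OF U(1)]) auto
  then obtain B where B: "\<And>z. z \<in> closure \<Omega> \<Longrightarrow> \<bar>U z\<bar> \<le> B" by (auto simp: bounded_iff)
  have UB: "\<bar>U z * h z\<bar> \<le> \<bar>B\<bar> * C" if "\<And>z. \<bar>h z\<bar> \<le> C" "\<And>z. z \<notin> \<Omega> \<Longrightarrow> h z = 0" for h z C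
  proof (cases "z \<in> \<Omega>")
    case True
    then have "\<bar>U z\<bar> \<le> \<bar>B\<bar>" using B[of z] closure_subset[of \<Omega>] by auto
    then show ?thesis unfolding abs_mult using that(1)[of z] by (intro mult_mono) auto
  next
    case False
    have "0 \<le> C" using that(1)[of z] by simp
    then show ?thesis using that(2)[OF False] by simp
  qed
  have [measurable]: "U \<in> borel_measurable borel" using U(1) by (rule borel_measurable_continuous_onI)
  have [measurable]: "(\<lambda>z. frechet_derivative (?\<phi> s) (at z) w) \<in> borel_measurable borel" for s w
    by (intro borel_measurable_continuous_onI smooth_fun_continuous_derivative smooth_bump)
  have lb: "integral (cbox (- c) c) h = (\<integral>z. h z \<partial>lborel)"
    if "h \<in> borel_measurable borel" "\<And>z. z \<notin> \<Omega> \<Longrightarrow> h z = 0" "\<And>z. \<bar>h z\<bar> \<le> C" for h :: "'a \<Rightarrow> real" and C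
    using integrable_bounded_support[OF that(1) \<Omega>(2) that(2,3)] that(2) c by (intro integral_cbox_eq_lborel) auto
  have Fl: "F s = (\<integral>z. U z * ?\<phi> s z \<partial>lborel)" if s: "0 \<le> s" "s \<le> 1" for s
    unfolding F_def fun_cong[OF \<phi>\<psi>, symmetric]
    using \<phi>0[OF s] bump_bounds[of 1 "a + s *\<^sub>R v" "b + s *\<^sub>R v"]
    by (intro lb[of _ "\<bar>B\<bar> * 1"] UB) auto
  have F'l: "F' s \<le> L * norm v * (\<integral>z. ?\<psi> z \<partial>lborel)" if s: "0 \<le> s" "s \<le> 1" for s
  proof -
    let ?d = "\<lambda>z. frechet_derivative (?\<phi> s) (at z) (- v)"
    note \<phi> = \<phi>t[OF s]
    note lm = lmeasurable_open_bounded[OF \<Omega>]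
    obtain C where C: "\<And>z. \<bar>?d z\<bar> \<le> C" using test_function_derivative_bounded[OF \<phi>] by blast
    have d0: "?d z = 0" if "z \<notin> \<Omega>" for z
      using that test_functionsD(3)[OF \<phi>] by (intro test_function_derivative_eq_0[OF \<phi>]) auto
    have "F' s = (\<integral>z. U z * ?d z \<partial>lborel)"
      unfolding F'_def der[symmetric] using d0 C by (intro lb[of _ "\<bar>B\<bar> * C"] UB) auto
    also have "\<dots> = (\<integral>z. u z * ?d z \<partial>lebesgue_on \<Omega>)"
    proof -
      have "(\<lambda>z. indicator \<Omega> z * (u z * ?d z)) = (\<lambda>z. U z * ?d z)"
        using d0 U(2) by (force simp: indicator_def)
      moreover have "(\<lambda>z. U z * ?d z) \<in> borel_measurable borel" by measurable
      ultimately show ?thesis using \<Omega>(1) by (subst integral_lebesgue_on_lborel) (auto simp: borel_open)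
    qed
    also have "\<dots> = (\<integral>z. (G z \<bullet> v) * ?\<phi> s z \<partial>lebesgue_on \<Omega>)"
      using weak_gradient_direction[OF \<Omega> u G(1,2) \<phi>, of "- v"] by simp
    also have "\<dots> \<le> (\<integral>z. (L * norm v) * ?\<phi> s z \<partial>lebesgue_on \<Omega>)"
    proof (rule integral_mono_AE)
      have Gv: "AE z in lebesgue_on \<Omega>. \<bar>G z \<bullet> v\<bar> \<le> L * norm v"
        using G(3)
      proof eventually_elim
        case (elim z)
        show ?case using Cauchy_Schwarz_ineq2[of "G z" v] mult_right_mono[OF elim norm_ge_zero[of v]] by linarith
      qed
      show "integrable (lebesgue_on \<Omega>) (\<lambda>z. (G z \<bullet> v) * ?\<phi> s z)"
        using G(1) bump_bounds[of 1 "a + s *\<^sub>R v" "b + s *\<^sub>R v"]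
        by (intro integrable_Linf_mult[where B = 1, OF \<Omega> _ Gv smooth_fun_continuous[OF smooth_bump]]) (auto simp: Linf_def intro: borel_measurable_inner)
      show "integrable (lebesgue_on \<Omega>) (\<lambda>z. (L * norm v) * ?\<phi> s z)"
        using G(4) bump_bounds[of 1 "a + s *\<^sub>R v" "b + s *\<^sub>R v"]
        by (intro integrable_Linf_mult[where B = 1 and C = "L * norm v", OF \<Omega> _ _ smooth_fun_continuous[OF smooth_bump]]) auto
      show "AE z in lebesgue_on \<Omega>. (G z \<bullet> v) * ?\<phi> s z \<le> (L * norm v) * ?\<phi> s z"
        using Gv by eventually_elim (intro mult_right_mono bump_bounds, linarith)
    qed
    also have "\<dots> = L * norm v * (\<integral>z. ?\<phi> s z \<partial>lebesgue_on \<Omega>)" by simp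
    also have "(\<integral>z. ?\<phi> s z \<partial>lebesgue_on \<Omega>) = (\<integral>z. ?\<phi> s z \<partial>lborel)"
    proof -
      have "(\<lambda>z. indicator \<Omega> z * ?\<phi> s z) = ?\<phi> s" using \<phi>0[OF s] by (force simp: indicator_def)
      then show ?thesis using \<Omega>(1) by (subst integral_lebesgue_on_lborel) (auto simp: borel_open)
    qed
    also have "\<dots> = (\<integral>z. ?\<psi> z \<partial>lborel)"
      unfolding \<phi>\<psi> by (rule integral_translate) simp
    finally show ?thesis .
  qed
  have "\<exists>s\<in>{0<..<1}. F 1 - F 0 = F' s * (1 - 0)"
    using F by (intro mvt_simple[where f' = "\<lambda>s. (*) (F' s)"]) (auto simp: has_field_derivative_def)
  then obtain s where s: "0 < s" "s < 1" "F 1 - F 0 = F' s" by auto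
  then have "F 1 - F 0 \<le> L * norm v * (\<integral>z. ?\<psi> z \<partial>lborel)" using F'l[of s] by simp
  then show ?thesis using Fl[of 1] Fl[of 0] by simp
qed


theorem weak_gradient_bound_imp_Lipschitz:
  fixes u :: "'a::euclidean_space \<Rightarrow> real"
  assumes \<Omega>: "open \<Omega>" "bounded \<Omega>" "convex \<Omega>" and u: "u \<in> Linf \<Omega>" "continuous_on (closure \<Omega>) u"
    and G: "G \<in> Linf \<Omega>" "is_weak_gradient \<Omega> u G" "AE x in lebesgue_on \<Omega>. norm (G x) \<le> L" "0 \<le> L"
    and xy: "x \<in> \<Omega>" "y \<in> \<Omega>"
  shows "u y - u x \<le> L * dist x y"
proof (rule field_le_epsilon)
  fix \<eta> :: real assume \<eta>: "0 < \<eta>"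
  obtain U where U: "continuous_on UNIV U" "\<And>z. z \<in> closure \<Omega> \<Longrightarrow> U z = u z"
    using Tietze_unbounded[of "closure \<Omega>" u UNIV] u(2) by auto
  have Uu: "U z = u z" if "z \<in> \<Omega>" for z using U(2) that closure_subset by blast
  have "compact (closed_segment x y)" by simp
  moreover have "closed_segment x y \<subseteq> \<Omega>" using closed_segment_subset[OF xy \<Omega>(3)] .
  ultimately have "\<exists>d>0. \<forall>p\<in>closed_segment x y. \<forall>q\<in>- \<Omega>. d \<le> dist p q"
    using \<Omega>(1) by (intro separate_compact_closed) auto
  then obtain d where d: "0 < d" "\<And>p q. p \<in> closed_segment x y \<Longrightarrow> q \<notin> \<Omega> \<Longrightarrow> d \<le> dist p q" by auto
  obtain d1 where d1: "0 < d1" "\<And>z. dist x z < d1 \<Longrightarrow> \<bar>U z - U x\<bar> < \<eta> / 2"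
    using U(1) \<eta> unfolding continuous_on_iff by (metis UNIV_I dist_commute dist_real_def half_gt_zero)
  obtain d2 where d2: "0 < d2" "\<And>z. dist y z < d2 \<Longrightarrow> \<bar>U z - U y\<bar> < \<eta> / 2"
    using U(1) \<eta> unfolding continuous_on_iff by (metis UNIV_I dist_commute dist_real_def half_gt_zero)
  define w where "w = min d (min d1 d2) / (2 * DIM('a))"
  have w: "0 < w" "w * DIM('a) < d" "w * DIM('a) < d1" "w * DIM('a) < d2"
    using d(1) d1(1) d2(1) by (auto simp: w_def)
  define a where "a = x - w *\<^sub>R One"
  define b where "b = x + w *\<^sub>R One"
  let ?v = "y - x"
  have near: "dist (x + s *\<^sub>R ?v) z \<le> w * DIM('a)" if "z \<in> cbox (a + s *\<^sub>R ?v) (b + s *\<^sub>R ?v)" for s z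
    using that dist_le_of_mem_cbox[of z "x + s *\<^sub>R ?v" w] by (simp add: a_def b_def algebra_simps)
  have sub: "cbox (a + s *\<^sub>R ?v) (b + s *\<^sub>R ?v) \<subseteq> \<Omega>" if s: "0 \<le> s" "s \<le> 1" for s
  proof
    fix z assume z: "z \<in> cbox (a + s *\<^sub>R ?v) (b + s *\<^sub>R ?v)"
    have "x + s *\<^sub>R ?v \<in> closed_segment x y"
      using s by (auto simp: in_segment algebra_simps intro!: exI[of _ s])
    then show "z \<in> \<Omega>" using d(2) near[OF z] w(2) by force
  qed
  let ?\<psi> = "bump 1 a b" and ?\<chi> = "bump 1 (a + ?v) (b + ?v)"
  define I where "I = (\<integral>z. ?\<psi> z \<partial>lborel)"
  have inc: "(\<integral>z. U z * ?\<chi> z \<partial>lborel) - (\<integral>z. U z * ?\<psi> z \<partial>lborel) \<le> L * norm ?v * I"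
    unfolding I_def by (rule weak_gradient_mollified_increment[OF \<Omega>(1,2) u(1) G U(1) Uu sub])
  have Um [measurable]: "U \<in> borel_measurable borel" using U(1) by (rule borel_measurable_continuous_onI)
  have 0: "?\<psi> z = 0" if "z \<notin> cbox a b" for z using that box_subset_cbox[of a b] by (intro bump_eq_0) auto
  have 1: "?\<chi> z = 0" if "z \<notin> cbox (a + ?v) (b + ?v)" for z
    using that box_subset_cbox[of "a + ?v" "b + ?v"] by (intro bump_eq_0) auto
  have comp: "\<bar>U z * h z\<bar> \<le> B * 1" if "\<And>z. z \<in> S \<Longrightarrow> \<bar>U z\<bar> \<le> B" "0 \<le> B" "\<And>z. z \<notin> S \<Longrightarrow> h z = 0" "\<And>z. \<bar>h z\<bar> \<le> 1" for S h z B
  proof (cases "z \<in> S")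
    case True
    then show ?thesis unfolding abs_mult using that by (intro mult_mono) auto
  qed (use that in auto)
  have Ux: "\<bar>U z - u x\<bar> \<le> \<eta> / 2" if "z \<in> cbox a b" for z
    using near[of z 0] that d1(2)[of z] w(3) Uu[OF xy(1)] by force
  have Uy: "\<bar>U z - u y\<bar> \<le> \<eta> / 2" if "z \<in> cbox (a + ?v) (b + ?v)" for z
    using near[of z 1] that d2(2)[of z] w(4) Uu[OF xy(2)] by force
  have iU: "integrable lborel (\<lambda>z. U z * h z)"
    if h: "h \<in> borel_measurable borel" "\<And>z. z \<notin> cbox p q \<Longrightarrow> h z = 0" "\<And>z. \<bar>h z\<bar> \<le> 1" and k: "\<And>z. z \<in> cbox p q \<Longrightarrow> \<bar>U z - k\<bar> \<le> \<eta> / 2" for h p q k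
  proof (rule integrable_bounded_support[OF _ bounded_cbox[of p q]])
    show "(\<lambda>z. U z * h z) \<in> borel_measurable borel" using h(1) by measurable
    show "U z * h z = 0" if "z \<notin> cbox p q" for z using h(2)[OF that] by simp
    show "\<bar>U z * h z\<bar> \<le> (\<bar>k\<bar> + \<eta> / 2) * 1" for z
    proof (rule comp[of "cbox p q", OF _ _ h(2,3)])
      show "\<bar>U z\<bar> \<le> \<bar>k\<bar> + \<eta> / 2" if "z \<in> cbox p q" for z using k[OF that] by linarith
    qed (use \<eta> in auto)
  qed
  have b1: "\<bar>?\<psi> z\<bar> \<le> 1" "\<bar>?\<chi> z\<bar> \<le> 1" for z using bump_bounds[of 1 a b z] bump_bounds[of 1 "a + ?v" "b + ?v" z] by auto
  have i\<psi>: "integrable lborel ?\<psi>" by (rule integrable_bounded_support[OF _ bounded_cbox[of a b] 0 b1(1)]) simp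
  have i\<chi>: "integrable lborel ?\<chi>" by (rule integrable_bounded_support[OF _ bounded_cbox[of "a + ?v" "b + ?v"] 1 b1(2)]) simp
  have I\<chi>: "(\<integral>z. ?\<chi> z \<partial>lborel) = I"
  proof -
    have "?\<chi> = (\<lambda>z. ?\<psi> (z + - ?v))" by (rule ext, subst bump_translate, subst diff_conv_add_uminus, rule refl)
    then show ?thesis unfolding I_def by (simp only:) (rule integral_translate, simp)
  qed
  have "(\<integral>z. U z * ?\<psi> z \<partial>lborel) \<le> (\<integral>z. (u x + \<eta> / 2) * ?\<psi> z \<partial>lborel)"
  proof (rule integral_mono)
    show "integrable lborel (\<lambda>z. U z * ?\<psi> z)" by (rule iU[OF _ 0 b1(1) Ux]) auto
    show "U z * ?\<psi> z \<le> (u x + \<eta> / 2) * ?\<psi> z" for z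
    proof (cases "z \<in> cbox a b")
      case True
      have "U z \<le> u x + \<eta> / 2" using Ux[OF True] by linarith
      then show ?thesis by (intro mult_right_mono bump_bounds)
    qed (simp add: 0)
  qed (use i\<psi> in auto)
  then have lo: "(\<integral>z. U z * ?\<psi> z \<partial>lborel) \<le> (u x + \<eta> / 2) * I" by (simp add: I_def)
  have "(\<integral>z. (u y - \<eta> / 2) * ?\<chi> z \<partial>lborel) \<le> (\<integral>z. U z * ?\<chi> z \<partial>lborel)"
  proof (rule integral_mono)
    show "integrable lborel (\<lambda>z. U z * ?\<chi> z)" by (rule iU[OF _ 1 b1(2) Uy]) auto
    show "(u y - \<eta> / 2) * ?\<chi> z \<le> U z * ?\<chi> z" for z
    proof (cases "z \<in> cbox (a + ?v) (b + ?v)")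
      case True
      have "u y - \<eta> / 2 \<le> U z" using Uy[OF True] by linarith
      then show ?thesis by (intro mult_right_mono bump_bounds)
    qed (simp add: 1)
  qed (use i\<chi> in auto)
  then have hi: "(u y - \<eta> / 2) * I \<le> (\<integral>z. U z * ?\<chi> z \<partial>lborel)" by (simp add: I\<chi>)
  have Ipos: "0 < I"
  proof -
    have "0 \<le> I" unfolding I_def by (intro Bochner_Integration.integral_nonneg bump_bounds)
    moreover have "I \<noteq> 0"
    proof
      assume "I = 0"
      then have "AE z in lborel. ?\<psi> z = 0"
        using integral_nonneg_eq_0_iff_AE[OF i\<psi> AE_I2[OF bump_bounds(1)]] by (simp add: I_def)
      then have "AE z in lborel. z \<notin> box a b" by eventually_elim (use bump_pos[of 1 _ a b] in force)
      then have "box a b \<in> null_sets lebesgue"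
        by (intro null_sets_completionI) (simp add: AE_iff_null_sets)
      moreover have "x \<in> box a b" using w(1) by (auto simp: a_def b_def mem_box inner_diff_left inner_add_left)
      ultimately show False
        using open_not_negligible[of "box a b"] by (auto simp: negligible_iff_null_sets open_box)
    qed
    ultimately show ?thesis by simp
  qed
  have "(u y - \<eta> / 2) * I - (u x + \<eta> / 2) * I \<le> L * norm ?v * I"
    by (rule order_trans[OF diff_mono[OF hi lo] inc])
  then have "((u y - \<eta> / 2) - (u x + \<eta> / 2)) * I \<le> (L * norm ?v) * I" by (simp only: left_diff_distrib)
  then have "(u y - \<eta> / 2) - (u x + \<eta> / 2) \<le> L * norm ?v" using Ipos by (rule mult_right_le_imp_le)
  then show "u y - u x \<le> L * dist x y + \<eta>" by (simp add: dist_norm norm_minus_commute)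
qed

section \<open>The minimization problem\<close>

lemma Lip1_boundary_estimate:
  fixes \<Omega> :: "'a::euclidean_space set"
  assumes \<Omega>: "open \<Omega>" "bounded \<Omega>" "convex \<Omega>" "\<Omega> \<noteq> {}" and u: "u \<in> Lip1 \<Omega>"
  obtains L where "0 \<le> L" "Linf_norm \<Omega> (weak_gradient \<Omega> u) = ereal L"
    "\<And>x p. x \<in> \<Omega> \<Longrightarrow> p \<in> frontier \<Omega> \<Longrightarrow> \<bar>1 - u x\<bar> \<le> L * dist x p"
proof -
  define G where "G = weak_gradient \<Omega> u"
  have u': "u \<in> Linf \<Omega>" "continuous_on (closure \<Omega>) u" "\<And>p. p \<in> frontier \<Omega> \<Longrightarrow> u p = 1" "\<exists>g\<in>Linf \<Omega>. is_weak_gradient \<Omega> u g"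
    using u by (auto simp: Lip1_def W1inf_def)
  have G: "G \<in> Linf \<Omega>" "is_weak_gradient \<Omega> u G"
    using someI_ex[of "\<lambda>g. g \<in> Linf \<Omega> \<and> is_weak_gradient \<Omega> u g"] u'(4)
    by (auto simp: G_def weak_gradient_def)
  have "0 \<le> Linf_norm \<Omega> G" "Linf_norm \<Omega> G < \<infinity>"
    using Linf_norm_nonneg[OF \<Omega>(1,4)] G(1) by (auto simp: Linf_def)
  then obtain L where L: "Linf_norm \<Omega> G = ereal L" "0 \<le> L" by (cases "Linf_norm \<Omega> G") auto
  have Lip: "u y - u x \<le> L * dist x y" if "x \<in> \<Omega>" "y \<in> \<Omega>" for x y
    by (rule weak_gradient_bound_imp_Lipschitz[OF \<Omega>(1,2,3) u'(1,2) G Linf_norm_AE[OF L(1)] L(2) that])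
  have "\<bar>1 - u x\<bar> \<le> L * dist x p" if x: "x \<in> \<Omega>" and p: "p \<in> frontier \<Omega>" for x p
  proof -
    have pc: "p \<in> closure \<Omega>" using p by (simp add: frontier_def)
    have "u p - L * dist x p \<le> u x"
      by (rule continuous_le_on_closure[OF _ pc]) (use Lip[OF x] in \<open>auto intro!: continuous_intros u'(2) simp: algebra_simps\<close>)
    moreover have "- u p - L * dist x p \<le> - u x"
      by (rule continuous_le_on_closure[OF _ pc]) (use Lip[OF _ x] in \<open>auto intro!: continuous_intros u'(2) simp: algebra_simps dist_commute\<close>)
    ultimately show ?thesis using u'(3)[OF p] by (simp add: abs_le_iff)
  qed
  then show ?thesis using that L by (simp add: G_def)
qed

lemma open_positivity_set:
  assumes "open \<Omega>" "continuous_on \<Omega> u" shows "open {x \<in> \<Omega>. (0::real) < u x}"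
proof -
  have "{x \<in> \<Omega>. 0 < u x} = \<Omega> \<inter> u -` {0<..}" by auto
  then show ?thesis using assms by (simp add: continuous_open_preimage)
qed

lemma zero_set_subset_inner_parallel:
  fixes \<Omega> :: "'a::euclidean_space set"
  assumes L: "0 < L" and est: "\<And>x p. x \<in> \<Omega> \<Longrightarrow> p \<in> frontier \<Omega> \<Longrightarrow> \<bar>1 - u x\<bar> \<le> L * dist x p"
    and x: "x \<in> \<Omega>" "u x = 0"
  shows "x \<in> inner_parallel \<Omega> (1 / L)"
proof -
  have "y \<in> \<Omega>" if y: "dist x y < 1 / L" for y
  proof (rule ccontr)
    assume "y \<notin> \<Omega>"
    then have "closed_segment x y \<inter> frontier \<Omega> \<noteq> {}"
      using x(1) by (intro connected_Int_frontier) auto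
    then obtain p where p: "p \<in> closed_segment x y" "p \<in> frontier \<Omega>" by blast
    have "1 \<le> L * dist x p" using est[OF x(1) p(2)] x(2) by simp
    moreover have "dist x p \<le> dist x y" using dist_in_closed_segment[OF p(1)] by (simp add: dist_commute)
    ultimately have "1 \<le> L * dist x y" using L by (meson mult_left_mono less_imp_le order_trans)
    then show False using y L by (simp add: field_simps)
  qed
  then show ?thesis by (auto simp: inner_parallel_def)
qed

lemma positivity_measure_ge:
  fixes \<Omega> :: "'a::euclidean_space set" and u :: "'a \<Rightarrow> real"
  assumes \<Omega>: "open \<Omega>" "bounded \<Omega>" and t: "0 < t" and u: "continuous_on \<Omega> u" "\<And>x. x \<in> \<Omega> \<Longrightarrow> 0 \<le> u x"
    and sub: "\<And>x. x \<in> \<Omega> \<Longrightarrow> u x = 0 \<Longrightarrow> x \<in> inner_parallel \<Omega> t"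
  shows "measure lebesgue \<Omega> - measure lebesgue (inner_parallel \<Omega> t) \<le> measure lebesgue {x \<in> \<Omega>. 0 < u x}"
proof -
  note l = lmeasurable_open_bounded[OF \<Omega>] lmeasurable_inner_parallel[OF \<Omega>(2) t]
  have "measure lebesgue \<Omega> - measure lebesgue (inner_parallel \<Omega> t) = measure lebesgue (\<Omega> - inner_parallel \<Omega> t)"
    using l inner_parallel_subset[OF t] by (subst measurable_measure_Diff) auto
  also have "\<dots> \<le> measure lebesgue {x \<in> \<Omega>. 0 < u x}"
  proof (rule measure_mono_fmeasurable)
    show "\<Omega> - inner_parallel \<Omega> t \<subseteq> {x \<in> \<Omega>. 0 < u x}"
    proof
      fix x assume x: "x \<in> \<Omega> - inner_parallel \<Omega> t"
      then have "u x \<noteq> 0" using sub by blast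
      then show "x \<in> {x \<in> \<Omega>. 0 < u x}" using x u(2)[of x] by simp
    qed
    show "\<Omega> - inner_parallel \<Omega> t \<in> sets lebesgue" using l by auto
    show "{x \<in> \<Omega>. 0 < u x} \<in> lmeasurable"
      using open_positivity_set[OF \<Omega>(1) u(1)] \<Omega>(2) by (intro lmeasurable_open_bounded) (auto intro: bounded_subset)
  qed
  finally show ?thesis .
qed

lemma J_ge:
  fixes \<Omega> :: "'a::euclidean_space set"
  assumes \<Omega>: "open \<Omega>" "bounded \<Omega>" "convex \<Omega>" "\<Omega> \<noteq> {}" and u: "u \<in> Lip1 \<Omega>" and \<Lambda>: "0 < \<Lambda>"
  obtains "\<And>x. x \<in> closure \<Omega> \<Longrightarrow> u x = 1" "J \<Omega> \<Lambda> u = ereal (\<Lambda> * measure lebesgue \<Omega>)"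
  | t where "0 < t" "ereal (1 / t + \<Lambda> * (measure lebesgue \<Omega> - measure lebesgue (inner_parallel \<Omega> t))) \<le> J \<Omega> \<Lambda> u"
proof -
  obtain L where L: "0 \<le> L" "Linf_norm \<Omega> (weak_gradient \<Omega> u) = ereal L"
    and est: "\<And>x p. x \<in> \<Omega> \<Longrightarrow> p \<in> frontier \<Omega> \<Longrightarrow> \<bar>1 - u x\<bar> \<le> L * dist x p"
    using Lip1_boundary_estimate[OF \<Omega> u] by blast
  have J: "J \<Omega> \<Lambda> u = ereal (L + \<Lambda> * measure lebesgue {x\<in>\<Omega>. 0 < u x})" by (simp add: J_def L(2))
  have u': "continuous_on \<Omega> u" "\<And>x. x \<in> \<Omega> \<Longrightarrow> 0 \<le> u x" "\<And>x. x \<in> frontier \<Omega> \<Longrightarrow> u x = 1"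
    using u continuous_on_subset[OF _ closure_subset] by (auto simp: Lip1_def)
  show ?thesis
  proof (cases "L = 0")
    case True
    have "frontier \<Omega> \<noteq> {}" using \<Omega> not_bounded_UNIV by (auto simp: frontier_eq_empty)
    then obtain p where p: "p \<in> frontier \<Omega>" by blast
    have u1: "u x = 1" if "x \<in> \<Omega>" for x using est[OF that p] True by simp
    then have "{x\<in>\<Omega>. 0 < u x} = \<Omega>" by auto
    moreover have "u x = 1" if "x \<in> closure \<Omega>" for x
      using that u1 u'(3) \<Omega>(1) by (cases "x \<in> \<Omega>") (auto simp: frontier_def interior_open)
    ultimately show ?thesis using that(1) J True by simp
  next
    case False
    with L have "0 < L" by simp
    then have "measure lebesgue \<Omega> - measure lebesgue (inner_parallel \<Omega> (1 / L)) \<le> measure lebesgue {x \<in> \<Omega>. 0 < u x}"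
      using zero_set_subset_inner_parallel[OF _ est] by (intro positivity_measure_ge \<Omega> u') auto
    then have "\<Lambda> * (measure lebesgue \<Omega> - measure lebesgue (inner_parallel \<Omega> (1 / L))) \<le> \<Lambda> * measure lebesgue {x \<in> \<Omega>. 0 < u x}"
      using \<Lambda> by (intro mult_left_mono) auto
    then show ?thesis using that(2)[of "1 / L"] \<open>0 < L\<close> by (simp add: J)
  qed
qed

lemma convex_Lipschitz_in_Lip1:
  fixes \<Omega> :: "'a::euclidean_space set"
  assumes \<Omega>: "open \<Omega>" "bounded \<Omega>" "\<Omega> \<noteq> {}" and u: "convex_on \<Omega> u"
    and L: "\<And>x y. \<bar>u x - u y\<bar> \<le> L * dist x y" "0 \<le> L"
    and bd: "\<And>x. 0 \<le> u x" "\<And>x. u x \<le> 1" and fr: "\<And>x. x \<in> frontier \<Omega> \<Longrightarrow> u x = 1"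
  shows "u \<in> Lip1 \<Omega>"
    and "J \<Omega> \<Lambda> u \<le> ereal (L + \<Lambda> * measure lebesgue {x\<in>\<Omega>. 0 < u x})"
proof -
  have b: "\<bar>u x\<bar> \<le> 1" for x using bd[of x] by simp
  have "continuous_on (closure \<Omega>) u" using L(1) by (rule Lipschitz_imp_continuous_on)
  moreover have "u \<in> Linf \<Omega>" by (rule convex_Lipschitz_in_Linf[OF \<Omega> u L b])
  moreover have "\<exists>g\<in>Linf \<Omega>. is_weak_gradient \<Omega> u g" by (rule convex_Lipschitz_weak_gradient_exists[OF \<Omega> u L b])
  ultimately show "u \<in> Lip1 \<Omega>" using bd fr by (auto simp: Lip1_def W1inf_def)
  have "Linf_norm \<Omega> (weak_gradient \<Omega> u) \<le> ereal L"
    by (rule convex_Lipschitz_weak_gradient_norm[OF \<Omega> u L b])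
  then show "J \<Omega> \<Lambda> u \<le> ereal (L + \<Lambda> * measure lebesgue {x\<in>\<Omega>. 0 < u x})"
    unfolding J_def plus_ereal.simps(1)[symmetric] by (rule add_right_mono)
qed

lemma convex_on_neg_infdist_Compl:
  fixes \<Omega> :: "'a::euclidean_space set"
  assumes "convex \<Omega>" "- \<Omega> \<noteq> {}"
  shows "convex_on \<Omega> (\<lambda>x. - infdist x (- \<Omega>))"
proof (rule convex_onI)
  fix s x y assume s: "0 < s" "s < (1::real)" and xy: "x \<in> \<Omega>" "y \<in> \<Omega>"
  let ?d = "\<lambda>x. infdist x (- \<Omega>)"
  define z where "z = (1 - s) *\<^sub>R x + s *\<^sub>R y"
  define \<rho> where "\<rho> = (1 - s) * ?d x + s * ?d y"
  have near: "q \<in> \<Omega>" if "dist p q < ?d p" for p q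
    using that infdist_le[of q "- \<Omega>" p] by force
  have "\<rho> \<le> dist z w" if w: "w \<in> - \<Omega>" for w
  proof (rule ccontr)
    assume "\<not> \<rho> \<le> dist z w"
    then have lt: "dist z w < \<rho>" by simp
    then have \<rho>: "0 < \<rho>" using zero_le_dist[of z w] by linarith
    define v where "v = (w - z) /\<^sub>R \<rho>"
    have "norm v = dist z w / \<rho>" using \<rho> by (simp add: v_def dist_norm norm_minus_commute divide_inverse mult.commute)
    then have v: "norm v < 1" using lt \<rho> by simp
    have mem: "p + ?d p *\<^sub>R v \<in> \<Omega>" if p: "p \<in> \<Omega>" for p
    proof (cases "?d p = 0")
      case False
      then have "0 < ?d p" using infdist_nonneg[of p "- \<Omega>"] by simp
      then have "dist p (p + ?d p *\<^sub>R v) < ?d p" using v by (simp add: dist_norm)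
      then show ?thesis by (rule near)
    qed (use p in simp)
    have "(1 - s) *\<^sub>R (x + ?d x *\<^sub>R v) + s *\<^sub>R (y + ?d y *\<^sub>R v) \<in> \<Omega>"
      using s xy mem by (intro convexD_alt[OF assms(1)]) auto
    also have "(1 - s) *\<^sub>R (x + ?d x *\<^sub>R v) + s *\<^sub>R (y + ?d y *\<^sub>R v) = z + \<rho> *\<^sub>R v"
      by (simp add: z_def \<rho>_def algebra_simps)
    also have "\<dots> = w" using \<rho> by (simp add: v_def)
    finally show False using w by simp
  qed
  then have "\<rho> \<le> ?d z" using assms(2) by (auto simp: infdist_def intro!: cINF_greatest)
  then show "- ?d ((1 - s) *\<^sub>R x + s *\<^sub>R y) \<le> (1 - s) * (- ?d x) + s * (- ?d y)"
    by (simp add: z_def \<rho>_def)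
qed (rule assms(1))

lemma inner_parallel_iff_infdist:
  assumes "- \<Omega> \<noteq> {}" shows "x \<in> inner_parallel \<Omega> t \<longleftrightarrow> t \<le> infdist x (- \<Omega>)"
proof
  assume "x \<in> inner_parallel \<Omega> t"
  then have "t \<le> dist x y" if "y \<in> - \<Omega>" for y using that by (auto simp: inner_parallel_def subset_eq not_le[symmetric])
  then show "t \<le> infdist x (- \<Omega>)" using assms by (auto simp: infdist_def intro!: cINF_greatest)
next
  assume "t \<le> infdist x (- \<Omega>)"
  then show "x \<in> inner_parallel \<Omega> t"
    using infdist_le[of _ "- \<Omega>" x] by (force simp: inner_parallel_def)
qed

lemma convex_on_max_fun:
  assumes f: "convex_on S f" and g: "convex_on S g" shows "convex_on S (\<lambda>x. max (f x) (g x :: real))"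
proof (rule convex_onI)
  show "convex S" using f by (rule convex_on_imp_convex)
  fix t x y assume t: "0 < t" "t < (1::real)" and xy: "x \<in> S" "y \<in> S"
  have "(1 - t) * f x + t * f y \<le> (1 - t) * max (f x) (g x) + t * max (f y) (g y)"
    "(1 - t) * g x + t * g y \<le> (1 - t) * max (f x) (g x) + t * max (f y) (g y)"
    using t by (auto intro!: add_mono mult_left_mono)
  moreover have "f ((1 - t) *\<^sub>R x + t *\<^sub>R y) \<le> (1 - t) * f x + t * f y" "g ((1 - t) *\<^sub>R x + t *\<^sub>R y) \<le> (1 - t) * g x + t * g y"
    using t xy convex_onD[OF f, of t x y] convex_onD[OF g, of t x y] by auto
  ultimately show "max (f ((1 - t) *\<^sub>R x + t *\<^sub>R y)) (g ((1 - t) *\<^sub>R x + t *\<^sub>R y))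
      \<le> (1 - t) * max (f x) (g x) + t * max (f y) (g y)" by linarith
qed

definition cone_profile :: "'a::metric_space set \<Rightarrow> real \<Rightarrow> 'a \<Rightarrow> real" where
  "cone_profile \<Omega> t x = max 0 (1 - infdist x (- \<Omega>) / t)"

lemma cone_profile_Lip1:
  fixes \<Omega> :: "'a::euclidean_space set"
  assumes \<Omega>: "open \<Omega>" "bounded \<Omega>" "convex \<Omega>" "\<Omega> \<noteq> {}" and t: "0 < t"
  shows "cone_profile \<Omega> t \<in> Lip1 \<Omega>"
    and "J \<Omega> \<Lambda> (cone_profile \<Omega> t) \<le> ereal (1 / t + \<Lambda> * (measure lebesgue \<Omega> - measure lebesgue (inner_parallel \<Omega> t)))"
    and "inner_parallel \<Omega> t \<noteq> {} \<Longrightarrow> \<not> cone_profile \<Omega> t constant_on closure \<Omega>"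
proof -
  have "\<Omega> \<noteq> UNIV" using \<Omega>(2) not_bounded_UNIV by blast
  then have ne: "- \<Omega> \<noteq> {}" by auto
  let ?d = "\<lambda>x. infdist x (- \<Omega>)" and ?u = "cone_profile \<Omega> t"
  have fr: "?u x = 1" if "x \<in> frontier \<Omega>" for x
  proof -
    have "x \<in> - \<Omega>" using that \<Omega>(1) by (auto simp: frontier_def interior_open)
    then show ?thesis by (simp add: cone_profile_def infdist_zero)
  qed
  have cv: "convex_on \<Omega> ?u"
  proof -
    have "convex_on \<Omega> (\<lambda>x. 1 + (1 / t) * (- ?d x))"
      using t by (intro convex_on_add convex_on_cmul convex_on_neg_infdist_Compl \<Omega> ne convex_on_const[THEN iffD2]) auto
    then have "convex_on \<Omega> (\<lambda>x. max 0 (1 + (1 / t) * (- ?d x)))"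
      by (intro convex_on_max_fun convex_on_const[THEN iffD2] \<Omega>)
    then show ?thesis by (simp add: cone_profile_def[abs_def])
  qed
  have lip: "\<bar>?u x - ?u y\<bar> \<le> (1 / t) * dist x y" for x y
  proof -
    have "\<bar>?u x - ?u y\<bar> \<le> \<bar>?d x / t - ?d y / t\<bar>" unfolding cone_profile_def by linarith
    also have "\<dots> = \<bar>?d x - ?d y\<bar> / t" using t by (simp add: diff_divide_distrib[symmetric])
    also have "\<dots> \<le> dist x y / t" using t infdist_triangle_abs[of x "- \<Omega>" y] by (intro divide_right_mono) auto
    finally show ?thesis by simp
  qed
  have bd: "0 \<le> ?u x" "?u x \<le> 1" for x using t infdist_nonneg[of x "- \<Omega>"] by (auto simp: cone_profile_def)
  have t': "0 \<le> 1 / t" using t by simp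
  show "?u \<in> Lip1 \<Omega>" by (rule convex_Lipschitz_in_Lip1(1)[OF \<Omega>(1,2,4) cv lip t' bd fr])
  have set: "{x\<in>\<Omega>. 0 < ?u x} = \<Omega> - inner_parallel \<Omega> t"
    using t by (auto simp: cone_profile_def inner_parallel_iff_infdist[OF ne] not_le field_simps)
  have "measure lebesgue (\<Omega> - inner_parallel \<Omega> t) = measure lebesgue \<Omega> - measure lebesgue (inner_parallel \<Omega> t)"
    using lmeasurable_open_bounded[OF \<Omega>(1,2)] lmeasurable_inner_parallel[OF \<Omega>(2) t] inner_parallel_subset[OF t]
    by (intro measurable_measure_Diff) auto
  then show "J \<Omega> \<Lambda> ?u \<le> ereal (1 / t + \<Lambda> * (measure lebesgue \<Omega> - measure lebesgue (inner_parallel \<Omega> t)))"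
    using convex_Lipschitz_in_Lip1(2)[OF \<Omega>(1,2,4) cv lip t' bd fr, of \<Lambda>] by (simp add: set)
  show "\<not> ?u constant_on closure \<Omega>" if K: "inner_parallel \<Omega> t \<noteq> {}"
  proof
    assume c: "?u constant_on closure \<Omega>"
    obtain x where x: "x \<in> inner_parallel \<Omega> t" using K by blast
    have "frontier \<Omega> \<noteq> {}" using \<Omega> not_bounded_UNIV by (auto simp: frontier_eq_empty)
    then obtain p where p: "p \<in> frontier \<Omega>" by blast
    have "x \<in> closure \<Omega>" using x inner_parallel_subset[OF t] closure_subset by blast
    moreover have "p \<in> closure \<Omega>" using p by (simp add: frontier_def)
    ultimately have "?u x = ?u p" using c by (auto simp: constant_on_def)
    moreover have "?u x = 0" using x t by (simp add: cone_profile_def inner_parallel_iff_infdist[OF ne])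
    ultimately show False using fr[OF p] by simp
  qed
qed

lemma const_one_Lip1:
  fixes \<Omega> :: "'a::euclidean_space set"
  assumes \<Omega>: "open \<Omega>" "bounded \<Omega>" "convex \<Omega>" "\<Omega> \<noteq> {}"
  shows "(\<lambda>_. 1) \<in> Lip1 \<Omega>" "J \<Omega> \<Lambda> (\<lambda>_. 1) \<le> ereal (\<Lambda> * measure lebesgue \<Omega>)"
proof -
  have cv: "convex_on \<Omega> (\<lambda>_. 1 :: real)" using \<Omega>(3) by (simp add: convex_on_const)
  show "(\<lambda>_. 1) \<in> Lip1 \<Omega>" by (rule convex_Lipschitz_in_Lip1(1)[OF \<Omega>(1,2,4) cv, of 0]) auto
  have "J \<Omega> \<Lambda> (\<lambda>_. 1) \<le> ereal (0 + \<Lambda> * measure lebesgue {x\<in>\<Omega>. (0::real) < 1})"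
    by (rule convex_Lipschitz_in_Lip1(2)[OF \<Omega>(1,2,4) cv, of 0]) auto
  then show "J \<Omega> \<Lambda> (\<lambda>_. 1) \<le> ereal (\<Lambda> * measure lebesgue \<Omega>)" by simp
qed

lemma inner_parallel_antimono: "s \<le> t \<Longrightarrow> inner_parallel \<Omega> t \<subseteq> inner_parallel \<Omega> s"
  using subset_ball by (fastforce simp: inner_parallel_def)

lemma measure_inner_parallel_antimono:
  fixes \<Omega> :: "'a::euclidean_space set"
  assumes "bounded \<Omega>" "0 < s" "s \<le> t"
  shows "measure lebesgue (inner_parallel \<Omega> t) \<le> measure lebesgue (inner_parallel \<Omega> s)"
  using assms lmeasurable_inner_parallel[OF assms(1)] inner_parallel_antimono[OF assms(3)]
  by (intro measure_mono_fmeasurable fmeasurableD) auto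

lemma measure_inner_parallel_usc:
  fixes \<Omega> :: "'a::euclidean_space set"
  assumes bd: "bounded \<Omega>" and l: "0 < l" and \<epsilon>: "0 < \<epsilon>" and X: "X \<longlonglongrightarrow> l"
  shows "\<forall>\<^sub>F n in sequentially. measure lebesgue (inner_parallel \<Omega> (X n)) \<le> measure lebesgue (inner_parallel \<Omega> l) + \<epsilon>"
proof -
  define s where "s n = l - l / real (n + 2)" for n
  have s: "0 < s n" "s n < l" for n using l by (auto simp: s_def field_simps add_pos_nonneg)
  have slim: "s \<longlonglongrightarrow> l"
  proof -
    have "(\<lambda>n. l - l * inverse (real (Suc (n + 1)))) \<longlonglongrightarrow> l - l * 0"
      by (intro tendsto_intros LIMSEQ_ignore_initial_segment[OF LIMSEQ_inverse_real_of_nat])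
    then show ?thesis by (simp add: s_def[abs_def] divide_inverse)
  qed
  have "(\<lambda>n. measure lebesgue (inner_parallel \<Omega> (s n))) \<longlonglongrightarrow> measure lebesgue (\<Inter>n. inner_parallel \<Omega> (s n))"
  proof (rule Lim_measure_decseq)
    show "range (\<lambda>n. inner_parallel \<Omega> (s n)) \<subseteq> sets lebesgue"
      using lmeasurable_inner_parallel[OF bd s(1)] by auto
    show "decseq (\<lambda>n. inner_parallel \<Omega> (s n))"
      using l by (intro decseq_SucI inner_parallel_antimono) (simp add: s_def frac_le)
    show "emeasure lebesgue (inner_parallel \<Omega> (s n)) \<noteq> \<infinity>" for n
      using lmeasurable_inner_parallel[OF bd s(1)] by (metis fmeasurableD2 infinity_ennreal_def)
  qed
  also have "(\<Inter>n. inner_parallel \<Omega> (s n)) = inner_parallel \<Omega> l"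
  proof
    show "inner_parallel \<Omega> l \<subseteq> (\<Inter>n. inner_parallel \<Omega> (s n))"
      using inner_parallel_antimono[OF less_imp_le[OF s(2)]] by blast
    show "(\<Inter>n. inner_parallel \<Omega> (s n)) \<subseteq> inner_parallel \<Omega> l"
    proof
      fix x assume x: "x \<in> (\<Inter>n. inner_parallel \<Omega> (s n))"
      have "y \<in> \<Omega>" if xy: "dist x y < l" for y
      proof -
        obtain n where "dist x y < s n"
          using order_tendstoD(1)[OF slim xy] by (auto simp: eventually_sequentially)
        then show ?thesis using x by (auto simp: inner_parallel_def subset_eq)
      qed
      then show "x \<in> inner_parallel \<Omega> l" by (auto simp: inner_parallel_def)
    qed
  qed
  finally have "\<forall>\<^sub>F n in sequentially. measure lebesgue (inner_parallel \<Omega> (s n)) < measure lebesgue (inner_parallel \<Omega> l) + \<epsilon>"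
    using \<epsilon> by (intro order_tendstoD(2)) auto
  then obtain k where k: "measure lebesgue (inner_parallel \<Omega> (s k)) < measure lebesgue (inner_parallel \<Omega> l) + \<epsilon>"
    by (auto simp: eventually_sequentially)
  have "\<forall>\<^sub>F n in sequentially. s k < X n" using X s(2) by (rule order_tendstoD)
  then show ?thesis
  proof eventually_elim
    case (elim n)
    have "measure lebesgue (inner_parallel \<Omega> (X n)) \<le> measure lebesgue (inner_parallel \<Omega> (s k))"
      using elim by (intro measure_inner_parallel_antimono bd s) simp
    then show ?case using k by linarith
  qed
qed

lemma inner_parallel_functional_attains_max:
  fixes \<Omega> :: "'a::euclidean_space set" and p q :: "real \<Rightarrow> real"
  defines "f \<equiv> \<lambda>t. q t * measure lebesgue (inner_parallel \<Omega> t) - p t"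
  assumes bd: "bounded \<Omega>" and ab: "0 < a" "a \<le> b" and pq: "continuous_on {a..b} p" "continuous_on {a..b} q"
    and q: "\<And>t. t \<in> {a..b} \<Longrightarrow> 0 \<le> q t" and B: "\<And>t. t \<in> {a..b} \<Longrightarrow> f t \<le> B"
  obtains t where "t \<in> {a..b}" "\<And>s. s \<in> {a..b} \<Longrightarrow> f s \<le> f t"
proof -
  define S where "S = Sup (f ` {a..b})"
  have ne: "f ` {a..b} \<noteq> {}" using ab by simp
  have bdd: "bdd_above (f ` {a..b})" using B by (rule bdd_aboveI2)
  have "\<exists>y\<in>{a..b}. S - 1 / real (Suc n) < f y" for n
  proof -
    have "S - 1 / real (Suc n) < Sup (f ` {a..b})" by (simp add: S_def)
    then show ?thesis using less_cSup_iff[OF ne bdd] by auto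
  qed
  then obtain y where y: "\<And>n. y n \<in> {a..b}" "\<And>n. S - 1 / real (Suc n) < f (y n)" by metis
  obtain l r where lr: "l \<in> {a..b}" "strict_mono (r :: nat \<Rightarrow> nat)" "(y \<circ> r) \<longlonglongrightarrow> l"
    using compact_Icc[of a b, unfolded compact_def] y(1) by meson
  have l: "0 < l" using lr(1) ab by simp
  let ?W = "\<lambda>t. measure lebesgue (inner_parallel \<Omega> t)"
  have yl: "(\<lambda>n. h (y (r n))) \<longlonglongrightarrow> h l" if "continuous_on {a..b} h" for h :: "real \<Rightarrow> real"
    using that lr y(1) unfolding continuous_on_sequentially by (auto simp: o_def)
  have Sle: "S \<le> q l * (?W l + \<epsilon>) - p l" if \<epsilon>: "0 < \<epsilon>" for \<epsilon>
  proof (rule tendsto_le[OF sequentially_bot])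
    show "(\<lambda>n. q (y (r n)) * (?W l + \<epsilon>) - p (y (r n))) \<longlonglongrightarrow> q l * (?W l + \<epsilon>) - p l"
      by (intro tendsto_intros yl pq)
    have "(\<lambda>n. S - inverse (real (Suc n))) \<longlonglongrightarrow> S - 0" by (intro tendsto_intros LIMSEQ_inverse_real_of_nat)
    then show "(\<lambda>n. S - 1 / real (Suc (r n))) \<longlonglongrightarrow> S"
      using LIMSEQ_subseq_LIMSEQ[OF _ lr(2)] by (fastforce simp: o_def inverse_eq_divide)
    have "\<forall>\<^sub>F n in sequentially. ?W ((y \<circ> r) n) \<le> ?W l + \<epsilon>" by (rule measure_inner_parallel_usc[OF bd l \<epsilon> lr(3)])
    then show "\<forall>\<^sub>F n in sequentially. S - 1 / real (Suc (r n)) \<le> q (y (r n)) * (?W l + \<epsilon>) - p (y (r n))"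
    proof eventually_elim
      case (elim n)
      have "S - 1 / real (Suc (r n)) \<le> f (y (r n))" using y(2)[of "r n"] by simp
      also have "\<dots> \<le> q (y (r n)) * (?W l + \<epsilon>) - p (y (r n))"
        unfolding f_def using elim q[OF y(1)[of "r n"]] by (intro diff_right_mono mult_left_mono) auto
      finally show ?case .
    qed
  qed
  have "S \<le> f l"
  proof (rule field_le_epsilon)
    fix e :: real assume e: "0 < e"
    have ql: "0 \<le> q l" using q lr(1) .
    have "S \<le> q l * (?W l + e / (q l + 1)) - p l" using e ql by (intro Sle) (auto intro: divide_pos_pos)
    also have "\<dots> = f l + q l / (q l + 1) * e" by (simp add: f_def algebra_simps)
    also have "\<dots> \<le> f l + 1 * e" using e ql by (intro add_left_mono mult_right_mono) (auto simp: divide_le_eq)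
    finally show "S \<le> f l + e" by simp
  qed
  then show ?thesis using that[OF lr(1)] cSup_upper[OF imageI bdd] by (force simp: S_def)
qed

lemma inner_parallel_empty:
  fixes \<Omega> :: "'a::euclidean_space set"
  assumes "bounded \<Omega>" obtains D where "0 < D" "\<And>t. D < t \<Longrightarrow> inner_parallel \<Omega> t = {}"
proof -
  obtain R where R: "0 < R" "\<And>x. x \<in> \<Omega> \<Longrightarrow> norm x \<le> R" using assms by (auto simp: bounded_pos)
  obtain e :: 'a where e: "norm e = 1" using vector_choose_size[of 1] by auto
  have "inner_parallel \<Omega> t = {}" if t: "3 * R < t" for t
  proof (rule ccontr)
    assume "inner_parallel \<Omega> t \<noteq> {}"
    then obtain x where x: "ball x t \<subseteq> \<Omega>" by (auto simp: inner_parallel_def)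
    have "x \<in> \<Omega>" "x + (3 * R) *\<^sub>R e \<in> \<Omega>" using x t R(1) e by (auto simp: subset_eq dist_norm)
    then have "norm x \<le> R" "norm (x + (3 * R) *\<^sub>R e) \<le> R" using R(2) by auto
    moreover have "norm ((3 * R) *\<^sub>R e) \<le> norm (x + (3 * R) *\<^sub>R e) + norm x"
      using norm_triangle_ineq4[of "x + (3 * R) *\<^sub>R e" x] by simp
    ultimately show False using e R(1) by simp
  qed
  then show ?thesis using that[of "3 * R"] R(1) by simp
qed

lemma nonconstant_solution_iff:
  fixes \<Omega> :: "'a::euclidean_space set"
  assumes \<Omega>: "open \<Omega>" "bounded \<Omega>" "convex \<Omega>" "\<Omega> \<noteq> {}" and \<Lambda>: "0 < \<Lambda>"
  shows "(\<exists>u. is_solution \<Omega> \<Lambda> u \<and> \<not> u constant_on closure \<Omega>) \<longleftrightarrow>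
    (\<exists>t>0. 1 \<le> \<Lambda> * (t * measure lebesgue (inner_parallel \<Omega> t)))"
proof -
  let ?W = "\<lambda>t. measure lebesgue (inner_parallel \<Omega> t)" and ?m = "measure lebesgue \<Omega>"
  define h where "h t = 1 / t + \<Lambda> * (?m - ?W t)" for t
  have m: "0 < ?m" using measure_open_pos[OF \<Omega>(1,2,4)] .
  have Wm: "?W t \<le> ?m" if "0 < t" for t
    using lmeasurable_open_bounded[OF \<Omega>(1,2)] lmeasurable_inner_parallel[OF \<Omega>(2) that] inner_parallel_subset[OF that]
    by (intro measure_mono_fmeasurable) auto
  have h_iff: "1 \<le> \<Lambda> * (t * ?W t) \<longleftrightarrow> h t \<le> \<Lambda> * ?m" if t: "0 < t" for t
  proof -
    have "h t \<le> \<Lambda> * ?m \<longleftrightarrow> 1 / t \<le> \<Lambda> * ?W t" by (simp add: h_def algebra_simps)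
    also have "\<dots> \<longleftrightarrow> 1 \<le> \<Lambda> * (t * ?W t)" using t by (simp add: pos_divide_le_eq mult_ac)
    finally show ?thesis by simp
  qed
  show ?thesis
  proof
    assume "\<exists>u. is_solution \<Omega> \<Lambda> u \<and> \<not> u constant_on closure \<Omega>"
    then obtain u where u: "u \<in> Lip1 \<Omega>" "\<And>v. v \<in> Lip1 \<Omega> \<Longrightarrow> J \<Omega> \<Lambda> u \<le> J \<Omega> \<Lambda> v" "\<not> u constant_on closure \<Omega>"
      by (auto simp: is_solution_def is_arg_min_def not_less)
    from \<Omega> u(1) \<Lambda> show "\<exists>t>0. 1 \<le> \<Lambda> * (t * ?W t)"
    proof (cases rule: J_ge)
      case 1
      then show ?thesis using u(3) by (auto simp: constant_on_def)
    next
      case (2 t)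
      have "ereal (h t) \<le> J \<Omega> \<Lambda> u" using 2 by (simp add: h_def)
      also have "\<dots> \<le> J \<Omega> \<Lambda> (\<lambda>_. 1)" by (rule u(2)[OF const_one_Lip1(1)[OF \<Omega>]])
      also have "\<dots> \<le> ereal (\<Lambda> * ?m)" by (rule const_one_Lip1(2)[OF \<Omega>])
      finally show ?thesis using h_iff 2(1) by auto
    qed
  next
    assume "\<exists>t>0. 1 \<le> \<Lambda> * (t * ?W t)"
    then obtain t0 where t0: "0 < t0" "1 \<le> \<Lambda> * (t0 * ?W t0)" by blast
    obtain D where D: "0 < D" "\<And>t. D < t \<Longrightarrow> inner_parallel \<Omega> t = {}" using inner_parallel_empty[OF \<Omega>(2)] by blast
    define a where "a = 1 / (\<Lambda> * ?m)"
    have a: "0 < a" using \<Lambda> m by (simp add: a_def)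
    have t0D: "t0 \<le> D" using D(2)[of t0] t0(2) by (cases "t0 \<le> D") auto
    have at0: "a \<le> t0"
    proof -
      have "\<Lambda> * (t0 * ?W t0) \<le> \<Lambda> * (t0 * ?m)" using Wm[OF t0(1)] \<Lambda> t0(1) by (intro mult_left_mono) auto
      then have "1 \<le> t0 * (\<Lambda> * ?m)" using t0(2) by (simp add: mult_ac)
      then show ?thesis using \<Lambda> m by (simp add: a_def pos_divide_le_eq)
    qed
    obtain t where t: "t \<in> {a..D}" "\<And>s. s \<in> {a..D} \<Longrightarrow> \<Lambda> * ?W s - 1 / s \<le> \<Lambda> * ?W t - 1 / t"
    proof (rule inner_parallel_functional_attains_max[OF \<Omega>(2) a, of D "\<lambda>t. 1 / t" "\<lambda>_. \<Lambda>" "\<Lambda> * ?m"])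
      show "a \<le> D" using at0 t0D by simp
      show "continuous_on {a..D} (\<lambda>t. 1 / t)" using a by (auto intro!: continuous_intros)
      show "\<Lambda> * ?W t - 1 / t \<le> \<Lambda> * ?m" if "t \<in> {a..D}" for t
      proof -
        have "0 < t" using that a by simp
        then have "\<Lambda> * ?W t \<le> \<Lambda> * ?m" "0 < 1 / t" using Wm \<Lambda> by auto
        then show ?thesis by linarith
      qed
    qed (use \<Lambda> in auto)
    have t_pos: "0 < t" using t(1) a by simp
    have h_t: "h t \<le> h s" if "s \<in> {a..D}" for s using t(2)[OF that] by (simp add: h_def algebra_simps)
    have h_le: "h t \<le> \<Lambda> * ?m" using h_t[of t0] at0 t0D h_iff[OF t0(1)] t0(2) by simp
    have h_all: "h t \<le> h s" if s: "0 < s" for s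
    proof -
      consider "s < a" | "s \<in> {a..D}" | "D < s" by fastforce
      then show ?thesis
      proof cases
        case 1
        then have "\<Lambda> * ?m \<le> 1 / s" using s \<Lambda> m by (simp add: a_def field_simps)
        also have "\<dots> \<le> h s" using Wm[OF s] \<Lambda> by (simp add: h_def)
        finally show ?thesis using h_le by simp
      next
        case 3
        then have "\<Lambda> * ?m \<le> h s" using D(2) s by (simp add: h_def)
        then show ?thesis using h_le by simp
      qed (use h_t in simp)
    qed
    have Jle: "J \<Omega> \<Lambda> (cone_profile \<Omega> t) \<le> J \<Omega> \<Lambda> v" if v: "v \<in> Lip1 \<Omega>" for v
    proof -
      have "J \<Omega> \<Lambda> (cone_profile \<Omega> t) \<le> ereal (h t)"
        unfolding h_def by (rule cone_profile_Lip1(2)[OF \<Omega> t_pos])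
      also from \<Omega> v \<Lambda> have "ereal (h t) \<le> J \<Omega> \<Lambda> v"
      proof (cases rule: J_ge)
        case (2 s)
        have "ereal (h t) \<le> ereal (h s)" using h_all[OF 2(1)] by simp
        then show ?thesis using 2(2) unfolding h_def by (rule order_trans)
      qed (use h_le in simp)
      finally show ?thesis .
    qed
    then have "is_solution \<Omega> \<Lambda> (cone_profile \<Omega> t)"
      using cone_profile_Lip1(1)[OF \<Omega> t_pos] by (auto simp: is_solution_def is_arg_min_def not_less)
    moreover have "inner_parallel \<Omega> t \<noteq> {}"
      using h_iff[OF t_pos] h_le by auto
    ultimately show "\<exists>u. is_solution \<Omega> \<Lambda> u \<and> \<not> u constant_on closure \<Omega>"
      using cone_profile_Lip1(3)[OF \<Omega> t_pos] by blast
  qed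
qed

lemma Bernoulli_const_eq:
  fixes \<Omega> :: "'a::euclidean_space set"
  assumes \<Omega>: "open \<Omega>" "bounded \<Omega>" "convex \<Omega>" "\<Omega> \<noteq> {}"
  obtains t where "0 < t" "0 < measure lebesgue (inner_parallel \<Omega> t)"
    "\<And>s. 0 < s \<Longrightarrow> s * measure lebesgue (inner_parallel \<Omega> s) \<le> t * measure lebesgue (inner_parallel \<Omega> t)"
    "Bernoulli_const \<Omega> = ereal (1 / (t * measure lebesgue (inner_parallel \<Omega> t)))"
proof -
  let ?W = "\<lambda>t. measure lebesgue (inner_parallel \<Omega> t)" and ?m = "measure lebesgue \<Omega>"
  have m: "0 < ?m" using measure_open_pos[OF \<Omega>(1,2,4)] .
  have Wm: "?W t \<le> ?m" if "0 < t" for t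
    using lmeasurable_open_bounded[OF \<Omega>(1,2)] lmeasurable_inner_parallel[OF \<Omega>(2) that] inner_parallel_subset[OF that]
    by (intro measure_mono_fmeasurable) auto
  obtain x r where x: "0 < r" "ball x (r + r) \<subseteq> \<Omega>"
  proof -
    obtain x where "x \<in> \<Omega>" using \<Omega>(4) by blast
    then obtain e where "0 < e" "ball x e \<subseteq> \<Omega>" using \<Omega>(1) by (meson openE)
    then show ?thesis using that[of "e / 2" x] by simp
  qed
  have "ball x r \<subseteq> inner_parallel \<Omega> r"
  proof
    fix y assume y: "y \<in> ball x r"
    have "ball y r \<subseteq> ball x (r + r)"
    proof
      fix z assume "z \<in> ball y r"
      then show "z \<in> ball x (r + r)" using y dist_triangle[of x z y] by simp
    qed
    then show "y \<in> inner_parallel \<Omega> r" using x(2) by (auto simp: inner_parallel_def)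
  qed
  then have "measure lebesgue (ball x r) \<le> ?W r"
    using lmeasurable_inner_parallel[OF \<Omega>(2) x(1)] by (intro measure_mono_fmeasurable) (auto simp: borel_open)
  moreover have "0 < measure lebesgue (ball x r)" using x(1) by (intro measure_open_pos) auto
  ultimately have Wr: "0 < ?W r" by linarith
  obtain D where D: "0 < D" "\<And>t. D < t \<Longrightarrow> inner_parallel \<Omega> t = {}" using inner_parallel_empty[OF \<Omega>(2)] by blast
  define a where "a = r * ?W r / ?m"
  have a: "0 < a" using x(1) Wr m by (simp add: a_def)
  have ar: "a \<le> r" using x(1) Wm[OF x(1)] m by (simp add: a_def pos_divide_le_eq)
  have rD: "r \<le> D" using D(2)[of r] Wr by (cases "r \<le> D") auto
  obtain t where t: "t \<in> {a..D}" "\<And>s. s \<in> {a..D} \<Longrightarrow> s * ?W s - 0 \<le> t * ?W t - 0"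
  proof (rule inner_parallel_functional_attains_max[OF \<Omega>(2) a, of D "\<lambda>_. 0" "\<lambda>t. t" "D * ?m"])
    show "a \<le> D" using ar rD by simp
    show "t * ?W t - 0 \<le> D * ?m" if "t \<in> {a..D}" for t
      using that a Wm[of t] D(1) by (auto intro!: mult_mono)
  qed (use a in auto)
  have t_pos: "0 < t" using t(1) a by simp
  have rt: "r * ?W r \<le> t * ?W t" using t(2)[of r] ar rD by simp
  then have "0 < t * ?W t" using mult_pos_pos[OF x(1) Wr] by linarith
  then have Wt: "0 < ?W t" using t_pos by (simp add: zero_less_mult_iff)
  have max: "s * ?W s \<le> t * ?W t" if s: "0 < s" for s
  proof -
    consider "s < a" | "s \<in> {a..D}" | "D < s" by fastforce
    then show ?thesis
    proof cases
      case 1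
      have "s * ?W s \<le> a * ?m" using 1 s Wm[OF s] by (intro mult_mono) auto
      then show ?thesis using rt m by (simp add: a_def)
    next
      case 3
      then show ?thesis using D(2) t_pos Wt by simp
    qed (use t in simp)
  qed
  let ?M = "t * ?W t"
  have M: "0 < ?M" using t_pos Wt by simp
  have set: "{\<Lambda>. 0 < \<Lambda> \<and> (\<exists>u. is_solution \<Omega> \<Lambda> u \<and> \<not> u constant_on closure \<Omega>)} = {1 / ?M..}"
  proof (intro set_eqI iffI)
    fix \<Lambda> assume "\<Lambda> \<in> {\<Lambda>. 0 < \<Lambda> \<and> (\<exists>u. is_solution \<Omega> \<Lambda> u \<and> \<not> u constant_on closure \<Omega>)}"
    then obtain s where s: "0 < \<Lambda>" "0 < s" "1 \<le> \<Lambda> * (s * ?W s)" using nonconstant_solution_iff[OF \<Omega>] by auto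
    have "1 \<le> \<Lambda> * ?M" using s(3) mult_left_mono[OF max[OF s(2)], of \<Lambda>] s(1) by linarith
    then show "\<Lambda> \<in> {1 / ?M..}" using M by (simp add: pos_divide_le_eq)
  next
    fix \<Lambda> assume L: "\<Lambda> \<in> {1 / ?M..}"
    then have "1 / ?M \<le> \<Lambda>" by simp
    moreover have "0 < 1 / ?M" using M by simp
    ultimately have "0 < \<Lambda>" by linarith
    moreover have "1 \<le> \<Lambda> * ?M" using L M by (simp add: pos_divide_le_eq)
    ultimately show "\<Lambda> \<in> {\<Lambda>. 0 < \<Lambda> \<and> (\<exists>u. is_solution \<Omega> \<Lambda> u \<and> \<not> u constant_on closure \<Omega>)}"
      using nonconstant_solution_iff[OF \<Omega>] t_pos by auto
  qed
  have "Bernoulli_const \<Omega> = ereal (1 / ?M)"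
    unfolding Bernoulli_const_def set by (intro antisym INF_lower2[of "1 / ?M"] INF_greatest) auto
  then show ?thesis using that t_pos Wt max by blast
qed

lemma Brunn_Minkowski_inner_parallel:
  fixes \<Omega> :: "'a::euclidean_space set"
  assumes \<Omega>: "open \<Omega>" "bounded \<Omega>" "convex \<Omega>" and t: "0 < t" and pos: "0 < measure lebesgue (inner_parallel \<Omega> t)"
  shows "root DIM('a) (measure lebesgue (inner_parallel \<Omega> t)) + root DIM('a) (measure lebesgue (ball (0::'a) t))
     \<le> root DIM('a) (measure lebesgue \<Omega>)"
proof -
  let ?A = "interior (inner_parallel \<Omega> t)"
  have mA: "measure lebesgue ?A = measure lebesgue (inner_parallel \<Omega> t)"
    by (rule measure_inner_parallel_interior[OF \<Omega>(3,2) t])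
  then have ne: "?A \<noteq> {}" using pos by auto
  have bdA: "bounded ?A"
    using \<Omega>(2) by (rule bounded_subset) (use interior_subset inner_parallel_subset[OF t] in blast)
  have sub: "?A + ball 0 t \<subseteq> \<Omega>"
    using set_plus_mono2[OF interior_subset order_refl] inner_parallel_plus_ball by (rule order_trans)
  have "BM_ineq ?A (ball 0 t) \<Omega>"
    using t bdA ne sub \<Omega>
    by (intro BM_ineq_mono[OF Brunn_Minkowski_open]) (auto intro!: lmeasurable_open_bounded open_set_plus bounded_set_plus)
  then show ?thesis by (simp add: BM_ineq_def mA)
qed

lemma root_measure_ball:
  fixes c :: "'a::euclidean_space"
  assumes "0 \<le> r"
  shows "root DIM('a) (measure lebesgue (ball c r)) = root DIM('a) (unit_ball_vol (real DIM('a))) * r"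
  using assms by (simp add: content_ball real_root_mult real_root_power_cancel)

lemma inner_parallel_ball:
  fixes c :: "'a::euclidean_space"
  assumes "0 < t" shows "inner_parallel (ball c r) t = cball c (r - t)"
  using assms by (auto simp: inner_parallel_def ball_subset_ball_iff dist_commute)

lemma measure_inner_parallel_le_ball:
  fixes \<Omega> :: "'a::euclidean_space set" and c :: 'a
  assumes \<Omega>: "open \<Omega>" "bounded \<Omega>" "convex \<Omega>" and r: "0 < r"
    and vol: "measure lebesgue (ball c r) = measure lebesgue \<Omega>" and t: "0 < t"
  shows "measure lebesgue (inner_parallel \<Omega> t) \<le> measure lebesgue (inner_parallel (ball c r) t)"
    and "0 < measure lebesgue (inner_parallel \<Omega> t) \<Longrightarrow>
      root DIM('a) (measure lebesgue (inner_parallel (ball c r) t)) + root DIM('a) (measure lebesgue (ball (0::'a) t))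
        = root DIM('a) (measure lebesgue \<Omega>)"
proof -
  let ?\<omega> = "root DIM('a) (unit_ball_vol (real DIM('a)))"
  have \<omega>: "0 < ?\<omega>" by simp
  have key: "root DIM('a) (measure lebesgue (inner_parallel \<Omega> t)) \<le> ?\<omega> * (r - t)"
    if "0 < measure lebesgue (inner_parallel \<Omega> t)"
    using Brunn_Minkowski_inner_parallel[OF \<Omega> t that] root_measure_ball[of t "0::'a"] root_measure_ball[of r c] r t vol
    by (simp add: right_diff_distrib)
  have rt: "t < r" if "0 < measure lebesgue (inner_parallel \<Omega> t)"
  proof -
    have "0 < root DIM('a) (measure lebesgue (inner_parallel \<Omega> t))" using that by simp
    then have "0 < ?\<omega> * (r - t)" using key[OF that] by linarith
    then have "0 < r - t" using \<omega> by (rule zero_less_mult_pos)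
    then show ?thesis by simp
  qed
  have W: "root DIM('a) (measure lebesgue (inner_parallel (ball c r) t)) = ?\<omega> * (r - t)"
    if "0 < measure lebesgue (inner_parallel \<Omega> t)"
    using rt[OF that] by (simp add: inner_parallel_ball[OF t] content_cball real_root_mult real_root_power_cancel)
  show "measure lebesgue (inner_parallel \<Omega> t) \<le> measure lebesgue (inner_parallel (ball c r) t)"
  proof (cases "0 < measure lebesgue (inner_parallel \<Omega> t)")
    case True
    then show ?thesis using key W by (metis real_root_le_iff DIM_positive)
  next
    case False
    then show ?thesis using measure_nonneg[of lebesgue "inner_parallel (ball c r) t"] by linarith
  qed
  show "root DIM('a) (measure lebesgue (inner_parallel (ball c r) t)) + root DIM('a) (measure lebesgue (ball (0::'a) t))
        = root DIM('a) (measure lebesgue \<Omega>)"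
    if p: "0 < measure lebesgue (inner_parallel \<Omega> t)"
    using W[OF p] root_measure_ball[of t "0::'a"] root_measure_ball[of r c] r t vol
    by (simp add: right_diff_distrib)
qed

theorem Bernoulli_const_ball_le:
  fixes \<Omega> :: "'a::euclidean_space set" and c :: 'a
  assumes \<Omega>: "open \<Omega>" "bounded \<Omega>" "convex \<Omega>" "\<Omega> \<noteq> {}" and r: "0 < r"
    and vol: "measure lebesgue (ball c r) = measure lebesgue \<Omega>"
  shows "Bernoulli_const (ball c r) \<le> Bernoulli_const \<Omega>"
    and "Bernoulli_const \<Omega> = Bernoulli_const (ball c r) \<Longrightarrow> \<exists>a s. 0 < s \<and> \<Omega> = ball a s"
proof -
  let ?W = "\<lambda>t. measure lebesgue (inner_parallel \<Omega> t)" and ?V = "\<lambda>t. measure lebesgue (inner_parallel (ball c r) t)"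
  obtain t where t: "0 < t" "0 < ?W t" "Bernoulli_const \<Omega> = ereal (1 / (t * ?W t))"
    using Bernoulli_const_eq[OF \<Omega>] by metis
  have b: "open (ball c r)" "bounded (ball c r)" "convex (ball c r)" "ball c r \<noteq> {}" using r by auto
  obtain s where s: "0 < s" "0 < ?V s" "\<And>x. 0 < x \<Longrightarrow> x * ?V x \<le> s * ?V s" "Bernoulli_const (ball c r) = ereal (1 / (s * ?V s))"
    using Bernoulli_const_eq[OF b] by metis
  have WV: "?W t \<le> ?V t" by (rule measure_inner_parallel_le_ball(1)[OF \<Omega>(1,2,3) r vol t(1)])
  then have 1: "t * ?W t \<le> t * ?V t" using t(1) by simp
  also have 2: "t * ?V t \<le> s * ?V s" by (rule s(3)[OF t(1)])
  finally show "Bernoulli_const (ball c r) \<le> Bernoulli_const \<Omega>"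
    using t s by (simp add: frac_le)
  assume "Bernoulli_const \<Omega> = Bernoulli_const (ball c r)"
  then have "1 / (t * ?W t) = 1 / (s * ?V s)" using t(3) s(4) by simp
  then have "t * ?W t = s * ?V s" using t s by (simp add: divide_eq_eq)
  then have "t * ?V t = t * ?W t" using 1 2 by linarith
  then have "?V t = ?W t" using t(1) by simp
  then have "root DIM('a) (measure lebesgue \<Omega>) \<le> root DIM('a) (?W t) + root DIM('a) (measure lebesgue (ball (0::'a) t))"
    using measure_inner_parallel_le_ball(2)[OF \<Omega>(1,2,3) r vol t(1,2)] by simp
  then show "\<exists>a s. 0 < s \<and> \<Omega> = ball a s"
    by (rule inner_parallel_rigidity[OF \<Omega>(1,2,3) t(1) _ t(2)])
qed

theorem theorem6:
  fixes \<Omega> :: "(real ^ 'n) set" and c :: "real ^ 'n" and r :: real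
  assumes "CARD('n) \<ge> 2"
    and "\<Omega> \<noteq> {}" and "open \<Omega>" and "bounded \<Omega>" and "convex \<Omega>"
    and "0 < r" and "measure lebesgue (ball c r) = measure lebesgue \<Omega>"
  shows "Bernoulli_const \<Omega> \<ge> Bernoulli_const (ball c r) \<and>
    (Bernoulli_const \<Omega> = Bernoulli_const (ball c r) \<longleftrightarrow> (\<exists>a s. 0 < s \<and> \<Omega> = ball a s))"
proof -
  note le = Bernoulli_const_ball_le[OF assms(3,4,5,2,6,7)]
  have "Bernoulli_const \<Omega> = Bernoulli_const (ball c r)" if s: "0 < s" and \<Omega>: "\<Omega> = ball a s" for a s
  proof (rule antisym)
    show "Bernoulli_const (ball c r) \<le> Bernoulli_const \<Omega>" by (rule le(1))
    show "Bernoulli_const \<Omega> \<le> Bernoulli_const (ball c r)"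
      unfolding \<Omega> using assms(6,7) s \<Omega> by (intro Bernoulli_const_ball_le(1)) auto
  qed
  then show ?thesis using le by blast
qed

end
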